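(* Let $(W,D)$ be a contact manifold of dimension $2n+1$ over $\mathbb K=\mathbb R$ or $\mathbb C$, $N$ an $n$-dimensional manifold, $f:(N,x_0)\to W$ an integral map-germ, and $\alpha$ a contact form defining $D$ near $w_0=f(x_0)$. Then $VI_f$ is an $\mathcal E_W$-module by the multiplication $$H*v=f^*H\cdot v+(i_v\alpha)\,(X_H-H\cdot R)\circ f,\qquad H\in\mathcal E_W,\ v\in VI_f .$$ The multiplication is independent of the choice of the contact form $\alpha$; it depends only on the contact structure (and on $H,v$). Moreover the sequence $$0\longrightarrow VI_f'\longrightarrow VI_f\stackrel{e}{\longrightarrow}R_f\longrightarrow0$$ is an exact sequence of $\mathcal E_W$-modules, where $e(v)=i_v\alpha$ and $VI_f'=\ker e$.
   Context: All manifolds and mappings are $C^\infty$ if $\mathbb K=\mathbb R$ and complex analytic if $\mathbb K=\mathbb C$. $\mathcal E_N=\mathcal E_{N,x_0}$ and $\mathcal E_W=\mathcal E_{W,w_0}$ are algebras of function-germs. A map-germ $f$ is integral if $f_*(T_xN)\subset D_{f(x)}$ for all $x$ near $x_0$. $V_f$ is the $\mathcal E_N$-module of vector field germs $v:(N,x_0)\to TW$ along $f$; the module addition of $VI_f\subset V_f$ is the one of $V_f$, and "$\cdot$" denotes ordinary multiplication in $V_f$. For $v\in V_f$, $i_v\alpha\in\mathcal E_N$ is $x\mapsto\alpha(v(x))$, and $L_v\alpha:=\frac{d}{dt}|_{t=0}F_t^*\alpha$ for any deformation $F_t$ of $f$ with velocity $v$ at $t=0$. $VI_f=\{v\in V_f\mid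 L_v\alpha=0\}$, the space of infinitesimal integral deformations of $f$. $R_f=\{h\in\mathcal E_N\mid dh\in\mathcal E_N\,d(f^*\mathcal E_W)\}$, an $\mathcal E_W$-module via $f^*:\mathcal E_W\to\mathcal E_N$. $R$ is the Reeb vector field of $\alpha$: $i_R\alpha=1$, $i_Rd\alpha=0$. For $H\in\mathcal E_W$, $X_H$ is the contact Hamilton vector field of $H$ with respect to $\alpha$: the unique vector field germ with $i_{X_H}\alpha=H$ and $L_{X_H}\alpha=\mu\alpha$ for some function $\mu$. *)

theory Defs
  imports "HOL-Analysis.Analysis" "HOL-Algebra.Module" "HOL-Algebra.Coset"
begin

text \<open>
  The ground field is a type \<open>'k\<close> of sort \<open>{real_normed_field, euclidean_space}\<close>. By Frobenius'
  theorem, the types of this sort are, up to isometric isomorphism, exactly \<open>real\<close> and \<open>complex\<close>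
  (both are instances), so a statement about all such \<open>'k\<close> is a statement about both fields.
\<close>

section \<open>Smooth maps over \<open>'k\<close>\<close>

fun Cr_on :: "nat \<Rightarrow> 'a::real_normed_vector set \<Rightarrow> ('a \<Rightarrow> 'b::real_normed_vector) \<Rightarrow> bool" where
  "Cr_on 0 S f \<longleftrightarrow> continuous_on S f"
| "Cr_on (Suc r) S f \<longleftrightarrow>
     (\<forall>x\<in>S. f differentiable (at x)) \<and> (\<forall>v. Cr_on r S (\<lambda>x. frechet_derivative f (at x) v))"

text \<open>
  For an open set in a finite-dimensional space: infinitely differentiable in the real sense, with
  \<open>'k\<close>-linear derivative at every point. Over the reals the linearity condition is void; over the
  complex numbers it is the system of Cauchy-Riemann equations, so these are the holomorphic
  (i.e. complex analytic) maps. The scalar multiplications of source and target are arguments.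
\<close>
definition smooth_on ::
  "('k::{real_normed_field,euclidean_space} \<Rightarrow> 'a \<Rightarrow> 'a) \<Rightarrow> ('k \<Rightarrow> 'b \<Rightarrow> 'b) \<Rightarrow>
   'a::real_normed_vector set \<Rightarrow> ('a \<Rightarrow> 'b::real_normed_vector) \<Rightarrow> bool" where
  "smooth_on s s' S f \<longleftrightarrow>
     (\<forall>r. Cr_on r S f) \<and> (\<forall>x\<in>S. Vector_Spaces.linear s s' (frechet_derivative f (at x)))"

section \<open>Manifolds\<close>

type_synonym ('a, 'k, 'm) chart = "'a set \<times> ('a \<Rightarrow> 'k ^ 'm)"

abbreviation chart_inv :: "('a, 'k, 'm) chart \<Rightarrow> 'k ^ 'm \<Rightarrow> 'a" where
  "chart_inv c \<equiv> inv_into (fst c) (snd c)"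

text \<open>
  An atlas of dimension \<open>CARD('m)\<close> over \<open>'k\<close> on the whole type \<open>'a\<close>. It need not be
  maximal: the notions below depend only on the structure it generates.
\<close>
definition manifold ::
  "('a::{t2_space,second_countable_topology}, 'k::{real_normed_field,euclidean_space}, 'm::finite) chart set
   \<Rightarrow> bool" where
  "manifold A \<longleftrightarrow>
     (\<Union>c\<in>A. fst c) = UNIV \<and>
     (\<forall>c\<in>A. open (fst c) \<and> open (snd c ` fst c) \<and>
             homeomorphism (fst c) (snd c ` fst c) (snd c) (chart_inv c)) \<and>
     (\<forall>c\<in>A. \<forall>c'\<in>A. smooth_on (*s) (*s) (snd c ` (fst c \<inter> fst c')) (snd c' \<circ> chart_inv c))"

definition charts_at :: "('a, 'k, 'm) chart set \<Rightarrow> 'a \<Rightarrow> ('a, 'k, 'm) chart set" where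
  "charts_at A p = {c\<in>A. p \<in> fst c}"

definition some_chart :: "('a, 'k, 'm) chart set \<Rightarrow> 'a \<Rightarrow> ('a, 'k, 'm) chart" where
  "some_chart A p = (SOME c. c \<in> charts_at A p)"

text \<open>Smoothness near \<open>p\<close> of a map into a \<open>'k\<close>-vector space with scalar multiplication \<open>s\<close>.\<close>
definition smooth_at ::
  "('a::topological_space, 'k::{real_normed_field,euclidean_space}, 'm::finite) chart set \<Rightarrow>
   ('k \<Rightarrow> 'b \<Rightarrow> 'b) \<Rightarrow> 'a \<Rightarrow> ('a \<Rightarrow> 'b::real_normed_vector) \<Rightarrow> bool" where
  "smooth_at A s p h \<longleftrightarrow>
     (\<exists>c\<in>charts_at A p. \<exists>S. open S \<and> snd c p \<in> S \<and> S \<subseteq> snd c ` fst c \<and>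
        smooth_on (*s) s S (h \<circ> chart_inv c))"

definition smooth_map_at ::
  "('a::topological_space, 'k::{real_normed_field,euclidean_space}, 'n::finite) chart set \<Rightarrow>
   ('b::topological_space, 'k, 'm::finite) chart set \<Rightarrow> 'a \<Rightarrow> ('a \<Rightarrow> 'b) \<Rightarrow> bool" where
  "smooth_map_at A B p f \<longleftrightarrow>
     (\<exists>c'\<in>charts_at B (f p). (\<forall>\<^sub>F x in nhds p. f x \<in> fst c') \<and> smooth_at A (*s) p (snd c' \<circ> f))"

section \<open>Tangent vectors and differentials\<close>

text \<open>
  A tangent vector at \<open>p\<close> is the family of its components in all charts around \<open>p\<close>, related by the
  derivatives of the coordinate changes; the other entries of the family are fixed to be 0.
\<close>
type_synonym ('a, 'k, 'm) tangent = "('a, 'k, 'm) chart \<Rightarrow> 'k ^ 'm"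

definition tangent_space ::
  "('a, 'k::{real_normed_field,euclidean_space}, 'm::finite) chart set \<Rightarrow> 'a \<Rightarrow> ('a, 'k, 'm) tangent set" where
  "tangent_space A p = {u.
     (\<forall>c. c \<notin> charts_at A p \<longrightarrow> u c = 0) \<and>
     (\<forall>c\<in>charts_at A p. \<forall>c'\<in>charts_at A p.
        u c' = frechet_derivative (snd c' \<circ> chart_inv c) (at (snd c p)) (u c))}"

definition tadd :: "('a, 'k::real_normed_field, 'm::finite) tangent \<Rightarrow> ('a, 'k, 'm) tangent \<Rightarrow> ('a, 'k, 'm) tangent" where
  "tadd u v = (\<lambda>c. u c + v c)"

definition tscale :: "'k::real_normed_field \<Rightarrow> ('a, 'k, 'm::finite) tangent \<Rightarrow> ('a, 'k, 'm) tangent" where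
  "tscale k u = (\<lambda>c. k *s u c)"

text \<open>The tangent vector at \<open>p\<close> with components \<open>\<xi>\<close> in the chart \<open>c\<close>.\<close>
definition coord_vec ::
  "('a, 'k::{real_normed_field,euclidean_space}, 'm::finite) chart set \<Rightarrow> ('a, 'k, 'm) chart \<Rightarrow> 'k ^ 'm \<Rightarrow>
   'a \<Rightarrow> ('a, 'k, 'm) tangent" where
  "coord_vec A c \<xi> p =
     (\<lambda>c'. if c' \<in> charts_at A p
           then frechet_derivative (snd c' \<circ> chart_inv c) (at (snd c p)) \<xi> else 0)"

text \<open>The tangent map \<open>f\<^sub>* : T\<^sub>x \<rightarrow> T\<^bsub>f x\<^esub>\<close>.\<close>
definition tangent_map ::
  "('a, 'k::{real_normed_field,euclidean_space}, 'n::finite) chart set \<Rightarrow> ('b, 'k, 'm::finite) chart set \<Rightarrow>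
   ('a \<Rightarrow> 'b) \<Rightarrow> 'a \<Rightarrow> ('a, 'k, 'n) tangent \<Rightarrow> ('b, 'k, 'm) tangent" where
  "tangent_map A B f x u =
     (\<lambda>c'. if c' \<in> charts_at B (f x)
           then let c = some_chart A x
                in frechet_derivative (snd c' \<circ> f \<circ> chart_inv c) (at (snd c x)) (u c)
           else 0)"

definition differential ::
  "('a, 'k::{real_normed_field,euclidean_space}, 'n::finite) chart set \<Rightarrow> ('a \<Rightarrow> 'k) \<Rightarrow>
   'a \<Rightarrow> ('a, 'k, 'n) tangent \<Rightarrow> 'k" where
  "differential A h x u =
     (let c = some_chart A x in frechet_derivative (h \<circ> chart_inv c) (at (snd c x)) (u c))"

section \<open>Contact forms and contact structures\<close>

type_synonym ('a, 'k, 'm) form = "'a \<Rightarrow> ('a, 'k, 'm) tangent \<Rightarrow> 'k"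

definition one_form_at ::
  "('a::topological_space, 'k::{real_normed_field,euclidean_space}, 'm::finite) chart set \<Rightarrow> 'a \<Rightarrow>
   ('a, 'k, 'm) form \<Rightarrow> bool" where
  "one_form_at A p \<alpha> \<longleftrightarrow>
     (\<forall>\<^sub>F q in nhds p. \<forall>u\<in>tangent_space A q. \<forall>v\<in>tangent_space A q. \<forall>k.
        \<alpha> q (tadd u v) = \<alpha> q u + \<alpha> q v \<and> \<alpha> q (tscale k u) = k * \<alpha> q u) \<and>
     (\<exists>c\<in>charts_at A p. \<forall>\<xi>. smooth_at A (*) p (\<lambda>q. \<alpha> q (coord_vec A c \<xi> q)))"

text \<open>
  \<open>d\<alpha>(u, v) = u(\<alpha>(V)) - v(\<alpha>(U))\<close>, where \<open>U\<close>, \<open>V\<close> extend \<open>u\<close>, \<open>v\<close> with constant components in a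
  chart (so that \<open>[U, V] = 0\<close>).
\<close>
definition ext_deriv ::
  "('a, 'k::{real_normed_field,euclidean_space}, 'm::finite) chart set \<Rightarrow> ('a, 'k, 'm) form \<Rightarrow>
   'a \<Rightarrow> ('a, 'k, 'm) tangent \<Rightarrow> ('a, 'k, 'm) tangent \<Rightarrow> 'k" where
  "ext_deriv A \<alpha> q u v =
     (let c = some_chart A q in
      frechet_derivative (\<lambda>y. \<alpha> (chart_inv c y) (coord_vec A c (v c) (chart_inv c y))) (at (snd c q)) (u c)
    - frechet_derivative (\<lambda>y. \<alpha> (chart_inv c y) (coord_vec A c (u c) (chart_inv c y))) (at (snd c q)) (v c))"

text \<open>A 1-form near \<open>p\<close> that vanishes nowhere and whose \<open>d\<alpha>\<close> is nondegenerate on \<open>ker \<alpha>\<close>.\<close>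
definition contact_form_at ::
  "('a::topological_space, 'k::{real_normed_field,euclidean_space}, 'm::finite) chart set \<Rightarrow> 'a \<Rightarrow>
   ('a, 'k, 'm) form \<Rightarrow> bool" where
  "contact_form_at A p \<alpha> \<longleftrightarrow>
     one_form_at A p \<alpha> \<and>
     (\<forall>\<^sub>F q in nhds p.
        (\<exists>u\<in>tangent_space A q. \<alpha> q u \<noteq> 0) \<and>
        (\<forall>u\<in>tangent_space A q.
           \<alpha> q u = 0 \<and> (\<forall>v\<in>tangent_space A q. \<alpha> q v = 0 \<longrightarrow> ext_deriv A \<alpha> q u v = 0)
           \<longrightarrow> u = (\<lambda>_. 0)))"

definition defines_near ::
  "('a::topological_space, 'k::{real_normed_field,euclidean_space}, 'm::finite) chart set \<Rightarrow>
   ('a \<Rightarrow> ('a, 'k, 'm) tangent set) \<Rightarrow> 'a \<Rightarrow> ('a, 'k, 'm) form \<Rightarrow> bool" where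
  "defines_near A D p \<alpha> \<longleftrightarrow> (\<forall>\<^sub>F q in nhds p. D q = {u \<in> tangent_space A q. \<alpha> q u = 0})"

definition contact_structure ::
  "('a::topological_space, 'k::{real_normed_field,euclidean_space}, 'm::finite) chart set \<Rightarrow>
   ('a \<Rightarrow> ('a, 'k, 'm) tangent set) \<Rightarrow> bool" where
  "contact_structure A D \<longleftrightarrow> (\<forall>p. \<exists>\<alpha>. contact_form_at A p \<alpha> \<and> defines_near A D p \<alpha>)"

definition integral_at ::
  "('a::topological_space, 'k::{real_normed_field,euclidean_space}, 'n::finite) chart set \<Rightarrow>
   ('b, 'k, 'm::finite) chart set \<Rightarrow> ('b \<Rightarrow> ('b, 'k, 'm) tangent set) \<Rightarrow> 'a \<Rightarrow> ('a \<Rightarrow> 'b) \<Rightarrow> bool" where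
  "integral_at A B D p f \<longleftrightarrow>
     (\<forall>\<^sub>F x in nhds p. tangent_map A B f x ` tangent_space A x \<subseteq> D (f x))"

section \<open>Vector fields along a map, deformations, Lie derivative\<close>

definition vf_along ::
  "('a::topological_space, 'k::{real_normed_field,euclidean_space}, 'n::finite) chart set \<Rightarrow>
   ('b, 'k, 'm::finite) chart set \<Rightarrow> 'a \<Rightarrow> ('a \<Rightarrow> 'b) \<Rightarrow> ('a \<Rightarrow> ('b, 'k, 'm) tangent) \<Rightarrow> bool" where
  "vf_along A B p f v \<longleftrightarrow>
     (\<forall>\<^sub>F x in nhds p. v x \<in> tangent_space B (f x)) \<and>
     (\<exists>c\<in>charts_at B (f p). smooth_at A (*s) p (\<lambda>x. v x c))"

text \<open>\<open>F\<close> is a deformation of the germ of \<open>f\<close> at \<open>p\<close>, smooth in \<open>(t, x)\<close> near \<open>(0, p)\<close>, with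
  velocity \<open>v\<close> at \<open>t = 0\<close>.\<close>
definition deformation ::
  "('a::topological_space, 'k::{real_normed_field,euclidean_space}, 'n::finite) chart set \<Rightarrow>
   ('b, 'k, 'm::finite) chart set \<Rightarrow> 'a \<Rightarrow> ('a \<Rightarrow> 'b) \<Rightarrow> ('a \<Rightarrow> ('b, 'k, 'm) tangent) \<Rightarrow>
   ('k \<Rightarrow> 'a \<Rightarrow> 'b) \<Rightarrow> bool" where
  "deformation A B p f v F \<longleftrightarrow>
     (\<forall>\<^sub>F x in nhds p. F 0 x = f x) \<and>
     (\<exists>c\<in>charts_at A p. \<exists>c'\<in>charts_at B (f p). \<exists>S.
        open S \<and> (0, snd c p) \<in> S \<and>
        (\<forall>(t, y)\<in>S. y \<in> snd c ` fst c \<and> F t (chart_inv c y) \<in> fst c') \<and>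
        smooth_on (\<lambda>k (t, y). (k * t, k *s y)) (*s) S (\<lambda>(t, y). snd c' (F t (chart_inv c y)))) \<and>
     (\<forall>\<^sub>F x in nhds p. \<forall>c'\<in>charts_at B (f x).
        v x c' = frechet_derivative (\<lambda>t. snd c' (F t x)) (at 0) 1)"

text \<open>
  \<open>L\<^sub>v\<alpha> = d/dt F\<^sub>t\<^sup>*\<alpha>\<close> at \<open>t = 0\<close>, for any deformation \<open>F\<close> of \<open>f\<close> with velocity \<open>v\<close>. For \<open>f = id\<close> it is
  the Lie derivative along a vector field.
\<close>
definition lie_deriv ::
  "('a::topological_space, 'k::{real_normed_field,euclidean_space}, 'n::finite) chart set \<Rightarrow>
   ('b, 'k, 'm::finite) chart set \<Rightarrow> 'a \<Rightarrow> ('a \<Rightarrow> 'b) \<Rightarrow> ('a \<Rightarrow> ('b, 'k, 'm) tangent) \<Rightarrow>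
   ('b, 'k, 'm) form \<Rightarrow> ('a, 'k, 'n) form" where
  "lie_deriv A B p f v \<alpha> x \<xi> =
     (let F = (SOME F. deformation A B p f v F)
      in frechet_derivative (\<lambda>t. \<alpha> (F t x) (tangent_map A B (F t) x \<xi>)) (at 0) 1)"

section \<open>Germs\<close>

definition germ :: "'a::topological_space \<Rightarrow> ('a \<Rightarrow> 'b) \<Rightarrow> ('a \<Rightarrow> 'b) set" where
  "germ p h = {g. \<forall>\<^sub>F x in nhds p. g x = h x}"

definition rep :: "('a \<Rightarrow> 'b) set \<Rightarrow> 'a \<Rightarrow> 'b" where
  "rep G = (SOME h. h \<in> G)"

definition fun_germs ::
  "('a::topological_space, 'k::{real_normed_field,euclidean_space}, 'm::finite) chart set \<Rightarrow> 'a \<Rightarrow>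
   ('a \<Rightarrow> 'k) set ring" where
  "fun_germs A p =
     \<lparr>carrier = germ p ` {h. smooth_at A (*) p h},
      mult = (\<lambda>G H. germ p (\<lambda>x. rep G x * rep H x)),
      one = germ p (\<lambda>_. 1),
      zero = germ p (\<lambda>_. 0),
      add = (\<lambda>G H. germ p (\<lambda>x. rep G x + rep H x))\<rparr>"

text \<open>\<open>f\<^sup>*H\<close> and \<open>i\<^sub>v\<alpha>\<close> as germs at \<open>p\<close>.\<close>
definition pullback :: "'a::topological_space \<Rightarrow> ('a \<Rightarrow> 'b) \<Rightarrow> ('b \<Rightarrow> 'k) set \<Rightarrow> ('a \<Rightarrow> 'k) set" where
  "pullback p f H = germ p (\<lambda>x. rep H (f x))"

definition contraction ::
  "'a::topological_space \<Rightarrow> ('a \<Rightarrow> 'b) \<Rightarrow> ('b, 'k, 'm) form \<Rightarrow> ('a \<Rightarrow> ('b, 'k, 'm) tangent) set \<Rightarrow> ('a \<Rightarrow> 'k) set" where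
  "contraction p f \<alpha> v = germ p (\<lambda>x. \<alpha> (f x) (rep v x))"

section \<open>Reeb and contact Hamilton vector fields\<close>

definition reeb ::
  "('b::topological_space, 'k::{real_normed_field,euclidean_space}, 'm::finite) chart set \<Rightarrow> 'b \<Rightarrow>
   ('b, 'k, 'm) form \<Rightarrow> ('b \<Rightarrow> ('b, 'k, 'm) tangent) set" where
  "reeb B q \<alpha> = (THE R. \<exists>Y. R = germ q Y \<and> vf_along B B q id Y \<and>
     (\<forall>\<^sub>F w in nhds q. \<alpha> w (Y w) = 1 \<and> (\<forall>u\<in>tangent_space B w. ext_deriv B \<alpha> w (Y w) u = 0)))"

definition ham_field ::
  "('b::topological_space, 'k::{real_normed_field,euclidean_space}, 'm::finite) chart set \<Rightarrow> 'b \<Rightarrow>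
   ('b, 'k, 'm) form \<Rightarrow> ('b \<Rightarrow> 'k) set \<Rightarrow> ('b \<Rightarrow> ('b, 'k, 'm) tangent) set" where
  "ham_field B q \<alpha> H = (THE X. \<exists>Y. X = germ q Y \<and> vf_along B B q id Y \<and>
     (\<forall>\<^sub>F w in nhds q. \<alpha> w (Y w) = rep H w) \<and>
     (\<exists>\<mu>. smooth_at B (*) q \<mu> \<and>
        (\<forall>\<^sub>F w in nhds q. \<forall>u\<in>tangent_space B w. lie_deriv B B q id Y \<alpha> w u = \<mu> w * \<alpha> w u)))"

section \<open>The modules\<close>

definition VI_carrier ::
  "('a::topological_space, 'k::{real_normed_field,euclidean_space}, 'n::finite) chart set \<Rightarrow>
   ('b, 'k, 'm::finite) chart set \<Rightarrow> 'a \<Rightarrow> ('a \<Rightarrow> 'b) \<Rightarrow> ('b, 'k, 'm) form \<Rightarrow>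
   ('a \<Rightarrow> ('b, 'k, 'm) tangent) set set" where
  "VI_carrier A B p f \<alpha> = germ p ` {v. vf_along A B p f v \<and>
     (\<forall>\<^sub>F x in nhds p. \<forall>\<xi>\<in>tangent_space A x. lie_deriv A B p f v \<alpha> x \<xi> = 0)}"

text \<open>\<open>H * v = f\<^sup>*H \<cdot> v + (i\<^sub>v\<alpha>) (X\<^sub>H - H \<cdot> R) \<circ> f\<close>\<close>
definition star ::
  "('b::topological_space, 'k::{real_normed_field,euclidean_space}, 'm::finite) chart set \<Rightarrow>
   'a::topological_space \<Rightarrow> ('a \<Rightarrow> 'b) \<Rightarrow> ('b, 'k, 'm) form \<Rightarrow>
   ('b \<Rightarrow> 'k) set \<Rightarrow> ('a \<Rightarrow> ('b, 'k, 'm) tangent) set \<Rightarrow> ('a \<Rightarrow> ('b, 'k, 'm) tangent) set" where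
  "star B p f \<alpha> H v = germ p (\<lambda>x c.
     rep (pullback p f H) x *s rep v x c +
     rep (contraction p f \<alpha> v) x *s
       (rep (ham_field B (f p) \<alpha> H) (f x) c - rep H (f x) *s rep (reeb B (f p) \<alpha>) (f x) c))"

text \<open>The ring fields \<open>mult\<close> and \<open>one\<close> of a module record play no role.\<close>
definition VI ::
  "('a::topological_space, 'k::{real_normed_field,euclidean_space}, 'n::finite) chart set \<Rightarrow>
   ('b::topological_space, 'k, 'm::finite) chart set \<Rightarrow> 'a \<Rightarrow> ('a \<Rightarrow> 'b) \<Rightarrow> ('b, 'k, 'm) form \<Rightarrow>
   (('b \<Rightarrow> 'k) set, ('a \<Rightarrow> ('b, 'k, 'm) tangent) set) module" where
  "VI A B p f \<alpha> =
     \<lparr>carrier = VI_carrier A B p f \<alpha>,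
      mult = undefined,
      one = undefined,
      zero = germ p (\<lambda>_ _. 0),
      add = (\<lambda>u v. germ p (\<lambda>x. tadd (rep u x) (rep v x))),
      smult = star B p f \<alpha>\<rparr>"

text \<open>\<open>R\<^sub>f\<close>: membership says that \<open>dh\<close> is a finite sum of terms \<open>a\<^sub>i d(f\<^sup>*H\<^sub>i)\<close>.\<close>
definition R_mod ::
  "('a::topological_space, 'k::{real_normed_field,euclidean_space}, 'n::finite) chart set \<Rightarrow>
   ('b::topological_space, 'k, 'm::finite) chart set \<Rightarrow> 'a \<Rightarrow> ('a \<Rightarrow> 'b) \<Rightarrow>
   (('b \<Rightarrow> 'k) set, ('a \<Rightarrow> 'k) set) module" where
  "R_mod A B p f =
     \<lparr>carrier = germ p ` {h. smooth_at A (*) p h \<and>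
        (\<exists>(r::nat) a H. (\<forall>i<r. smooth_at A (*) p (a i) \<and> smooth_at B (*) (f p) (H i)) \<and>
           (\<forall>\<^sub>F x in nhds p. \<forall>\<xi>\<in>tangent_space A x.
              differential A h x \<xi> = (\<Sum>i<r. a i x * differential A (H i \<circ> f) x \<xi>)))},
      mult = mult (fun_germs A p),
      one = one (fun_germs A p),
      zero = zero (fun_germs A p),
      add = add (fun_germs A p),
      smult = (\<lambda>H h. mult (fun_germs A p) (pullback p f H) h)\<rparr>"

definition module_homs ::
  "('r, 's) ring_scheme \<Rightarrow> ('r, 'u, 'x) module_scheme \<Rightarrow> ('r, 'v, 'y) module_scheme \<Rightarrow> ('u \<Rightarrow> 'v) set" where
  "module_homs E M M' = {h \<in> hom (add_monoid M) (add_monoid M').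
     \<forall>r\<in>carrier E. \<forall>u\<in>carrier M. h (r \<odot>\<^bsub>M\<^esub> u) = r \<odot>\<^bsub>M'\<^esub> h u}"

definition short_exact ::
  "('r, 's) ring_scheme \<Rightarrow> ('r, 'u, 'x) module_scheme \<Rightarrow> ('u \<Rightarrow> 'v) \<Rightarrow> ('r, 'v, 'y) module_scheme \<Rightarrow>
   ('v \<Rightarrow> 'w) \<Rightarrow> ('r, 'w, 'z) module_scheme \<Rightarrow> bool" where
  "short_exact E M1 i M2 e M3 \<longleftrightarrow>
     Module.module E M1 \<and> Module.module E M2 \<and> Module.module E M3 \<and>
     i \<in> module_homs E M1 M2 \<and> e \<in> module_homs E M2 M3 \<and>
     inj_on i (carrier M1) \<and>
     i ` carrier M1 = kernel (add_monoid M2) (add_monoid M3) e \<and>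
     e ` carrier M2 = carrier M3"

end

theory Submission
  imports Defs
begin

text \<open>
  By Cartan's formula, \<open>L\<^sub>v\<alpha> = d\<alpha>(v, f\<^sub>*\<cdot>) + d(\<alpha>(v))\<close>, so \<open>VI\<^sub>f\<close> is cut out by a first-order linear
  equation. Since \<open>d\<alpha> + \<alpha> \<otimes> \<alpha>\<close> is nondegenerate, every 1-form is represented by a smooth vector
  field; this gives \<open>R\<close>, and for each \<open>H\<close> a field \<open>Z\<^sub>H\<close> in the contact hyperplanes with
  \<open>d\<alpha>(Z\<^sub>H, \<cdot>) = - dH\<close> there, and \<open>X\<^sub>H = H R + Z\<^sub>H\<close>. Hence \<open>H * v = f\<^sup>*H v + \<alpha>(v) Z\<^sub>H \<circ> f\<close>, and the
  module laws say that \<open>H \<mapsto> Z\<^sub>H\<close> is a derivation with values in \<open>ker \<alpha>\<close>. As \<open>f\<close> is integral,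
  \<open>d\<alpha>(Z\<^sub>H \<circ> f, f\<^sub>*\<cdot>) = - d(f\<^sup>*H)\<close>; so \<open>H * v\<close> is again infinitesimally integral, and if
  \<open>dh = \<Sum> a\<^sub>i d(f\<^sup>*H\<^sub>i)\<close> then \<open>h R \<circ> f + \<Sum> a\<^sub>i Z\<^bsub>H i\<^esub> \<circ> f\<close> is a preimage of \<open>h\<close> under \<open>e\<close>. For another
  contact form \<open>\<beta> = g \<alpha>\<close> one finds \<open>L\<^sub>v\<beta> = f\<^sup>*g L\<^sub>v\<alpha>\<close> along \<open>f\<close>, and \<open>Z\<^sub>H\<close> is divided by \<open>g\<close>, which cancels
  the factor \<open>g\<close> in \<open>\<beta>(v)\<close>.
\<close>

section \<open>Smooth maps in flat space\<close>

text \<open>Multiplying v by the pullback of H alone destroys L_v \<alpha> = 0: the defect is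
  \<alpha>(v) times the differential of that pullback. The summand \<alpha>(v) Z_H, being
  annihilated by \<alpha>, contributes only through d\<alpha> and cancels it; this is where the
  correction term comes from. Adding \<alpha> tensor \<alpha> repairs the degeneracy of d\<alpha>
  along R, so that R and Z_H solve square linear systems in one chart, smoothly by Cramer's rule,
  with no frame of the hyperplanes. The obstacle is choice: \<open>differential\<close>,
  \<open>tangent_map\<close> and \<open>ext_deriv\<close> pick a chart by \<open>SOME\<close> anew
  at every point, and \<open>lie_deriv\<close> picks a deformation by \<open>SOME\<close>. Nothing
  can be differentiated in the point before such values are shown to be independent of the pick. For
  d\<alpha> and for L_v \<alpha> this comes from one identity in flat space,
  \<open>flat_naturality\<close>, which rests on the symmetry of second derivatives; the same
  symmetry shows that derivatives of smooth maps over \<open>'k\<close> are again smooth over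
  \<open>'k\<close>. That R_f is a module is not checked axiom by axiom: it is the image of VI_f
  under e.\<close>

abbreviation FD :: "('a::real_normed_vector \<Rightarrow> 'b::real_normed_vector) \<Rightarrow> 'a \<Rightarrow> 'a \<Rightarrow> 'b" where
  "FD f x \<equiv> frechet_derivative f (at x)"

section \<open>Calculus of r-fold differentiable maps over the reals\<close>

lemma FD_eq: "(f has_derivative f') (at x) \<Longrightarrow> FD f x = f'"
  by (metis frechet_derivative_at)

text \<open>\<open>frechet_derivative\<close> picks one among all derivatives at the point.
  Functions that agree near x have the same set of derivatives, hence the same pick, even where that
  set is empty.\<close>

lemma FD_cong:
  assumes "\<forall>\<^sub>F y in nhds x. f y = g y"
  shows "FD f x = FD g x"
proof -
  have "f x = g x" "\<forall>\<^sub>F y in at x. f y = g y"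
    using assms eventually_nhds_x_imp_x by (auto simp: eventually_nhds_conv_at)
  then have "(f has_derivative f') (at x) \<longleftrightarrow> (g has_derivative f') (at x)" for f'
    by (intro iffI; (elim has_derivative_transform_eventually)) (auto elim: eventually_mono)
  then show ?thesis
    unfolding frechet_derivative_def by simp
qed

lemma differentiable_cong_nhds:
  assumes "\<forall>\<^sub>F y in nhds x. f y = g y" "f differentiable (at x)"
  shows "g differentiable (at x)"
proof -
  have "f x = g x" "\<forall>\<^sub>F y in at x. f y = g y"
    using assms eventually_nhds_x_imp_x by (auto simp: eventually_nhds_conv_at)
  moreover from assms(2) obtain D where "(f has_derivative D) (at x)"
    by (auto simp: differentiable_def)
  ultimately show ?thesis
    using has_derivative_transform_eventually[of f D x UNIV g] by (auto simp: differentiable_def)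
qed

lemma Cr_on_cong:
  assumes "open S" "\<And>x. x \<in> S \<Longrightarrow> f x = g x"
  shows "Cr_on r S f \<longleftrightarrow> Cr_on r S g"
  using assms(2)
proof (induction r arbitrary: f g)
  case 0
  then show ?case
    by (simp cong: continuous_on_cong)
next
  case (Suc r)
  have ev: "\<forall>\<^sub>F y in nhds x. f y = g y" if "x \<in> S" for x
    using assms(1) Suc.prems that by (auto simp: eventually_nhds)
  have ev': "\<forall>\<^sub>F y in nhds x. g y = f y" if "x \<in> S" for x
    using assms(1) Suc.prems that by (auto simp: eventually_nhds)
  have "FD f x = FD g x" if "x \<in> S" for x
    using FD_cong[OF ev[OF that]] .
  then have "Cr_on r S (\<lambda>x. FD f x v) = Cr_on r S (\<lambda>x. FD g x v)" for v
    by (intro Suc.IH) auto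
  then show ?case
    using ev ev' differentiable_cong_nhds by (auto; blast)
qed

text \<open>\<open>Cr_on\<close> speaks of the picked derivative; an explicit formula may replace
  it, because derivatives at a point are unique and \<open>Cr_on\<close> on an open set depends only
  on the values there. All closure rules below enter through this.\<close>

lemma Cr_on_SucI:
  assumes "open S" "\<And>x. x \<in> S \<Longrightarrow> (f has_derivative f' x) (at x)"
    "\<And>v. Cr_on r S (\<lambda>x. f' x v)"
  shows "Cr_on (Suc r) S f"
proof -
  have "Cr_on r S (\<lambda>x. FD f x v)" for v
    using assms(3)[of v] Cr_on_cong[OF assms(1), of "\<lambda>x. FD f x v" "\<lambda>x. f' x v"]
      FD_eq[OF assms(2)] by auto
  then show ?thesis
    using assms(2) by (auto simp: differentiable_def)
qed

lemma Cr_on_SucD: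
  "Cr_on (Suc r) S f \<Longrightarrow> Cr_on r S f"
proof (induction r arbitrary: f)
  case 0
  then have "f differentiable_on S"
    unfolding differentiable_on_def Cr_on.simps by (metis differentiable_at_withinI)
  then show ?case
    by (simp add: differentiable_imp_continuous_on)
next
  case (Suc r)
  show ?case
    using Suc.prems Suc.IH by (simp del: Cr_on.simps add: Cr_on.simps(2))
qed

lemma Cr_on_subset: "Cr_on r S f \<Longrightarrow> T \<subseteq> S \<Longrightarrow> Cr_on r T f"
  by (induction r arbitrary: f) (auto intro: continuous_on_subset)

lemma Cr_on_has_derivative:
  "Cr_on (Suc r) S f \<Longrightarrow> x \<in> S \<Longrightarrow> (f has_derivative FD f x) (at x)"
  by (simp add: frechet_derivative_works)

lemma Cr_on_const: "open S \<Longrightarrow> Cr_on r S (\<lambda>_. c)"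
proof (induction r arbitrary: c)
  case (Suc r)
  show ?case
    by (rule Cr_on_SucI[where f' = "\<lambda>_ _. 0"]) (use Suc in auto)
qed simp

lemma Cr_on_bounded_linear:
  assumes "open S" "bounded_linear f"
  shows "Cr_on r S f"
proof (cases r)
  case (Suc r)
  show ?thesis unfolding Suc
    by (rule Cr_on_SucI[where f' = "\<lambda>_. f"])
      (use assms in \<open>auto intro: bounded_linear_imp_has_derivative Cr_on_const\<close>)
qed (use assms in \<open>auto simp: linear_continuous_on\<close>)

lemma Cr_on_add:
  assumes "open S" "Cr_on r S f" "Cr_on r S g"
  shows "Cr_on r S (\<lambda>x. f x + g x)"
  using assms(2,3)
proof (induction r arbitrary: f g)
  case 0
  then show ?case by (auto intro: continuous_intros)
next
  case (Suc r)
  have "((\<lambda>x. f x + g x) has_derivative (\<lambda>v. FD f x v + FD g x v)) (at x)" if "x \<in> S" for x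
    using Suc.prems that by (intro has_derivative_add Cr_on_has_derivative)
  moreover have "Cr_on r S (\<lambda>x. FD f x v + FD g x v)" for v
    using Suc by simp
  ultimately show ?case
    using assms(1) by (rule Cr_on_SucI[rotated 1])
qed

lemma Cr_on_sum:
  assumes "open S" "\<And>i. i \<in> I \<Longrightarrow> Cr_on r S (f i)"
  shows "Cr_on r S (\<lambda>x. \<Sum>i\<in>I. f i x)"
  using assms(2)
  by (induction I rule: infinite_finite_induct) (auto intro: Cr_on_const Cr_on_add assms(1))

lemma Cr_on_bilinear:
  assumes "bounded_bilinear B" "open S" "Cr_on r S f" "Cr_on r S g"
  shows "Cr_on r S (\<lambda>x. B (f x) (g x))"
  using assms(3,4)
proof (induction r arbitrary: f g)
  case 0
  then show ?case
    using bounded_bilinear.continuous_on[OF assms(1)] by auto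
next
  case (Suc r)
  have "((\<lambda>x. B (f x) (g x)) has_derivative (\<lambda>v. B (f x) (FD g x v) + B (FD f x v) (g x))) (at x)"
    if "x \<in> S" for x
    using Suc.prems that by (intro bounded_bilinear.FDERIV[OF assms(1)] Cr_on_has_derivative)
  moreover have "Cr_on r S (\<lambda>x. B (f x) (FD g x v) + B (FD f x v) (g x))" for v
    using Suc.IH Suc.prems Suc.prems[THEN Cr_on_SucD] by (intro Cr_on_add assms) auto
  ultimately show ?case
    using assms(2) by (rule Cr_on_SucI[rotated 1])
qed

lemma Cr_on_linear_compose:
  assumes "bounded_linear L" "open S" "Cr_on r S f"
  shows "Cr_on r S (\<lambda>x. L (f x))"
  using assms(3)
proof (induction r arbitrary: f)
  case 0
  then show ?case
    using bounded_linear.continuous_on[OF assms(1)] by auto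
next
  case (Suc r)
  have "((\<lambda>x. L (f x)) has_derivative (\<lambda>v. L (FD f x v))) (at x)" if "x \<in> S" for x
    using Suc.prems that by (intro bounded_linear.has_derivative[OF assms(1)] Cr_on_has_derivative)
  moreover have "Cr_on r S (\<lambda>x. L (FD f x v))" for v
    using Suc by auto
  ultimately show ?case
    using assms(2) by (rule Cr_on_SucI[rotated 1])
qed

text \<open>In the chain rule both the base point and the argument of the derivative of g vary with
  x, while the induction hypothesis covers only fixed directions. Expanding the argument in an
  orthonormal basis separates the two: what remains are products of components with derivatives of g
  in basis directions.\<close>

lemma Cr_on_compose:
  fixes f :: "'a::real_normed_vector \<Rightarrow> 'b::euclidean_space"
  assumes "open S" "open T" "f ` S \<subseteq> T" "Cr_on r S f" "Cr_on r T g"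
  shows "Cr_on r S (\<lambda>x. g (f x))"
  using assms(4,5)
proof (induction r arbitrary: g)
  case 0
  then show ?case
    using assms(3) by (auto intro: continuous_on_compose2)
next
  case (Suc r)
  have *: "FD g (f x) w = (\<Sum>b\<in>Basis. (w \<bullet> b) *\<^sub>R FD g (f x) b)" if "x \<in> S" for x w
  proof -
    have "g differentiable at (f x)"
      using Suc.prems that assms(3) by auto
    then have "linear (FD g (f x))"
      by (rule linear_frechet_derivative)
    then have "FD g (f x) (\<Sum>b\<in>Basis. (w \<bullet> b) *\<^sub>R b) = (\<Sum>b\<in>Basis. (w \<bullet> b) *\<^sub>R FD g (f x) b)"
      by (simp add: linear_sum linear_scale)
    then show ?thesis
      by (simp add: euclidean_representation)
  qed
  have "((\<lambda>x. g (f x)) has_derivative (\<lambda>v. \<Sum>b\<in>Basis. (FD f x v \<bullet> b) *\<^sub>R FD g (f x) b)) (at x)"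
    if "x \<in> S" for x
    unfolding *[OF that, symmetric]
    using Suc.prems that assms(3)
    by (intro has_derivative_compose[of f _ _ _ g] Cr_on_has_derivative) auto
  moreover have "Cr_on r S (\<lambda>x. FD g (f x) b)" for b
    using Suc.IH[of "\<lambda>x. FD g x b"] Suc.prems Suc.prems[THEN Cr_on_SucD] by auto
  then have "Cr_on r S (\<lambda>x. \<Sum>b\<in>Basis. (FD f x v \<bullet> b) *\<^sub>R FD g (f x) b)" for v
    using Suc.IH Suc.prems Suc.prems[THEN Cr_on_SucD]
    by (intro Cr_on_sum Cr_on_bilinear[OF bounded_bilinear_scaleR] assms(1)
        Cr_on_linear_compose[OF bounded_linear_inner_left]) auto
  ultimately show ?case
    using assms(1) by (rule Cr_on_SucI[rotated 1])
qed

lemma Cr_on_inverse: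
  fixes f :: "'a::real_normed_vector \<Rightarrow> 'k::real_normed_field"
  assumes "open S" "Cr_on r S f" "\<And>x. x \<in> S \<Longrightarrow> f x \<noteq> 0"
  shows "Cr_on r S (\<lambda>x. inverse (f x))"
  using assms(2)
proof (induction r)
  case 0
  then show ?case
    using assms(3) by (auto intro!: continuous_intros)
next
  case (Suc r)
  have "((\<lambda>x. inverse (f x)) has_derivative
      (\<lambda>v. (-1) * (inverse (f x) * FD f x v * inverse (f x)))) (at x)" if "x \<in> S" for x
    using Suc.prems that assms(3)
    by (auto intro!: derivative_eq_intros Cr_on_has_derivative)
  moreover have "Cr_on r S (\<lambda>x. (-1) * (inverse (f x) * FD f x v * inverse (f x)))" for v
    using Suc.IH Suc.prems Suc.prems[THEN Cr_on_SucD]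
    by (intro Cr_on_bilinear[OF bounded_bilinear_mult] assms(1) Cr_on_const) auto
  ultimately show ?case
    using assms(1) by (rule Cr_on_SucI[rotated 1])
qed

text \<open>The second difference of \<open>f\<close> over the parallelogram spanned by \<open>h u\<close> and \<open>h v\<close>
  is symmetric in \<open>u\<close> and \<open>v\<close>; two applications of the mean value theorem express it by either
  mixed derivative.\<close>
lemma second_difference_mvt:
  fixes f :: "'a::real_normed_vector \<Rightarrow> real"
  assumes "Cr_on 2 S f" "h > 0"
    and S: "\<And>s t. 0 \<le> s \<Longrightarrow> s \<le> h \<Longrightarrow> 0 \<le> t \<Longrightarrow> t \<le> h \<Longrightarrow> z + s *\<^sub>R u + t *\<^sub>R v \<in> S"
  shows "\<exists>s t. 0 < s \<and> s < h \<and> 0 < t \<and> t < h \<and>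
    f (z + h *\<^sub>R u + h *\<^sub>R v) - f (z + h *\<^sub>R u) - f (z + h *\<^sub>R v) + f z
    = h * (h * FD (\<lambda>x. FD f x u) (z + s *\<^sub>R u + t *\<^sub>R v) v)"
proof -
  have d: "((\<lambda>s. g (p + s *\<^sub>R w)) has_real_derivative FD g (p + s *\<^sub>R w) w) (at s)"
    if g: "(g has_derivative FD g (p + s *\<^sub>R w)) (at (p + s *\<^sub>R w))" for g :: "'a \<Rightarrow> real" and p w s
  proof -
    have "((\<lambda>s. g (p + s *\<^sub>R w)) has_derivative (\<lambda>r. FD g (p + s *\<^sub>R w) (r *\<^sub>R w))) (at s)"
      by (rule has_derivative_compose[of "\<lambda>s. p + s *\<^sub>R w" _ _ _ g])
        (auto intro!: derivative_eq_intros g)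
    moreover have "FD g (p + s *\<^sub>R w) (r *\<^sub>R w) = FD g (p + s *\<^sub>R w) w * r" for r
      using has_derivative_linear[OF g] by (simp add: linear_scale)
    ultimately show ?thesis
      by (simp add: has_field_derivative_def)
  qed
  have f1: "(f has_derivative FD f x) (at x)" if "x \<in> S" for x
    using assms(1) that Cr_on_has_derivative[of 1] by (auto simp: numeral_2_eq_2)
  have f2: "((\<lambda>x. FD f x u) has_derivative FD (\<lambda>x. FD f x u) x) (at x)" if "x \<in> S" for x
    using assms(1) that Cr_on_has_derivative[of 0 S "\<lambda>x. FD f x u"] by (auto simp: numeral_2_eq_2)
  have "\<exists>s. 0 < s \<and> s < h \<and>
      (f (z + h *\<^sub>R v + h *\<^sub>R u) - f (z + h *\<^sub>R u)) - (f (z + h *\<^sub>R v + 0 *\<^sub>R u) - f (z + 0 *\<^sub>R u))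
      = (h - 0) * (FD f (z + h *\<^sub>R v + s *\<^sub>R u) u - FD f (z + s *\<^sub>R u) u)"
  proof (rule MVT2)
    fix s assume "0 \<le> s" "s \<le> h"
    then have "z + h *\<^sub>R v + s *\<^sub>R u \<in> S" "z + s *\<^sub>R u \<in> S"
      using S[of s h] S[of s 0] assms(2) by (auto simp: add_ac)
    then show "((\<lambda>s. f (z + h *\<^sub>R v + s *\<^sub>R u) - f (z + s *\<^sub>R u)) has_real_derivative
       FD f (z + h *\<^sub>R v + s *\<^sub>R u) u - FD f (z + s *\<^sub>R u) u) (at s)"
      by (intro DERIV_diff d f1)
  qed (rule assms)
  then obtain s where s: "0 < s" "s < h" "f (z + h *\<^sub>R u + h *\<^sub>R v) - f (z + h *\<^sub>R u) - f (z + h *\<^sub>R v) + f z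
      = h * (FD f (z + s *\<^sub>R u + h *\<^sub>R v) u - FD f (z + s *\<^sub>R u + 0 *\<^sub>R v) u)"
    by (auto simp: algebra_simps)
  have "\<exists>t. 0 < t \<and> t < h \<and>
      FD f (z + s *\<^sub>R u + h *\<^sub>R v) u - FD f (z + s *\<^sub>R u + 0 *\<^sub>R v) u
      = (h - 0) * FD (\<lambda>x. FD f x u) (z + s *\<^sub>R u + t *\<^sub>R v) v"
    by (rule MVT2) (use assms s S in \<open>auto intro!: d[where g = "\<lambda>x. FD f x u"] f2\<close>)
  with s show ?thesis
    by auto
qed

text \<open>The second difference over a small parallelogram is unchanged when u and v are
  exchanged, so the two mixed derivatives agree at two points close to z. By continuity they cannot
  differ at z: half of their distance serves as the tolerance for each.\<close>

lemma symmetric_FD_real: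
  fixes f :: "'a::real_normed_vector \<Rightarrow> real"
  assumes "open S" "Cr_on 2 S f" "z \<in> S"
  shows "FD (\<lambda>x. FD f x u) z v = FD (\<lambda>x. FD f x v) z u"
proof (rule ccontr)
  define A where "A = (\<lambda>x. FD (\<lambda>x. FD f x u) x v)"
  define B where "B = (\<lambda>x. FD (\<lambda>x. FD f x v) x u)"
  assume "\<not> ?thesis"
  then have e: "\<bar>A z - B z\<bar> / 2 > 0" (is "?e > 0")
    by (auto simp: A_def B_def)
  have "continuous_on S A" "continuous_on S B"
    using assms(2) unfolding A_def B_def numeral_2_eq_2 by auto
  then have "(A \<longlongrightarrow> A z) (nhds z)" "(B \<longlongrightarrow> B z) (nhds z)"
    using assms by (auto simp: continuous_on_eq_continuous_at isCont_def tendsto_at_iff_tendsto_nhds)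
  then have "\<forall>\<^sub>F x in nhds z. dist (A x) (A z) < ?e \<and> dist (B x) (B z) < ?e \<and> x \<in> S"
    using e assms by (intro eventually_conj tendstoD eventually_nhds_in_open) auto
  then obtain d where d: "d > 0"
    "\<And>x. dist x z < d \<Longrightarrow> dist (A x) (A z) < ?e \<and> dist (B x) (B z) < ?e \<and> x \<in> S"
    by (auto simp: eventually_nhds_metric)
  \<comment> \<open>The summand 1 keeps c positive when u = v = 0, and the factor 2 in the next
    constant makes the parallelogram of side factor h fit strictly inside the ball of radius
    d.\<close>
  define c where "c = norm u + norm v + 1"
  have c: "c > 0" "norm u + norm v \<le> c"
    by (auto simp: c_def add_nonneg_pos)
  define h where "h = d / (2 * c)"
  have hp: "h > 0" using d c by (simp add: h_def)
  have hd: "h * (norm u + norm v) < d"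
  proof -
    have "h * (norm u + norm v) \<le> h * c"
      using hp c by simp
    also have "\<dots> = d / 2"
      using c by (simp add: h_def)
    finally show ?thesis using d by simp
  qed
  have near: "dist (z + s *\<^sub>R u + t *\<^sub>R v) z < d" if "0 \<le> s" "s \<le> h" "0 \<le> t" "t \<le> h" for s t
  proof -
    have "norm (s *\<^sub>R u + t *\<^sub>R v) \<le> s * norm u + t * norm v"
      using that norm_triangle_ineq[of "s *\<^sub>R u" "t *\<^sub>R v"] by simp
    also have "\<dots> \<le> h * norm u + h * norm v"
      using that by (intro add_mono mult_right_mono) auto
    also have "\<dots> < d" using hd by (simp add: algebra_simps)
    finally show ?thesis by (simp add: dist_norm add.assoc)
  qed
  have near': "dist (z + s *\<^sub>R v + t *\<^sub>R u) z < d" if "0 \<le> s" "s \<le> h" "0 \<le> t" "t \<le> h" for s t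
    using near[of t s] that by (simp add: add_ac)
  obtain s t where st: "0 < s" "s < h" "0 < t" "t < h"
    "f (z + h *\<^sub>R u + h *\<^sub>R v) - f (z + h *\<^sub>R u) - f (z + h *\<^sub>R v) + f z = h * (h * A (z + s *\<^sub>R u + t *\<^sub>R v))"
    using second_difference_mvt[OF assms(2) hp, of z u v] d(2) near unfolding A_def by blast
  obtain s' t' where st': "0 < s'" "s' < h" "0 < t'" "t' < h"
    "f (z + h *\<^sub>R v + h *\<^sub>R u) - f (z + h *\<^sub>R v) - f (z + h *\<^sub>R u) + f z = h * (h * B (z + s' *\<^sub>R v + t' *\<^sub>R u))"
    using second_difference_mvt[OF assms(2) hp, of z v u] d(2) near' unfolding B_def by blast
  have vu: "z + h *\<^sub>R v + h *\<^sub>R u = z + h *\<^sub>R u + h *\<^sub>R v"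
    by (simp add: add_ac)
  have "h * (h * A (z + s *\<^sub>R u + t *\<^sub>R v)) = h * (h * B (z + s' *\<^sub>R v + t' *\<^sub>R u))"
    using st(5) st'(5)[unfolded vu] by linarith
  then have "A (z + s *\<^sub>R u + t *\<^sub>R v) = B (z + s' *\<^sub>R v + t' *\<^sub>R u)"
    using hp by simp
  moreover have "dist (A (z + s *\<^sub>R u + t *\<^sub>R v)) (A z) < ?e" "dist (B (z + s' *\<^sub>R v + t' *\<^sub>R u)) (B z) < ?e"
    using d(2) near near' st st' by auto
  ultimately show False
    unfolding dist_real_def by (smt (verit) field_sum_of_halves)
qed

text \<open>The real case applied to each component; taking a component commutes with both
  derivatives.\<close>

lemma symmetric_FD:
  fixes f :: "'a::real_normed_vector \<Rightarrow> 'b::euclidean_space"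
  assumes "open S" "Cr_on 2 S f" "z \<in> S"
  shows "FD (\<lambda>x. FD f x u) z v = FD (\<lambda>x. FD f x v) z u"
proof (rule euclidean_eqI)
  fix b :: 'b assume "b \<in> Basis"
  define g where "g = (\<lambda>x. f x \<bullet> b)"
  have g: "Cr_on 2 S g"
    unfolding g_def by (rule Cr_on_linear_compose[OF bounded_linear_inner_left]) fact+
  have g1: "FD g x w = FD f x w \<bullet> b" if "x \<in> S" for x w
  proof -
    have "(f has_derivative FD f x) (at x)"
      using assms that Cr_on_has_derivative[of 1] by (auto simp: numeral_2_eq_2)
    then show ?thesis
      unfolding g_def by (subst FD_eq[OF has_derivative_inner_left]) auto
  qed
  have g2: "FD (\<lambda>x. FD g x w) z w' = FD (\<lambda>x. FD f x w) z w' \<bullet> b" for w w'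
  proof -
    have "((\<lambda>x. FD f x w) has_derivative FD (\<lambda>x. FD f x w) z) (at z)"
      using assms Cr_on_has_derivative[of 0 S "\<lambda>x. FD f x w"] by (auto simp: numeral_2_eq_2)
    then have "FD (\<lambda>x. FD f x w \<bullet> b) z w' = FD (\<lambda>x. FD f x w) z w' \<bullet> b"
      by (subst FD_eq[OF has_derivative_inner_left]) auto
    moreover have "FD (\<lambda>x. FD g x w) z = FD (\<lambda>x. FD f x w \<bullet> b) z"
      by (rule FD_cong) (use assms g1 in \<open>auto simp: eventually_nhds\<close>)
    ultimately show ?thesis by simp
  qed
  show "FD (\<lambda>x. FD f x u) z v \<bullet> b = FD (\<lambda>x. FD f x v) z u \<bullet> b"
    using symmetric_FD_real[OF assms(1) g assms(3)] g2 by simp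
qed

section \<open>Smooth maps over the ground field\<close>

lemma vector_space_mult: "vector_space ((*) :: 'k::field \<Rightarrow> 'k \<Rightarrow> 'k)"
  by unfold_locales (auto simp: algebra_simps)

lemma vector_space_vec: "vector_space ((*s) :: 'k::field \<Rightarrow> 'k ^ 'n \<Rightarrow> 'k ^ 'n)"
  by (rule vec.vector_space_axioms)

lemma vector_space_prod:
  "vector_space (\<lambda>(k::'k::real_normed_field) (t::'k, y::'k ^ 'n). (k * t, k *s y))"
  by unfold_locales
    (auto simp: algebra_simps vector_add_ldistrib vector_sadd_rdistrib vector_smult_assoc plus_prod_def)

lemmas vector_space_scalars = vector_space_mult vector_space_vec vector_space_prod

text \<open>Real differentiability already makes the derivative additive, so linearity over
  \<open>'k\<close> amounts to compatibility with scalars.\<close>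

lemma smooth_onI:
  assumes "vector_space s" "vector_space s'" "\<And>r. Cr_on r S f"
    "\<And>x k v. x \<in> S \<Longrightarrow> FD f x (s k v) = s' k (FD f x v)"
  shows "smooth_on s s' S f"
proof -
  have "FD f x (u + v) = FD f x u + FD f x v" if "x \<in> S" for x u v
    using assms(3)[of "Suc 0"] that by (auto intro: linear_add linear_frechet_derivative)
  then show ?thesis
    using assms by (auto simp: smooth_on_def Vector_Spaces.linear_iff)
qed

lemma Cr_on_empty: "Cr_on r {} f"
  by (induction r arbitrary: f) auto

lemma smooth_on_empty: "smooth_on s s' {} f"
  by (simp add: smooth_on_def Cr_on_empty)

lemma smooth_on_Cr: "smooth_on s s' S f \<Longrightarrow> Cr_on r S f"
  by (simp add: smooth_on_def)

lemma smooth_on_scale: "smooth_on s s' S f \<Longrightarrow> x \<in> S \<Longrightarrow> FD f x (s k v) = s' k (FD f x v)"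
  by (simp add: smooth_on_def Vector_Spaces.linear_iff)

text \<open>The vector space axioms for s and s' are part of the linearity of each derivative and
  can be extracted only at a point of S. This explains the recurring case distinction on S being
  empty.\<close>

lemma smooth_on_vector_space:
  "smooth_on s s' S f \<Longrightarrow> x \<in> S \<Longrightarrow> vector_space s \<and> vector_space s'"
  by (auto simp: smooth_on_def Vector_Spaces.linear_iff)

lemma smooth_on_has_derivative:
  "smooth_on s s' S f \<Longrightarrow> x \<in> S \<Longrightarrow> (f has_derivative FD f x) (at x)"
  using Cr_on_has_derivative[of 0] smooth_on_Cr by blast

lemma smooth_on_continuous: "smooth_on s s' S f \<Longrightarrow> continuous_on S f"
  using smooth_on_Cr[of _ _ _ _ 0] by auto

lemma smooth_on_subset: "smooth_on s s' S f \<Longrightarrow> T \<subseteq> S \<Longrightarrow> smooth_on s s' T f"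
  by (auto simp: smooth_on_def intro: Cr_on_subset)

lemma smooth_on_cong:
  assumes "open S" "smooth_on s s' S f" "\<And>x. x \<in> S \<Longrightarrow> f x = g x"
  shows "smooth_on s s' S g"
proof -
  have "FD f x = FD g x" if "x \<in> S" for x
    using assms that by (intro FD_cong) (auto simp: eventually_nhds)
  then show ?thesis
    using assms(2) Cr_on_cong[OF assms(1,3)] by (auto simp: smooth_on_def)
qed

lemma smooth_on_linear:
  assumes "open S" "vector_space s" "vector_space s'" "bounded_linear f"
    "\<And>k v. f (s k v) = s' k (f v)"
  shows "smooth_on s s' S f"
  using assms FD_eq[OF bounded_linear_imp_has_derivative[OF assms(4)]]
  by (intro smooth_onI) (auto intro: Cr_on_bounded_linear)

lemma vector_space_scale_zero: "vector_space s \<Longrightarrow> s k 0 = 0"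
  by (metis add.right_neutral add_left_cancel vector_space.vector_space_assms(1))

lemma smooth_on_const:
  assumes "open S" "vector_space s" "vector_space s'"
  shows "smooth_on s s' S (\<lambda>_. c)"
  using assms FD_eq[OF has_derivative_const] vector_space_scale_zero[of s']
  by (intro smooth_onI) (auto intro: Cr_on_const)

lemma smooth_on_add:
  assumes "open S" "smooth_on s s' S f" "smooth_on s s' S g"
  shows "smooth_on s s' S (\<lambda>x. f x + g x)"
proof (cases "S = {}")
  case False
  then have vs: "vector_space s" "vector_space s'"
    using smooth_on_vector_space[OF assms(2)] by auto
  have "FD (\<lambda>x. f x + g x) x v = FD f x v + FD g x v" if "x \<in> S" for x v
    using FD_eq[OF has_derivative_add[OF assms(2,3)[THEN smooth_on_has_derivative]]] that by simp
  then show ?thesis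
    using assms smooth_on_scale[OF assms(2)] smooth_on_scale[OF assms(3)] vs
    by (intro smooth_onI) (auto intro: Cr_on_add smooth_on_Cr simp: vector_space_def)
qed (simp add: smooth_on_empty)

lemma smooth_on_mult:
  fixes f g :: "'a::real_normed_vector \<Rightarrow> 'k::{real_normed_field,euclidean_space}"
  assumes "open S" "smooth_on s (*) S f" "smooth_on s (*) S g"
  shows "smooth_on s (*) S (\<lambda>x. f x * g x)"
proof -
  have C: "Cr_on r S (\<lambda>x. f x * g x)" for r
    using assms by (intro Cr_on_bilinear[OF bounded_bilinear_mult] smooth_on_Cr)
  have F: "FD (\<lambda>x. f x * g x) x v = f x * FD g x v + FD f x v * g x" if "x \<in> S" for x v
    using FD_eq[OF has_derivative_mult[OF assms(2,3)[THEN smooth_on_has_derivative]]] that by simp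
  show ?thesis
  proof (cases "S = {}")
    case False
    then show ?thesis
      using C F assms smooth_on_scale[OF assms(2)] smooth_on_scale[OF assms(3)]
        smooth_on_vector_space[OF assms(2)]
      by (intro smooth_onI) (auto simp: vector_space_scalars algebra_simps)
  qed (simp add: smooth_on_empty)
qed

lemma smooth_on_inverse:
  fixes f :: "'a::real_normed_vector \<Rightarrow> 'k::{real_normed_field,euclidean_space}"
  assumes "open S" "smooth_on s (*) S f" "\<And>x. x \<in> S \<Longrightarrow> f x \<noteq> 0"
  shows "smooth_on s (*) S (\<lambda>x. inverse (f x))"
proof -
  have C: "Cr_on r S (\<lambda>x. inverse (f x))" for r
    using assms by (intro Cr_on_inverse smooth_on_Cr)
  have F: "FD (\<lambda>x. inverse (f x)) x v = - (inverse (f x) * FD f x v * inverse (f x))" if "x \<in> S" for x v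
    using FD_eq[OF Deriv.has_derivative_inverse[OF assms(3) assms(2)[THEN smooth_on_has_derivative]]] that by simp
  show ?thesis
  proof (cases "S = {}")
    case False
    then show ?thesis
      using C F assms smooth_on_scale[OF assms(2)] smooth_on_vector_space[OF assms(2)]
      by (intro smooth_onI) (auto simp: vector_space_scalars algebra_simps)
  qed (simp add: smooth_on_empty)
qed

lemma smooth_on_sum:
  assumes "open S" "vector_space s" "vector_space s'" "\<And>i. i \<in> I \<Longrightarrow> smooth_on s s' S (f i)"
  shows "smooth_on s s' S (\<lambda>x. \<Sum>i\<in>I. f i x)"
  using assms(4)
  by (induction I rule: infinite_finite_induct) (auto intro: smooth_on_const smooth_on_add assms(1-3))

lemma smooth_on_compose:
  fixes f :: "'a::real_normed_vector \<Rightarrow> 'b::euclidean_space"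
  assumes "open S" "open T" "f ` S \<subseteq> T" "smooth_on s s' S f" "smooth_on s' s'' T g"
  shows "smooth_on s s'' S (\<lambda>x. g (f x))"
proof -
  have C: "Cr_on r S (\<lambda>x. g (f x))" for r
    by (rule Cr_on_compose[OF assms(1-3) assms(4,5)[THEN smooth_on_Cr]])
  have F: "FD (\<lambda>x. g (f x)) x v = FD g (f x) (FD f x v)" if "x \<in> S" for x v
    using FD_eq[OF has_derivative_compose[OF smooth_on_has_derivative[OF assms(4)]
        smooth_on_has_derivative[OF assms(5)]]] that assms(3) by auto
  show ?thesis
  proof (cases "S = {}")
    case False
    then have "vector_space s \<and> vector_space s''"
      using assms(3) smooth_on_vector_space[OF assms(4)] smooth_on_vector_space[OF assms(5)] by blast
    then show ?thesis
      using C F assms(3) smooth_on_scale[OF assms(4)] smooth_on_scale[OF assms(5)]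
      by (intro smooth_onI) (auto simp: image_subset_iff)
  qed (simp add: smooth_on_empty)
qed

lemma bounded_linear_axis:
  "bounded_linear (axis i :: 'k::euclidean_space \<Rightarrow> 'k ^ 'n)"
  unfolding linear_conv_bounded_linear[symmetric]
  by (rule linearI) (auto simp: vec_eq_iff axis_def)

lemma vec_eq_sum_axis: "(x :: 'k::comm_monoid_add ^ 'n) = (\<Sum>i\<in>UNIV. axis i (x $ i))"
  by (simp add: vec_eq_iff axis_def if_distrib[of "\<lambda>f. f _"] sum.If_cases)

lemma vec_eq_sum_basis: "(x :: 'k::semiring_1 ^ 'n) = (\<Sum>i\<in>UNIV. x $ i *s axis i 1)"
proof -
  have "axis i (x $ i) = x $ i *s axis i 1" for i
    by (simp add: vec_eq_iff axis_def)
  then show ?thesis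
    using vec_eq_sum_axis[of x] by simp
qed

lemma smooth_on_vec_iff:
  fixes f :: "'a::real_normed_vector \<Rightarrow> 'k::{real_normed_field,euclidean_space} ^ 'n"
  assumes "open S"
  shows "smooth_on s (*s) S f \<longleftrightarrow> (\<forall>i. smooth_on s (*) S (\<lambda>x. f x $ i))"
proof safe
  fix i assume f: "smooth_on s (*s) S f"
  have "smooth_on (*s) (*) UNIV (\<lambda>v :: 'k ^ 'n. v $ i)"
    by (intro smooth_on_linear) (auto simp: vector_space_scalars bounded_linear_vec_nth)
  then show "smooth_on s (*) S (\<lambda>x. f x $ i)"
    using smooth_on_compose[OF assms open_UNIV _ f] by auto
next
  assume f: "\<forall>i. smooth_on s (*) S (\<lambda>x. f x $ i)"
  show "smooth_on s (*s) S f"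
  proof (cases "S = {}")
    case False
    have "smooth_on (*) (*s) UNIV (axis i :: 'k \<Rightarrow> 'k ^ 'n)" for i
      by (intro smooth_on_linear)
        (auto simp: vector_space_scalars bounded_linear_axis vec_eq_iff axis_def)
    then have "smooth_on s (*s) S (\<lambda>x. axis i (f x $ i))" for i
      using smooth_on_compose[OF assms open_UNIV subset_UNIV f[rule_format, of i]] by auto
    then have "smooth_on s (*s) S (\<lambda>x. \<Sum>i\<in>UNIV. axis i (f x $ i))"
      using False f smooth_on_vector_space
      by (intro smooth_on_sum[OF assms]) (blast intro: vector_space_vec)+
    then show ?thesis
      by (simp flip: vec_eq_sum_axis)
  qed (simp add: smooth_on_empty)
qed

text \<open>Over the complex numbers: the derivative of a holomorphic map is holomorphic. Deriving
  in the direction of a scaled u and of v may be exchanged; the inner derivative then releases the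
  scalar, a bounded linear factor passes through the outer one, and the order is exchanged
  back.\<close>

lemma smooth_on_FD:
  fixes f :: "'a::real_normed_vector \<Rightarrow> 'b::euclidean_space"
  assumes "open S" "smooth_on s s' S f" "\<And>k. bounded_linear (s' k)"
  shows "smooth_on s s' S (\<lambda>x. FD f x v)"
proof -
  have C: "Cr_on r S (\<lambda>x. FD f x v)" for r
    using smooth_on_Cr[OF assms(2), of "Suc r"] by simp
  show ?thesis
  proof (cases "S = {}")
    case False
    then have vs: "vector_space s" "vector_space s'"
      using smooth_on_vector_space[OF assms(2)] by auto
    have "FD (\<lambda>x. FD f x v) x (s k u) = s' k (FD (\<lambda>x. FD f x v) x u)" if "x \<in> S" for x k u
    proof -
      have "FD (\<lambda>x. FD f x v) x (s k u) = FD (\<lambda>x. FD f x (s k u)) x v"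
        using symmetric_FD[OF assms(1) smooth_on_Cr[OF assms(2)] that] .
      also have "\<dots> = FD (\<lambda>x. s' k (FD f x u)) x v"
        using that assms smooth_on_scale[OF assms(2)]
        by (intro FD_cong[THEN fun_cong]) (auto simp: eventually_nhds)
      also have "\<dots> = s' k (FD (\<lambda>x. FD f x u) x v)"
        using Cr_on_has_derivative[of 0 S "\<lambda>x. FD f x u"] smooth_on_Cr[OF assms(2), of 2] that
        by (intro FD_eq[THEN fun_cong] bounded_linear.has_derivative[OF assms(3)])
          (simp add: numeral_2_eq_2)
      also have "\<dots> = s' k (FD (\<lambda>x. FD f x v) x u)"
        using symmetric_FD[OF assms(1) smooth_on_Cr[OF assms(2)] that] by metis
      finally show ?thesis .
    qed
    then show ?thesis
      using C vs by (intro smooth_onI)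
  qed (simp add: smooth_on_empty)
qed

lemma bounded_linear_vec_scale:
  "bounded_linear (\<lambda>v :: 'k::{real_normed_field,euclidean_space} ^ 'n. k *s v)"
  unfolding linear_conv_bounded_linear[symmetric]
  by (rule linearI) (auto simp: vec_eq_iff algebra_simps)

lemmas smooth_on_FD_vec = smooth_on_FD[where s' = "(*s)", OF _ _ bounded_linear_vec_scale]
lemmas smooth_on_FD_mult = smooth_on_FD[where s' = "(*)", OF _ _ bounded_linear_mult_right]

text \<open>For a coordinate change \<open>\<phi>\<close> this is the chart independence of \<open>d\<alpha>\<close>; for a deformation
  \<open>\<phi>(t, y)\<close> it is Cartan's formula.\<close>
lemma flat_naturality:
  fixes \<phi> :: "'a::real_normed_vector \<Rightarrow> 'k::{real_normed_field,euclidean_space} ^ 'm"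
    and a :: "'k ^ 'm \<Rightarrow> 'k ^ 'm \<Rightarrow> 'k"
  assumes "open S" "z \<in> S" "Cr_on 2 S \<phi>"
    and lin: "\<forall>\<^sub>F y in nhds (\<phi> z). \<forall>\<xi>. a y \<xi> = (\<Sum>i\<in>UNIV. \<xi> $ i * a y (axis i 1))"
    and diff: "\<And>i. (\<lambda>y. a y (axis i 1)) differentiable (at (\<phi> z))"
  shows "(\<lambda>x. a (\<phi> x) (FD \<phi> x v)) differentiable (at z)"
    and "FD (\<lambda>x. a (\<phi> x) (FD \<phi> x v)) z u - FD (\<lambda>x. a (\<phi> x) (FD \<phi> x u)) z v
      = FD (\<lambda>y. a y (FD \<phi> z v)) (\<phi> z) (FD \<phi> z u) - FD (\<lambda>y. a y (FD \<phi> z u)) (\<phi> z) (FD \<phi> z v)"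
proof -
  define A where "A = (\<lambda>i y. a y (axis i 1))"
  define A' where "A' = (\<lambda>i. FD (A i) (\<phi> z))"
  have A: "(A i has_derivative A' i) (at (\<phi> z))" for i
    using diff by (simp add: A_def A'_def frechet_derivative_works)
  have \<phi>: "(\<phi> has_derivative FD \<phi> z) (at z)"
    using assms Cr_on_has_derivative[of 1] by (simp add: numeral_2_eq_2)
  have \<phi>2: "((\<lambda>x. FD \<phi> x w) has_derivative FD (\<lambda>x. FD \<phi> x w) z) (at z)" for w
    using assms Cr_on_has_derivative[of 0 S "\<lambda>x. FD \<phi> x w"] by (simp add: numeral_2_eq_2)
  have ev: "\<forall>\<^sub>F x in nhds z. a (\<phi> x) (FD \<phi> x w) = (\<Sum>i\<in>UNIV. FD \<phi> x w $ i * A i (\<phi> x))" for w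
  proof -
    have "filterlim \<phi> (nhds (\<phi> z)) (nhds z)"
      using has_derivative_continuous[OF \<phi>] by (simp add: isCont_def tendsto_at_iff_tendsto_nhds)
    from eventually_compose_filterlim[OF lin this] show ?thesis
      unfolding A_def by (rule eventually_mono) blast
  qed
  have 1: "((\<lambda>x. \<Sum>i\<in>UNIV. FD \<phi> x w $ i * A i (\<phi> x)) has_derivative
      (\<lambda>u. \<Sum>i\<in>UNIV. FD \<phi> z w $ i * A' i (FD \<phi> z u) + FD (\<lambda>x. FD \<phi> x w) z u $ i * A i (\<phi> z))) (at z)" for w
    by (intro has_derivative_sum has_derivative_mult bounded_linear.has_derivative[OF bounded_linear_vec_nth]
        \<phi>2 has_derivative_compose[OF \<phi> A])
  have 2: "FD (\<lambda>y. a y \<xi>) (\<phi> z) w = (\<Sum>i\<in>UNIV. \<xi> $ i * A' i w)" for \<xi> w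
  proof -
    have "FD (\<lambda>y. a y \<xi>) (\<phi> z) = FD (\<lambda>y. \<Sum>i\<in>UNIV. \<xi> $ i * A i y) (\<phi> z)"
      using lin by (intro FD_cong) (auto simp: A_def elim!: eventually_mono)
    also have "\<dots> = (\<lambda>w. \<Sum>i\<in>UNIV. \<xi> $ i * A' i w)"
      by (intro FD_eq has_derivative_sum has_derivative_mult_right A)
    finally show ?thesis by simp
  qed
  show "(\<lambda>x. a (\<phi> x) (FD \<phi> x v)) differentiable (at z)"
    by (rule differentiable_cong_nhds[OF _ differentiableI[OF 1]])
      (rule eventually_mono[OF ev], rule sym)
  have 3: "FD (\<lambda>x. a (\<phi> x) (FD \<phi> x w)) z u =
      (\<Sum>i\<in>UNIV. FD \<phi> z w $ i * A' i (FD \<phi> z u) + FD (\<lambda>x. FD \<phi> x w) z u $ i * A i (\<phi> z))" for w u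
    using FD_cong[OF ev[of w]] FD_eq[OF 1[of w]] by simp
  \<comment> \<open>The only terms with second derivatives of \<phi> are symmetric in u and v, so
    they drop out of the antisymmetrised difference.\<close>
  have "FD (\<lambda>x. FD \<phi> x v) z u = FD (\<lambda>x. FD \<phi> x u) z v"
    by (rule symmetric_FD[OF assms(1,3,2)])
  then show "FD (\<lambda>x. a (\<phi> x) (FD \<phi> x v)) z u - FD (\<lambda>x. a (\<phi> x) (FD \<phi> x u)) z v
      = FD (\<lambda>y. a y (FD \<phi> z v)) (\<phi> z) (FD \<phi> z u) - FD (\<lambda>y. a y (FD \<phi> z u)) (\<phi> z) (FD \<phi> z v)"
    unfolding 2 3 by (simp add: sum.distrib)
qed

lemma FD_compose:
  assumes "(f has_derivative f') (at x)" "(g has_derivative g') (at (f x))"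
  shows "FD (\<lambda>y. g (f y)) x v = g' (f' v)"
  using FD_eq[OF has_derivative_compose[OF assms]] by simp

section \<open>Smoothness of germs in flat space, with the neighbourhood hidden\<close>

definition smooth_near ::
  "('k::{real_normed_field,euclidean_space} \<Rightarrow> 'a \<Rightarrow> 'a) \<Rightarrow> ('k \<Rightarrow> 'b \<Rightarrow> 'b) \<Rightarrow>
   'a::real_normed_vector \<Rightarrow> ('a \<Rightarrow> 'b::real_normed_vector) \<Rightarrow> bool" where
  "smooth_near s s' z g \<longleftrightarrow> (\<exists>S. open S \<and> z \<in> S \<and> smooth_on s s' S g)"

lemma smooth_near_common:
  assumes "finite I" "\<And>i. i \<in> I \<Longrightarrow> smooth_near s s' z (g i)"
  shows "\<exists>S. open S \<and> z \<in> S \<and> (\<forall>i\<in>I. smooth_on s s' S (g i))"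
proof -
  obtain S where "\<And>i. i \<in> I \<Longrightarrow> open (S i) \<and> z \<in> S i \<and> smooth_on s s' (S i) (g i)"
    using assms(2) unfolding smooth_near_def by metis
  then show ?thesis
    using assms(1) by (intro exI[of _ "\<Inter>i\<in>I. S i"]) (auto intro: smooth_on_subset)
qed

lemma smooth_near_common2:
  assumes "smooth_near s s' z g" "smooth_near s s'' z h"
  shows "\<exists>S. open S \<and> z \<in> S \<and> smooth_on s s' S g \<and> smooth_on s s'' S h"
proof -
  obtain S T where "open S" "z \<in> S" "smooth_on s s' S g" "open T" "z \<in> T" "smooth_on s s'' T h"
    using assms unfolding smooth_near_def by metis
  then show ?thesis
    by (intro exI[of _ "S \<inter> T"]) (auto intro: smooth_on_subset)
qed

lemma smooth_near_cong:
  assumes "smooth_near s s' z g" "\<forall>\<^sub>F y in nhds z. g y = h y"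
  shows "smooth_near s s' z h"
proof -
  obtain S T where "open S" "z \<in> S" "smooth_on s s' S g" "open T" "z \<in> T" "\<And>y. y \<in> T \<Longrightarrow> g y = h y"
    using assms unfolding smooth_near_def eventually_nhds by metis
  then show ?thesis
    unfolding smooth_near_def
    by (intro exI[of _ "S \<inter> T"]) (auto intro: smooth_on_cong smooth_on_subset)
qed

lemma smooth_near_eventually:
  "smooth_near s s' z g \<Longrightarrow> \<forall>\<^sub>F y in nhds z. smooth_near s s' y g"
  unfolding smooth_near_def eventually_nhds by blast

lemma smooth_near_has_derivative:
  "smooth_near s s' z g \<Longrightarrow> (g has_derivative FD g z) (at z)"
  unfolding smooth_near_def using smooth_on_has_derivative by blast

lemma smooth_near_linear:
  "smooth_near s s' z g \<Longrightarrow> Vector_Spaces.linear s s' (FD g z)"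
  unfolding smooth_near_def by (auto simp: smooth_on_def)

lemma smooth_near_vector_space:
  "smooth_near s s' z g \<Longrightarrow> vector_space s \<and> vector_space s'"
  unfolding smooth_near_def using smooth_on_vector_space by blast

lemma smooth_near_filterlim:
  assumes "smooth_near s s' z g"
  shows "filterlim g (nhds (g z)) (nhds z)"
  using has_derivative_continuous[OF smooth_near_has_derivative[OF assms]]
  by (simp add: isCont_def tendsto_at_iff_tendsto_nhds)

lemma smooth_near_const:
  "vector_space s \<Longrightarrow> vector_space s' \<Longrightarrow> smooth_near s s' z (\<lambda>_. c)"
  unfolding smooth_near_def using smooth_on_const by blast

lemma smooth_near_bounded_linear:
  assumes "vector_space s" "vector_space s'" "bounded_linear f"
    "\<And>k v. f (s k v) = s' k (f v)"
  shows "smooth_near s s' z f"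
  unfolding smooth_near_def using smooth_on_linear[of UNIV s s' f] assms by blast

lemma smooth_near_add:
  "smooth_near s s' z f \<Longrightarrow> smooth_near s s' z g \<Longrightarrow> smooth_near s s' z (\<lambda>x. f x + g x)"
  using smooth_near_common2[of s s' z f s' g] smooth_on_add[of _ s s' f g]
  unfolding smooth_near_def by blast

lemma smooth_near_mult:
  fixes f g :: "'a::real_normed_vector \<Rightarrow> 'k::{real_normed_field,euclidean_space}"
  shows "smooth_near s (*) z f \<Longrightarrow> smooth_near s (*) z g \<Longrightarrow> smooth_near s (*) z (\<lambda>x. f x * g x)"
  using smooth_near_common2[of s "(*)" z f "(*)" g] smooth_on_mult[of _ s f g]
  unfolding smooth_near_def by blast

lemma smooth_near_inverse:
  fixes f :: "'a::real_normed_vector \<Rightarrow> 'k::{real_normed_field,euclidean_space}"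
  assumes "smooth_near s (*) z f" "f z \<noteq> 0"
  shows "smooth_near s (*) z (\<lambda>x. inverse (f x))"
proof -
  obtain S where S: "open S" "z \<in> S" "smooth_on s (*) S f"
    using assms by (auto simp: smooth_near_def)
  have "\<forall>\<^sub>F x in nhds z. f x \<noteq> 0"
    using tendsto_imp_eventually_ne[OF smooth_near_filterlim[OF assms(1)] assms(2)] .
  then obtain T where T: "open T" "z \<in> T" "\<And>x. x \<in> T \<Longrightarrow> f x \<noteq> 0"
    by (auto simp: eventually_nhds)
  have "smooth_on s (*) (S \<inter> T) (\<lambda>x. inverse (f x))"
    by (intro smooth_on_inverse smooth_on_subset[OF S(3)]) (use S T in auto)
  then show ?thesis
    using S T unfolding smooth_near_def by blast
qed

lemma smooth_near_sum:
  assumes "vector_space s" "vector_space s'" "\<And>i. i \<in> I \<Longrightarrow> smooth_near s s' z (f i)"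
  shows "smooth_near s s' z (\<lambda>x. \<Sum>i\<in>I. f i x)"
  using assms(3)
  by (induction I rule: infinite_finite_induct) (auto intro: smooth_near_const smooth_near_add assms(1-2))

lemma smooth_near_vec_iff:
  fixes f :: "'a::real_normed_vector \<Rightarrow> 'k::{real_normed_field,euclidean_space} ^ 'n"
  shows "smooth_near s (*s) z f \<longleftrightarrow> (\<forall>i. smooth_near s (*) z (\<lambda>x. f x $ i))"
proof
  assume "smooth_near s (*s) z f"
  then obtain S where S: "open S" "z \<in> S" "smooth_on s (*s) S f"
    by (auto simp: smooth_near_def)
  then have "smooth_on s (*) S (\<lambda>x. f x $ i)" for i
    using smooth_on_vec_iff[OF S(1), of s f] by simp
  then show "\<forall>i. smooth_near s (*) z (\<lambda>x. f x $ i)"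
    using S unfolding smooth_near_def by blast
next
  assume "\<forall>i. smooth_near s (*) z (\<lambda>x. f x $ i)"
  then obtain S where S: "open S" "z \<in> S" "\<forall>i\<in>UNIV. smooth_on s (*) S (\<lambda>x. f x $ i)"
    using smooth_near_common[of UNIV s "(*)" z "\<lambda>i x. f x $ i"] by auto
  then have "smooth_on s (*s) S f"
    using smooth_on_vec_iff[OF S(1), of s f] by simp
  then show "smooth_near s (*s) z f"
    using S unfolding smooth_near_def by blast
qed

lemma smooth_near_scaleV:
  fixes h :: "'a::real_normed_vector \<Rightarrow> 'k::{real_normed_field,euclidean_space}"
  assumes "smooth_near s (*) z h" "smooth_near s (*s) z f"
  shows "smooth_near s (*s) z (\<lambda>x. h x *s f x)"
  using assms by (auto simp: smooth_near_vec_iff intro: smooth_near_mult)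

lemma smooth_near_compose:
  fixes f :: "'a::real_normed_vector \<Rightarrow> 'b::euclidean_space"
  assumes "smooth_near s s' z f" "smooth_near s' s'' (f z) g"
  shows "smooth_near s s'' z (\<lambda>x. g (f x))"
proof -
  obtain S T where S: "open S" "z \<in> S" "smooth_on s s' S f" and T: "open T" "f z \<in> T" "smooth_on s' s'' T g"
    using assms by (auto simp: smooth_near_def)
  define U where "U = S \<inter> f -` T"
  have "open U"
    unfolding U_def using S T by (intro continuous_open_preimage smooth_on_continuous)
  then have "smooth_on s s'' U (\<lambda>x. g (f x))"
    using \<open>open U\<close>
    by (intro smooth_on_compose[OF _ T(1) _ smooth_on_subset[OF S(3)] T(3)]) (auto simp: U_def)
  then show ?thesis
    using \<open>open U\<close> S T unfolding smooth_near_def U_def by blast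
qed

lemma smooth_near_FD_vec:
  fixes f :: "'a::real_normed_vector \<Rightarrow> 'k::{real_normed_field,euclidean_space} ^ 'n"
  shows "smooth_near s (*s) z f \<Longrightarrow> smooth_near s (*s) z (\<lambda>x. FD f x v)"
  using smooth_on_FD_vec unfolding smooth_near_def by blast

lemma smooth_near_FD_mult:
  fixes f :: "'a::real_normed_vector \<Rightarrow> 'k::{real_normed_field,euclidean_space}"
  shows "smooth_near s (*) z f \<Longrightarrow> smooth_near s (*) z (\<lambda>x. FD f x v)"
  using smooth_on_FD_mult unfolding smooth_near_def by blast

text \<open>Base point and direction both vary. Expanding the direction in the standard basis over
  \<open>'k\<close> leaves smooth coefficients times derivatives in fixed directions; this needs the
  linearity of the derivative over \<open>'k\<close> at all points near
  \<open>\<phi> z\<close>.\<close>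

lemma smooth_near_FD_apply:
  fixes f :: "'k::{real_normed_field,euclidean_space} ^ 'n \<Rightarrow> 'k ^ 'm"
    and \<phi> h :: "'a::real_normed_vector \<Rightarrow> 'k ^ 'n"
  assumes "smooth_near s (*s) z \<phi>" "smooth_near s (*s) z h" "smooth_near (*s) (*s) (\<phi> z) f"
  shows "smooth_near s (*s) z (\<lambda>x. FD f (\<phi> x) (h x))"
proof -
  have vs: "vector_space s"
    using smooth_near_vector_space[OF assms(1)] by auto
  have "smooth_near s (*s) z (\<lambda>x. FD f (\<phi> x) (axis i 1))" for i
    by (rule smooth_near_compose[OF assms(1) smooth_near_FD_vec[OF assms(3)]])
  moreover have "smooth_near s (*) z (\<lambda>x. h x $ i)" for i
    using assms(2) by (simp add: smooth_near_vec_iff)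
  ultimately have "smooth_near s (*s) z (\<lambda>x. \<Sum>i\<in>UNIV. h x $ i *s FD f (\<phi> x) (axis i 1))"
    by (intro smooth_near_sum smooth_near_scaleV vs vector_space_vec)
  moreover have "(\<Sum>i\<in>UNIV. h x $ i *s FD f (\<phi> x) (axis i 1)) = FD f (\<phi> x) (h x)"
    if "smooth_near (*s) (*s) (\<phi> x) f" for x
  proof -
    interpret L: Vector_Spaces.linear "(*s)" "(*s)" "FD f (\<phi> x)"
      by (rule smooth_near_linear[OF that])
    have "FD f (\<phi> x) (\<Sum>i\<in>UNIV. h x $ i *s axis i 1) = (\<Sum>i\<in>UNIV. h x $ i *s FD f (\<phi> x) (axis i 1))"
      by (simp only: L.sum L.scale)
    then show ?thesis
      by (simp flip: vec_eq_sum_basis)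
  qed
  moreover have "\<forall>\<^sub>F x in nhds z. smooth_near (*s) (*s) (\<phi> x) f"
    by (rule eventually_compose_filterlim[OF smooth_near_eventually[OF assms(3)] smooth_near_filterlim[OF assms(1)]])
  ultimately show ?thesis
    by (elim smooth_near_cong) (auto elim: eventually_mono)
qed

section \<open>Charts\<close>

abbreviation coord_change :: "('a, 'k, 'm) chart \<Rightarrow> ('a, 'k, 'm) chart \<Rightarrow> 'k ^ 'm \<Rightarrow> 'k ^ 'm" where
  "coord_change c c' \<equiv> snd c' \<circ> chart_inv c"

context
  fixes A :: "('a::{t2_space,second_countable_topology}, 'k::{real_normed_field,euclidean_space}, 'm::finite) chart set"
  assumes A: "manifold A"
begin

lemma some_chart_in: "some_chart A p \<in> charts_at A p"
proof -
  have "p \<in> (\<Union>c\<in>A. fst c)"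
    using A by (simp add: manifold_def)
  then have "\<exists>c. c \<in> charts_at A p"
    by (auto simp: charts_at_def)
  then show ?thesis
    unfolding some_chart_def by (rule someI_ex)
qed

lemma chart_homeo: "c \<in> charts_at A p \<Longrightarrow> homeomorphism (fst c) (snd c ` fst c) (snd c) (chart_inv c)"
  using A by (auto simp: manifold_def charts_at_def)

lemma chart_open: "c \<in> charts_at A p \<Longrightarrow> open (fst c)" "c \<in> charts_at A p \<Longrightarrow> open (snd c ` fst c)"
  using A by (auto simp: manifold_def charts_at_def)

lemma chart_mem: "c \<in> charts_at A p \<Longrightarrow> p \<in> fst c"
  by (simp add: charts_at_def)

lemma chart_inv_snd [simp]: "c \<in> charts_at A p \<Longrightarrow> chart_inv c (snd c p) = p"
  using chart_homeo[of c p] chart_mem by (auto simp: homeomorphism_def)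

lemma snd_chart_inv: "c \<in> charts_at A p \<Longrightarrow> y \<in> snd c ` fst c \<Longrightarrow> snd c (chart_inv c y) = y"
  using chart_homeo[of c p] by (auto simp: homeomorphism_def)

lemma chart_inv_in: "c \<in> charts_at A p \<Longrightarrow> y \<in> snd c ` fst c \<Longrightarrow> c \<in> charts_at A (chart_inv c y)"
  by (auto simp: charts_at_def intro: inv_into_into)

lemma filterlim_chart: "c \<in> charts_at A p \<Longrightarrow> filterlim (snd c) (nhds (snd c p)) (nhds p)"
  using chart_homeo[of c p] chart_open[of c p] chart_mem[of c p]
  by (auto simp: homeomorphism_def continuous_on_eq_continuous_at isCont_def tendsto_at_iff_tendsto_nhds)

lemma filterlim_chart_inv: "c \<in> charts_at A p \<Longrightarrow> filterlim (chart_inv c) (nhds p) (nhds (snd c p))"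
proof -
  assume c: "c \<in> charts_at A p"
  then have "isCont (chart_inv c) (snd c p)"
    using chart_homeo[OF c] chart_open[OF c] chart_mem[OF c]
    by (auto simp: homeomorphism_def continuous_on_eq_continuous_at)
  then show ?thesis
    unfolding isCont_def tendsto_at_iff_tendsto_nhds using c by simp
qed

lemma charts_at_eventually: "c \<in> charts_at A p \<Longrightarrow> \<forall>\<^sub>F q in nhds p. c \<in> charts_at A q"
  using chart_open(1)[of c p] by (auto simp: charts_at_def eventually_nhds)

lemma eventually_chart_iff:
  assumes "c \<in> charts_at A p"
  shows "(\<forall>\<^sub>F y in nhds (snd c p). P (chart_inv c y)) \<longleftrightarrow> (\<forall>\<^sub>F q in nhds p. P q)"
proof
  assume "\<forall>\<^sub>F y in nhds (snd c p). P (chart_inv c y)"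
  then have "\<forall>\<^sub>F q in nhds p. P (chart_inv c (snd c q))"
    by (rule eventually_compose_filterlim[OF _ filterlim_chart[OF assms]])
  then show "\<forall>\<^sub>F q in nhds p. P q"
    using charts_at_eventually[OF assms] by eventually_elim simp
next
  assume "\<forall>\<^sub>F q in nhds p. P q"
  then show "\<forall>\<^sub>F y in nhds (snd c p). P (chart_inv c y)"
    by (rule eventually_compose_filterlim[OF _ filterlim_chart_inv[OF assms]])
qed

lemma chart_image_eventually:
  "c \<in> charts_at A p \<Longrightarrow> \<forall>\<^sub>F y in nhds (snd c p). y \<in> snd c ` fst c"
  using chart_open(2)[of c p] chart_mem[of c p] by (auto simp: eventually_nhds)

lemma coord_change_smooth:
  assumes "c \<in> charts_at A p" "c' \<in> charts_at A p"
  shows "smooth_near (*s) (*s) (snd c p) (coord_change c c')"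
proof -
  have "open (snd c ` (fst c \<inter> fst c'))"
    using homeomorphism_imp_open_map[OF chart_homeo[OF assms(1)], of "fst c \<inter> fst c'"]
      chart_open assms openin_open_eq openin_open_trans by (metis (no_types, lifting) inf_le1 open_Int openin_open_Int)
  then show ?thesis
    using A assms unfolding smooth_near_def manifold_def charts_at_def by blast
qed

text \<open>The definition asks for some chart around p; since coordinate changes are smooth, any
  chart will do. Most closure properties are then read off in \<open>some_chart A p\<close>.\<close>

lemma smooth_at_iff:
  assumes "c \<in> charts_at A p"
  shows "smooth_at A s p h \<longleftrightarrow> smooth_near (*s) s (snd c p) (h \<circ> chart_inv c)"
proof
  assume "smooth_at A s p h"
  then obtain c0 where c0: "c0 \<in> charts_at A p" "smooth_near (*s) s (snd c0 p) (h \<circ> chart_inv c0)"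
    by (auto simp: smooth_at_def smooth_near_def)
  have "smooth_near (*s) s (snd c p) (\<lambda>y. (h \<circ> chart_inv c0) (coord_change c c0 y))"
    by (rule smooth_near_compose[OF coord_change_smooth[OF assms c0(1)]]) (use c0 assms in \<open>simp add: comp_def\<close>)
  moreover have "\<forall>\<^sub>F y in nhds (snd c p). (h \<circ> chart_inv c0) (coord_change c c0 y) = (h \<circ> chart_inv c) y"
    using eventually_compose_filterlim[OF charts_at_eventually[OF c0(1)] filterlim_chart_inv[OF assms]]
    by (rule eventually_mono) simp
  ultimately show "smooth_near (*s) s (snd c p) (h \<circ> chart_inv c)"
    by (rule smooth_near_cong)
next
  assume "smooth_near (*s) s (snd c p) (h \<circ> chart_inv c)"
  then obtain S where "open S" "snd c p \<in> S" "smooth_on (*s) s S (h \<circ> chart_inv c)"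
    by (auto simp: smooth_near_def)
  then show "smooth_at A s p h"
    using assms chart_open(2)[OF assms] chart_mem[OF assms] unfolding smooth_at_def
    by (intro bexI[OF _ assms] exI[of _ "S \<inter> snd c ` fst c"]) (auto intro: smooth_on_subset)
qed

text \<open>The chain rule for coordinate changes. It is what makes \<open>coord_vec\<close> a
  consistent family, that is, a tangent vector.\<close>

lemma coord_change_cocycle:
  assumes "c \<in> charts_at A p" "c' \<in> charts_at A p" "c'' \<in> charts_at A p"
  shows "FD (coord_change c c'') (snd c p) \<xi>
    = FD (coord_change c' c'') (snd c' p) (FD (coord_change c c') (snd c p) \<xi>)"
proof -
  have "FD (\<lambda>y. coord_change c' c'' (coord_change c c' y)) (snd c p) \<xi>
      = FD (coord_change c' c'') (snd c' p) (FD (coord_change c c') (snd c p) \<xi>)"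
    using coord_change_smooth[OF assms(2,3), THEN smooth_near_has_derivative] assms(1)
    by (intro FD_compose[OF coord_change_smooth[OF assms(1,2), THEN smooth_near_has_derivative]]) (simp add: comp_def)
  moreover have "FD (\<lambda>y. coord_change c' c'' (coord_change c c' y)) (snd c p) = FD (coord_change c c'') (snd c p)"
    by (rule FD_cong, rule eventually_mono[OF eventually_compose_filterlim[OF
          charts_at_eventually[OF assms(2)] filterlim_chart_inv[OF assms(1)]]]) simp
  ultimately show ?thesis
    by (simp only:)
qed

lemma coord_change_self:
  assumes "c \<in> charts_at A p"
  shows "FD (coord_change c c) (snd c p) = (\<lambda>\<xi>. \<xi>)"
proof -
  have "\<forall>\<^sub>F y in nhds (snd c p). coord_change c c y = y"
    using chart_image_eventually[OF assms] snd_chart_inv[OF assms] by (auto elim!: eventually_mono)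
  from FD_cong[OF this] show ?thesis
    using FD_eq[OF has_derivative_ident] by metis
qed

lemma coord_change_linear:
  assumes "c \<in> charts_at A p" "c' \<in> charts_at A p"
  shows "Vector_Spaces.linear (*s) (*s) (FD (coord_change c c') (snd c p))"
  by (rule smooth_near_linear[OF coord_change_smooth[OF assms]])

section \<open>Tangent spaces as vector spaces over the ground field\<close>

lemma tangent_eq:
  "u \<in> tangent_space A p \<Longrightarrow> c \<in> charts_at A p \<Longrightarrow> c' \<in> charts_at A p \<Longrightarrow>
    u c' = FD (coord_change c c') (snd c p) (u c)"
  unfolding tangent_space_def by blast

lemma tangent_outside: "u \<in> tangent_space A p \<Longrightarrow> c \<notin> charts_at A p \<Longrightarrow> u c = 0"
  unfolding tangent_space_def by blast

lemma tangent_ext: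
  assumes "u \<in> tangent_space A p" "v \<in> tangent_space A p" "c \<in> charts_at A p" "u c = v c"
  shows "u = v"
proof
  fix c'
  show "u c' = v c'"
  proof (cases "c' \<in> charts_at A p")
    case True
    then show ?thesis
      using tangent_eq[OF assms(1,3)] tangent_eq[OF assms(2,3)] assms(4) by metis
  next
    case False
    then show ?thesis
      using assms(1,2) by (simp add: tangent_outside)
  qed
qed

lemma tangent_zero: "(\<lambda>_. 0) \<in> tangent_space A p"
proof -
  have "FD (coord_change c c') (snd c p) 0 = 0" if "c \<in> charts_at A p" "c' \<in> charts_at A p" for c c'
    by (rule has_derivative_linear[OF smooth_near_has_derivative[OF coord_change_smooth[OF that]], THEN linear_0])
  then show ?thesis
    by (simp add: tangent_space_def)
qed

lemma tangent_add:
  assumes "u \<in> tangent_space A p" "v \<in> tangent_space A p"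
  shows "tadd u v \<in> tangent_space A p"
proof -
  have "FD (coord_change c c') (snd c p) (u c + v c) = u c' + v c'"
    if "c \<in> charts_at A p" "c' \<in> charts_at A p" for c c'
    using coord_change_linear[OF that] assms[THEN tangent_eq[OF _ that]]
    unfolding Vector_Spaces.linear_iff by metis
  moreover have "u c + v c = 0" if "c \<notin> charts_at A p" for c
    using assms that by (simp add: tangent_outside)
  ultimately show ?thesis
    unfolding tangent_space_def tadd_def by auto
qed

lemma tangent_scale:
  assumes "u \<in> tangent_space A p"
  shows "tscale k u \<in> tangent_space A p"
proof -
  have "FD (coord_change c c') (snd c p) (k *s u c) = k *s u c'"
    if "c \<in> charts_at A p" "c' \<in> charts_at A p" for c c'
    using coord_change_linear[OF that] tangent_eq[OF assms that]
    unfolding Vector_Spaces.linear_iff by metis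
  moreover have "k *s u c = 0" if "c \<notin> charts_at A p" for c
    using assms that by (simp add: tangent_outside)
  ultimately show ?thesis
    unfolding tangent_space_def tscale_def by auto
qed

lemma coord_vec_in: "c \<in> charts_at A p \<Longrightarrow> coord_vec A c \<xi> p \<in> tangent_space A p"
  unfolding tangent_space_def coord_vec_def by (auto intro: coord_change_cocycle)

lemma coord_vec_self: "c \<in> charts_at A p \<Longrightarrow> coord_vec A c \<xi> p c = \<xi>"
  by (simp add: coord_vec_def coord_change_self)

lemma coord_vec_eq: "u \<in> tangent_space A p \<Longrightarrow> c \<in> charts_at A p \<Longrightarrow> coord_vec A c (u c) p = u"
  by (rule tangent_ext[OF coord_vec_in]) (auto simp: coord_vec_self)

section \<open>Smooth functions near a point of a manifold\<close>

lemma smooth_at_eventually: "smooth_at A s p h \<Longrightarrow> \<forall>\<^sub>F q in nhds p. smooth_at A s q h"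
proof -
  assume h: "smooth_at A s p h"
  let ?c = "some_chart A p"
  have "\<forall>\<^sub>F y in nhds (snd ?c p). smooth_near (*s) s y (h \<circ> chart_inv ?c)"
    using h smooth_at_iff[OF some_chart_in] smooth_near_eventually by blast
  from eventually_compose_filterlim[OF this filterlim_chart[OF some_chart_in]]
  show ?thesis
    using charts_at_eventually[OF some_chart_in]
    by eventually_elim (simp add: smooth_at_iff)
qed

lemma smooth_at_cong:
  assumes "smooth_at A s p g" "\<forall>\<^sub>F q in nhds p. g q = h q"
  shows "smooth_at A s p h"
  using smooth_near_cong[of "(*s)" s "snd (some_chart A p) p" "g \<circ> chart_inv (some_chart A p)" "h \<circ> chart_inv (some_chart A p)"]
    assms eventually_chart_iff[OF some_chart_in, of "\<lambda>q. g q = h q"] smooth_at_iff[OF some_chart_in] by auto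

lemma smooth_at_const: "vector_space s \<Longrightarrow> smooth_at A s p (\<lambda>_. k)"
  by (simp add: smooth_at_iff[OF some_chart_in] comp_def smooth_near_const vector_space_vec)

lemma smooth_at_add: "smooth_at A s p g \<Longrightarrow> smooth_at A s p h \<Longrightarrow> smooth_at A s p (\<lambda>q. g q + h q)"
  by (simp add: smooth_at_iff[OF some_chart_in] comp_def smooth_near_add)

lemma smooth_at_mult: "smooth_at A (*) p g \<Longrightarrow> smooth_at A (*) p h \<Longrightarrow> smooth_at A (*) p (\<lambda>q. g q * h q)"
  by (simp add: smooth_at_iff[OF some_chart_in] comp_def smooth_near_mult)

lemma smooth_at_uminus: "smooth_at A (*) p g \<Longrightarrow> smooth_at A (*) p (\<lambda>q. - g q)"
  using smooth_at_mult[OF smooth_at_const[OF vector_space_mult], of p g "-1"] by simp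

lemma smooth_at_diff: "smooth_at A (*) p g \<Longrightarrow> smooth_at A (*) p h \<Longrightarrow> smooth_at A (*) p (\<lambda>q. g q - h q)"
  using smooth_at_add[of "(*)" p g "\<lambda>q. - h q"] smooth_at_uminus[of p h] by simp

lemma smooth_at_sum:
  "(\<And>i. i \<in> I \<Longrightarrow> smooth_at A (*) p (g i)) \<Longrightarrow> smooth_at A (*) p (\<lambda>q. \<Sum>i\<in>I. g i q)"
  by (induction I rule: infinite_finite_induct) (auto intro: smooth_at_add smooth_at_const vector_space_mult)

lemma smooth_at_scaleV: "smooth_at A (*) p g \<Longrightarrow> smooth_at A (*s) p h \<Longrightarrow> smooth_at A (*s) p (\<lambda>q. g q *s h q)"
  by (simp add: smooth_at_iff[OF some_chart_in] comp_def smooth_near_scaleV)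

lemma smooth_at_vec_iff: "smooth_at A (*s) p g \<longleftrightarrow> (\<forall>i. smooth_at A (*) p (\<lambda>q. g q $ i))"
  by (simp add: smooth_at_iff[OF some_chart_in] comp_def smooth_near_vec_iff)

lemma smooth_at_inverse: "smooth_at A (*) p g \<Longrightarrow> g p \<noteq> 0 \<Longrightarrow> smooth_at A (*) p (\<lambda>q. inverse (g q))"
  by (simp add: smooth_at_iff[OF some_chart_in] comp_def smooth_near_inverse chart_inv_snd[OF some_chart_in])

lemma smooth_at_prod:
  "(\<And>i. i \<in> I \<Longrightarrow> smooth_at A (*) p (g i)) \<Longrightarrow> smooth_at A (*) p (\<lambda>q. \<Prod>i\<in>I. g i q)"
  by (induction I rule: infinite_finite_induct) (auto intro: smooth_at_mult smooth_at_const vector_space_mult)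

lemma smooth_at_det:
  fixes M :: "'a \<Rightarrow> 'k ^ 'l ^ 'l"
  assumes "\<And>i j. smooth_at A (*) p (\<lambda>q. M q $ i $ j)"
  shows "smooth_at A (*) p (\<lambda>q. det (M q))"
  unfolding det_def
  by (intro smooth_at_sum smooth_at_mult smooth_at_prod smooth_at_const vector_space_mult assms)

text \<open>By Cramer's rule the solution consists of quotients of determinants, which are
  polynomials in the smooth entries of the matrix and the right-hand side. This is the source of all
  vector fields constructed later.\<close>

lemma smooth_at_solve:
  fixes M :: "'a \<Rightarrow> 'k ^ 'l ^ 'l"
  assumes M: "\<And>i j. smooth_at A (*) p (\<lambda>q. M q $ i $ j)" and b: "smooth_at A (*s) p b"
    and det: "\<forall>\<^sub>F q in nhds p. det (M q) \<noteq> 0"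
  shows "\<exists>y. smooth_at A (*s) p y \<and> (\<forall>\<^sub>F q in nhds p. M q *v y q = b q)"
proof (intro exI conjI)
  let ?B = "\<lambda>q k. (\<chi> i j. if j = k then b q $ i else M q $ i $ j) :: 'k ^ 'l ^ 'l"
  let ?y = "\<lambda>q. (\<chi> k. det (?B q k) * inverse (det (M q))) :: 'k ^ 'l"
  have "smooth_at A (*) p (\<lambda>q. ?B q k $ i $ j)" for i j k
    using M b by (cases "j = k") (simp_all add: smooth_at_vec_iff)
  then have "smooth_at A (*) p (\<lambda>q. det (?B q k) * inverse (det (M q)))" for k
    by (intro smooth_at_mult smooth_at_inverse smooth_at_det M eventually_nhds_x_imp_x[OF det])
  then show "smooth_at A (*s) p ?y"
    by (simp add: smooth_at_vec_iff)
  show "\<forall>\<^sub>F q in nhds p. M q *v ?y q = b q"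
    using det by eventually_elim (simp add: cramer field_simps)
qed

section \<open>Differentials of functions\<close>

lemma smooth_at_has_derivative:
  "smooth_at A s p h \<Longrightarrow> c \<in> charts_at A p \<Longrightarrow>
    ((h \<circ> chart_inv c) has_derivative FD (h \<circ> chart_inv c) (snd c p)) (at (snd c p))"
  using smooth_near_has_derivative smooth_at_iff by blast

lemma FD_chart_change:
  assumes "smooth_at A s p h" "c \<in> charts_at A p" "c' \<in> charts_at A p"
  shows "FD (h \<circ> chart_inv c) (snd c p) \<xi> = FD (h \<circ> chart_inv c') (snd c' p) (FD (coord_change c c') (snd c p) \<xi>)"
proof -
  have "FD (\<lambda>y. (h \<circ> chart_inv c') (coord_change c c' y)) (snd c p) \<xi>
      = FD (h \<circ> chart_inv c') (snd c' p) (FD (coord_change c c') (snd c p) \<xi>)"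
    using smooth_at_has_derivative[OF assms(1,3)] assms(2)
    by (intro FD_compose[OF coord_change_smooth[OF assms(2,3), THEN smooth_near_has_derivative]]) (simp add: comp_def)
  moreover have "FD (\<lambda>y. (h \<circ> chart_inv c') (coord_change c c' y)) (snd c p) = FD (h \<circ> chart_inv c) (snd c p)"
    by (rule FD_cong, rule eventually_mono[OF eventually_compose_filterlim[OF
          charts_at_eventually[OF assms(3)] filterlim_chart_inv[OF assms(2)]]]) simp
  ultimately show ?thesis
    by (simp only:)
qed

text \<open>Frees the differential from the chart picked at p: the components of u and the
  derivative of h transform inversely. Only with one chart for all nearby points can the dependence
  on the point be studied.\<close>

lemma differential_chart:
  assumes "smooth_at A (*) p h" "c \<in> charts_at A p" "u \<in> tangent_space A p"
  shows "differential A h p u = FD (h \<circ> chart_inv c) (snd c p) (u c)"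
  using FD_chart_change[OF assms(1) assms(2) some_chart_in] tangent_eq[OF assms(3,2) some_chart_in]
  by (simp add: differential_def Let_def)

lemma differential_linear:
  assumes "smooth_at A (*) p h" "u \<in> tangent_space A p" "v \<in> tangent_space A p"
  shows "differential A h p (tadd u v) = differential A h p u + differential A h p v"
    and "differential A h p (tscale k u) = k * differential A h p u"
proof -
  have "Vector_Spaces.linear (*s) (*) (FD (h \<circ> chart_inv (some_chart A p)) (snd (some_chart A p) p))"
    using assms(1) smooth_at_iff[OF some_chart_in] smooth_near_linear by blast
  then show "differential A h p (tadd u v) = differential A h p u + differential A h p v"
    "differential A h p (tscale k u) = k * differential A h p u"
    by (auto simp: Vector_Spaces.linear_iff differential_def Let_def tadd_def tscale_def)
qed

lemma differential_add:
  assumes "smooth_at A (*) p g" "smooth_at A (*) p h"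
  shows "differential A (\<lambda>q. g q + h q) p u = differential A g p u + differential A h p u"
  using FD_eq[OF has_derivative_add[OF assms[THEN smooth_at_has_derivative[OF _ some_chart_in]]]]
  by (simp add: differential_def Let_def comp_def)

lemma differential_mult:
  assumes "smooth_at A (*) p g" "smooth_at A (*) p h"
  shows "differential A (\<lambda>q. g q * h q) p u = g p * differential A h p u + differential A g p u * h p"
  using FD_eq[OF has_derivative_mult[OF assms[THEN smooth_at_has_derivative[OF _ some_chart_in]]]]
  by (simp add: differential_def Let_def comp_def chart_inv_snd[OF some_chart_in])

lemma differential_const: "differential A (\<lambda>_. k) p u = 0"
  using FD_eq[OF has_derivative_const] by (simp add: differential_def Let_def comp_def)

lemma differential_cong:
  assumes "\<forall>\<^sub>F q in nhds p. g q = h q"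
  shows "differential A g p u = differential A h p u"
proof -
  have "\<forall>\<^sub>F y in nhds (snd (some_chart A p) p). (g \<circ> chart_inv (some_chart A p)) y = (h \<circ> chart_inv (some_chart A p)) y"
    using assms by (simp add: eventually_chart_iff[OF some_chart_in, of "\<lambda>q. g q = h q"])
  from FD_cong[OF this] show ?thesis
    by (simp add: differential_def Let_def comp_def)
qed

text \<open>In the fixed chart c the function is a directional derivative of the coordinate
  expression of h, so smoothness reduces to \<open>smooth_near_FD_mult\<close>.\<close>

lemma differential_coord_smooth:
  assumes "smooth_at A (*) p h" "c \<in> charts_at A p"
  shows "smooth_at A (*) p (\<lambda>q. differential A h q (coord_vec A c \<xi> q))"
proof -
  have "smooth_near (*s) (*) (snd c p) (\<lambda>y. FD (h \<circ> chart_inv c) y \<xi>)"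
    using assms smooth_at_iff smooth_near_FD_mult by blast
  moreover have "\<forall>\<^sub>F q in nhds p. FD (h \<circ> chart_inv c) (snd c q) \<xi> = differential A h q (coord_vec A c \<xi> q)"
    using smooth_at_eventually[OF assms(1)] charts_at_eventually[OF assms(2)]
    by eventually_elim (simp add: differential_chart coord_vec_in coord_vec_self)
  then have "\<forall>\<^sub>F y in nhds (snd c p). FD (h \<circ> chart_inv c) (snd c (chart_inv c y)) \<xi> =
      differential A h (chart_inv c y) (coord_vec A c \<xi> (chart_inv c y))"
    by (subst eventually_chart_iff[OF assms(2)])
  then have "\<forall>\<^sub>F y in nhds (snd c p). FD (h \<circ> chart_inv c) y \<xi> =
      ((\<lambda>q. differential A h q (coord_vec A c \<xi> q)) \<circ> chart_inv c) y"
    using chart_image_eventually[OF assms(2)]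
    by eventually_elim (simp add: snd_chart_inv[OF assms(2)])
  ultimately show ?thesis
    unfolding smooth_at_iff[OF assms(2)] by (rule smooth_near_cong)
qed

end

section \<open>Smooth maps and their tangent maps\<close>

lemma smooth_at_filterlim:
  assumes "manifold A" "smooth_at A s p h"
  shows "filterlim h (nhds (h p)) (nhds p)"
proof -
  let ?c = "some_chart A p"
  note c = some_chart_in[OF assms(1), of p]
  have "filterlim (h \<circ> chart_inv ?c) (nhds (h p)) (nhds (snd ?c p))"
    using smooth_near_filterlim assms(2) smooth_at_iff[OF assms(1) c] chart_inv_snd[OF assms(1) c]
    by (metis comp_apply)
  then have "filterlim (\<lambda>q. (h \<circ> chart_inv ?c) (snd ?c q)) (nhds (h p)) (nhds p)"
    by (rule filterlim_compose[OF _ filterlim_chart[OF assms(1) c]])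
  moreover have "\<forall>\<^sub>F q in nhds p. (h \<circ> chart_inv ?c) (snd ?c q) = h q"
    using charts_at_eventually[OF assms(1) c] by eventually_elim (simp add: chart_inv_snd[OF assms(1)])
  ultimately show ?thesis
    by (simp cong: filterlim_cong)
qed

lemma smooth_at_flat_compose:
  fixes h :: "'a::{t2_space,second_countable_topology} \<Rightarrow> 'k::{real_normed_field,euclidean_space} ^ 'm"
  assumes A: "manifold A" and h: "smooth_at A (*s) p h" and g: "smooth_near (*s) s (h p) g"
  shows "smooth_at A s p (\<lambda>q. g (h q))"
proof -
  note c = some_chart_in[OF A, of p]
  have "smooth_near (*s) s (snd (some_chart A p) p) (\<lambda>y. g ((h \<circ> chart_inv (some_chart A p)) y))"
    by (rule smooth_near_compose[where f = "h \<circ> chart_inv (some_chart A p)" and g = g])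
      (use h g in \<open>simp_all add: smooth_at_iff[OF A c] chart_inv_snd[OF A c]\<close>)
  then show ?thesis
    by (simp add: smooth_at_iff[OF A c] comp_def)
qed

text \<open>\<open>smooth_map_at\<close> does not mention continuity of f. It follows because nearby
  points are mapped into one chart domain, where f is the inverse chart after a continuous
  coordinate expression.\<close>

lemma smooth_map_at_filterlim:
  assumes A: "manifold A" and B: "manifold B" and f: "smooth_map_at A B p f"
  shows "filterlim f (nhds (f p)) (nhds p)"
proof -
  obtain c where c: "c \<in> charts_at B (f p)" "\<forall>\<^sub>F x in nhds p. f x \<in> fst c" "smooth_at A (*s) p (snd c \<circ> f)"
    using f by (auto simp: smooth_map_at_def)
  have "filterlim (\<lambda>x. chart_inv c ((snd c \<circ> f) x)) (nhds (f p)) (nhds p)"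
    using filterlim_compose[OF filterlim_chart_inv[OF B c(1)], of "snd c \<circ> f"] smooth_at_filterlim[OF A c(3)]
    by (simp add: comp_def)
  moreover have "\<forall>\<^sub>F x in nhds p. chart_inv c ((snd c \<circ> f) x) = f x"
    using c(2) by eventually_elim (use chart_inv_snd[OF B] c(1) in \<open>auto simp: charts_at_def\<close>)
  ultimately show ?thesis
    by (simp cong: filterlim_cong)
qed

lemma smooth_map_at_charts_eventually:
  assumes "manifold A" "manifold B" "smooth_map_at A B p f" "c \<in> charts_at B (f p)"
  shows "\<forall>\<^sub>F x in nhds p. c \<in> charts_at B (f x)"
  by (rule eventually_compose_filterlim[OF charts_at_eventually[OF assms(2,4)] smooth_map_at_filterlim[OF assms(1-3)]])

lemma smooth_map_at_chart:
  assumes A: "manifold A" and B: "manifold B" and f: "smooth_map_at A B p f" and c: "c \<in> charts_at B (f p)"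
  shows "smooth_at A (*s) p (snd c \<circ> f)"
proof -
  obtain c0 where c0: "c0 \<in> charts_at B (f p)" "smooth_at A (*s) p (snd c0 \<circ> f)"
    using f by (auto simp: smooth_map_at_def)
  have "smooth_at A (*s) p (\<lambda>x. coord_change c0 c ((snd c0 \<circ> f) x))"
    using coord_change_smooth[OF B c0(1) c] by (intro smooth_at_flat_compose[OF A c0(2)]) (simp add: comp_def)
  moreover have "\<forall>\<^sub>F x in nhds p. coord_change c0 c ((snd c0 \<circ> f) x) = (snd c \<circ> f) x"
    using smooth_map_at_charts_eventually[OF A B f c0(1)]
    by eventually_elim (simp add: chart_inv_snd[OF B])
  ultimately show ?thesis
    by (rule smooth_at_cong[OF A])
qed

lemma smooth_map_atI:
  assumes "c \<in> charts_at B (f p)" "\<forall>\<^sub>F x in nhds p. f x \<in> fst c" "smooth_at A (*s) p (snd c \<circ> f)"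
  shows "smooth_map_at A B p f"
  using assms by (auto simp: smooth_map_at_def)

lemma smooth_map_at_eventually:
  assumes A: "manifold A" and B: "manifold B" and f: "smooth_map_at A B p f"
  shows "\<forall>\<^sub>F x in nhds p. smooth_map_at A B x f"
proof -
  note c = some_chart_in[OF B, of "f p"]
  have ev: "\<forall>\<^sub>F x in nhds p. some_chart B (f p) \<in> charts_at B (f x)"
    by (rule smooth_map_at_charts_eventually[OF A B f c])
  then have "\<forall>\<^sub>F x in nhds p. \<forall>\<^sub>F y in nhds x. some_chart B (f p) \<in> charts_at B (f y)"
    by (simp add: eventually_eventually)
  then show ?thesis
    using ev smooth_at_eventually[OF A smooth_map_at_chart[OF A B f c]]
    by eventually_elim (auto intro!: smooth_map_atI simp: charts_at_def)
qed

lemma smooth_map_at_id: "manifold A \<Longrightarrow> smooth_map_at A A p id"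
proof -
  assume A: "manifold A"
  note c = some_chart_in[OF A, of p]
  have "smooth_at A (*s) p (snd (some_chart A p))"
    using coord_change_smooth[OF A c c] by (simp add: smooth_at_iff[OF A c])
  then show ?thesis
    using charts_at_eventually[OF A c] c
    by (intro smooth_map_atI[of "some_chart A p"]) (auto simp: charts_at_def comp_def elim: eventually_mono)
qed

lemma smooth_at_compose:
  assumes A: "manifold A" and B: "manifold B" and f: "smooth_map_at A B p f" and h: "smooth_at B s (f p) h"
  shows "smooth_at A s p (\<lambda>x. h (f x))"
proof -
  note c = some_chart_in[OF B, of "f p"]
  have "smooth_at A s p (\<lambda>x. (h \<circ> chart_inv (some_chart B (f p))) ((snd (some_chart B (f p)) \<circ> f) x))"
    using h by (intro smooth_at_flat_compose[OF A smooth_map_at_chart[OF A B f c]])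
      (simp add: smooth_at_iff[OF B c] comp_def)
  moreover have "\<forall>\<^sub>F x in nhds p.
      (h \<circ> chart_inv (some_chart B (f p))) ((snd (some_chart B (f p)) \<circ> f) x) = h (f x)"
    using smooth_map_at_charts_eventually[OF A B f c] by eventually_elim (simp add: chart_inv_snd[OF B])
  ultimately show ?thesis
    by (rule smooth_at_cong[OF A])
qed

lemma tangent_map_chart:
  assumes A: "manifold A" and B: "manifold B" and f: "smooth_map_at A B p f"
    and c: "c \<in> charts_at A p" and c': "c' \<in> charts_at B (f p)" and u: "u \<in> tangent_space A p"
  shows "tangent_map A B f p u c' = FD (snd c' \<circ> f \<circ> chart_inv c) (snd c p) (u c)"
  using FD_chart_change[OF A smooth_map_at_chart[OF A B f c'] c some_chart_in[OF A]]
    tangent_eq[OF A u c some_chart_in[OF A]] c'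
  by (simp add: tangent_map_def Let_def)

lemma tangent_map_in:
  assumes A: "manifold A" and B: "manifold B" and f: "smooth_map_at A B p f" and u: "u \<in> tangent_space A p"
  shows "tangent_map A B f p u \<in> tangent_space B (f p)"
proof -
  note c = some_chart_in[OF A, of p]
  let ?c = "some_chart A p"
  have "tangent_map A B f p u c'' = FD (coord_change c' c'') (snd c' (f p)) (tangent_map A B f p u c')"
    if c': "c' \<in> charts_at B (f p)" and c'': "c'' \<in> charts_at B (f p)" for c' c''
  proof -
    have d: "(snd c' \<circ> f \<circ> chart_inv ?c has_derivative FD (snd c' \<circ> f \<circ> chart_inv ?c) (snd ?c p)) (at (snd ?c p))"
      by (rule smooth_at_has_derivative[OF A smooth_map_at_chart[OF A B f c'] c])
    have "FD (\<lambda>y. coord_change c' c'' ((snd c' \<circ> f \<circ> chart_inv ?c) y)) (snd ?c p) (u ?c)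
        = FD (coord_change c' c'') (snd c' (f p)) (FD (snd c' \<circ> f \<circ> chart_inv ?c) (snd ?c p) (u ?c))"
      using smooth_near_has_derivative[OF coord_change_smooth[OF B c' c'']] chart_inv_snd[OF A c]
      by (intro FD_compose[OF d]) (simp add: comp_def)
    moreover have "FD (\<lambda>y. coord_change c' c'' ((snd c' \<circ> f \<circ> chart_inv ?c) y)) (snd ?c p)
        = FD (snd c'' \<circ> f \<circ> chart_inv ?c) (snd ?c p)"
      by (rule FD_cong, rule eventually_mono[OF eventually_compose_filterlim[OF
            smooth_map_at_charts_eventually[OF A B f c'] filterlim_chart_inv[OF A c]]])
        (simp add: chart_inv_snd[OF B])
    ultimately show ?thesis
      by (simp only: tangent_map_chart[OF A B f c _ u] c' c'')
  qed
  moreover have "tangent_map A B f p u c' = 0" if "c' \<notin> charts_at B (f p)" for c'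
    using that by (simp add: tangent_map_def)
  ultimately show ?thesis
    unfolding tangent_space_def by blast
qed

lemma tangent_map_id:
  assumes A: "manifold A" and u: "u \<in> tangent_space A p"
  shows "tangent_map A A id p u = u"
proof (rule tangent_ext[OF A _ u])
  show "tangent_map A A id p u \<in> tangent_space A p"
    using tangent_map_in[OF A A smooth_map_at_id[OF A] u] by simp
  show c: "some_chart A p \<in> charts_at A p"
    by (rule some_chart_in[OF A])
  show "tangent_map A A id p u (some_chart A p) = u (some_chart A p)"
    using tangent_map_chart[OF A A smooth_map_at_id[OF A] c _ u, of "some_chart A p"] c
      coord_change_self[OF A c] by simp
qed

lemma differential_compose:
  assumes A: "manifold A" and B: "manifold B" and f: "smooth_map_at A B p f"
    and h: "smooth_at B (*) (f p) h" and u: "u \<in> tangent_space A p"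
  shows "differential A (\<lambda>x. h (f x)) p u = differential B h (f p) (tangent_map A B f p u)"
proof -
  let ?c = "some_chart A p" and ?c' = "some_chart B (f p)"
  note c = some_chart_in[OF A, of p] and c' = some_chart_in[OF B, of "f p"]
  have d: "(snd ?c' \<circ> f \<circ> chart_inv ?c has_derivative FD (snd ?c' \<circ> f \<circ> chart_inv ?c) (snd ?c p)) (at (snd ?c p))"
    by (rule smooth_at_has_derivative[OF A smooth_map_at_chart[OF A B f c'] c])
  have "FD (\<lambda>y. (h \<circ> chart_inv ?c') ((snd ?c' \<circ> f \<circ> chart_inv ?c) y)) (snd ?c p) (u ?c)
      = FD (h \<circ> chart_inv ?c') (snd ?c' (f p)) (FD (snd ?c' \<circ> f \<circ> chart_inv ?c) (snd ?c p) (u ?c))"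
    using smooth_at_has_derivative[OF B h c'] chart_inv_snd[OF A c]
    by (intro FD_compose[OF d]) (simp add: comp_def)
  moreover have "FD (\<lambda>y. (h \<circ> chart_inv ?c') ((snd ?c' \<circ> f \<circ> chart_inv ?c) y)) (snd ?c p)
      = FD ((\<lambda>x. h (f x)) \<circ> chart_inv ?c) (snd ?c p)"
    by (rule FD_cong, rule eventually_mono[OF eventually_compose_filterlim[OF
          smooth_map_at_charts_eventually[OF A B f c'] filterlim_chart_inv[OF A c]]])
      (simp add: chart_inv_snd[OF B])
  ultimately show ?thesis
    using tangent_map_chart[OF A B f c c' u]
    by (simp add: differential_def Let_def)
qed

section \<open>Vector fields along a map\<close>

text \<open>\<open>vf_along\<close> asks for smooth components in one chart. The components in
  another arise by a derivative whose base point \<open>f x\<close> and whose argument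
  \<open>v x\<close> both vary, which is the situation of
  \<open>smooth_near_FD_apply\<close>.\<close>

lemma vf_along_chart:
  assumes A: "manifold A" and B: "manifold B" and f: "smooth_map_at A B p f"
    and v: "vf_along A B p f v" and c: "c \<in> charts_at B (f p)"
  shows "smooth_at A (*s) p (\<lambda>x. v x c)"
proof -
  obtain c0 where c0: "c0 \<in> charts_at B (f p)" "smooth_at A (*s) p (\<lambda>x. v x c0)"
    using v by (auto simp: vf_along_def)
  let ?e = "some_chart A p"
  note e = some_chart_in[OF A, of p]
  have "smooth_near (*s) (*s) (snd ?e p)
      (\<lambda>y. FD (coord_change c0 c) ((snd c0 \<circ> f \<circ> chart_inv ?e) y) (((\<lambda>x. v x c0) \<circ> chart_inv ?e) y))"
    using smooth_map_at_chart[OF A B f c0(1)] c0(2) coord_change_smooth[OF B c0(1) c] chart_inv_snd[OF A e]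
    by (intro smooth_near_FD_apply) (simp_all add: smooth_at_iff[OF A e] comp_def)
  then have "smooth_at A (*s) p (\<lambda>x. FD (coord_change c0 c) (snd c0 (f x)) (v x c0))"
    by (simp add: smooth_at_iff[OF A e] comp_def)
  moreover have "\<forall>\<^sub>F x in nhds p. v x \<in> tangent_space B (f x)"
    using v by (simp add: vf_along_def)
  then have "\<forall>\<^sub>F x in nhds p. FD (coord_change c0 c) (snd c0 (f x)) (v x c0) = v x c"
    using smooth_map_at_charts_eventually[OF A B f c] smooth_map_at_charts_eventually[OF A B f c0(1)]
    by eventually_elim (rule tangent_eq[OF B, symmetric])
  ultimately show ?thesis
    by (rule smooth_at_cong[OF A])
qed

lemma vf_along_tangent: "vf_along A B p f v \<Longrightarrow> \<forall>\<^sub>F x in nhds p. v x \<in> tangent_space B (f x)"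
  by (simp add: vf_along_def)

lemma vf_alongI:
  "\<forall>\<^sub>F x in nhds p. v x \<in> tangent_space B (f x) \<Longrightarrow> c \<in> charts_at B (f p) \<Longrightarrow>
    smooth_at A (*s) p (\<lambda>x. v x c) \<Longrightarrow> vf_along A B p f v"
  by (auto simp: vf_along_def)

lemma vf_along_eventually:
  assumes A: "manifold A" and B: "manifold B" and f: "smooth_map_at A B p f" and v: "vf_along A B p f v"
  shows "\<forall>\<^sub>F x in nhds p. vf_along A B x f v"
proof -
  have "\<forall>\<^sub>F x in nhds p. \<forall>\<^sub>F y in nhds x. v y \<in> tangent_space B (f y)"
    using vf_along_tangent[OF v] by (simp add: eventually_eventually)
  then show ?thesis
    using smooth_map_at_charts_eventually[OF A B f some_chart_in[OF B]]
      smooth_at_eventually[OF A vf_along_chart[OF A B f v some_chart_in[OF B]]]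
    by eventually_elim (rule vf_alongI)
qed

lemma vf_along_add:
  assumes A: "manifold A" and B: "manifold B" and f: "smooth_map_at A B p f"
    and v: "vf_along A B p f v" and w: "vf_along A B p f w"
  shows "vf_along A B p f (\<lambda>x. tadd (v x) (w x))"
proof (rule vf_alongI[OF _ some_chart_in[OF B]])
  show "\<forall>\<^sub>F x in nhds p. tadd (v x) (w x) \<in> tangent_space B (f x)"
    using vf_along_tangent[OF v] vf_along_tangent[OF w] by eventually_elim (rule tangent_add[OF B])
  show "smooth_at A (*s) p (\<lambda>x. tadd (v x) (w x) (some_chart B (f p)))"
    unfolding tadd_def
    by (intro smooth_at_add[OF A] vf_along_chart[OF A B f v] vf_along_chart[OF A B f w] some_chart_in[OF B])
qed

lemma vf_along_scale:
  assumes A: "manifold A" and B: "manifold B" and f: "smooth_map_at A B p f"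
    and h: "smooth_at A (*) p h" and v: "vf_along A B p f v"
  shows "vf_along A B p f (\<lambda>x. tscale (h x) (v x))"
proof (rule vf_alongI[OF _ some_chart_in[OF B]])
  show "\<forall>\<^sub>F x in nhds p. tscale (h x) (v x) \<in> tangent_space B (f x)"
    using vf_along_tangent[OF v] by eventually_elim (rule tangent_scale[OF B])
  show "smooth_at A (*s) p (\<lambda>x. tscale (h x) (v x) (some_chart B (f p)))"
    unfolding tscale_def
    by (intro smooth_at_scaleV[OF A] vf_along_chart[OF A B f v] h some_chart_in[OF B])
qed

lemma vf_along_zero: "manifold A \<Longrightarrow> manifold B \<Longrightarrow> vf_along A B p f (\<lambda>_ _. 0)"
  by (rule vf_alongI[OF _ some_chart_in])
    (auto simp: tangent_zero smooth_at_const vector_space_vec)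

lemma vf_along_compose:
  assumes A: "manifold A" and B: "manifold B" and f: "smooth_map_at A B p f"
    and Y: "vf_along B B (f p) id Y"
  shows "vf_along A B p f (\<lambda>x. Y (f x))"
proof (rule vf_alongI[OF _ some_chart_in[OF B]])
  show "\<forall>\<^sub>F x in nhds p. Y (f x) \<in> tangent_space B (f x)"
    using eventually_compose_filterlim[OF vf_along_tangent[OF Y] smooth_map_at_filterlim[OF A B f]] by simp
  show "smooth_at A (*s) p (\<lambda>x. Y (f x) (some_chart B (f p)))"
    using smooth_at_compose[OF A B f vf_along_chart[OF B B smooth_map_at_id[OF B] Y]] some_chart_in[OF B]
    by auto
qed

lemma vf_along_coord_vec:
  assumes A: "manifold A" and B: "manifold B" and f: "smooth_map_at A B p f"
    and c: "c \<in> charts_at B (f p)" and g: "smooth_at A (*s) p g"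
  shows "vf_along A B p f (\<lambda>x. coord_vec B c (g x) (f x))"
proof (rule vf_alongI[where c = c])
  show "c \<in> charts_at B (f p)"
    by (rule c)
  note ev = smooth_map_at_charts_eventually[OF A B f c]
  show "\<forall>\<^sub>F x in nhds p. coord_vec B c (g x) (f x) \<in> tangent_space B (f x)"
    using ev by eventually_elim (rule coord_vec_in[OF B])
  show "smooth_at A (*s) p (\<lambda>x. coord_vec B c (g x) (f x) c)"
    by (rule smooth_at_cong[OF A g eventually_mono[OF ev]]) (simp add: coord_vec_self[OF B])
qed

section \<open>One-forms and the exterior derivative\<close>

lemma sum_tangent:
  assumes "manifold A" "\<And>i. i \<in> I \<Longrightarrow> u i \<in> tangent_space A q"
  shows "(\<lambda>c. \<Sum>i\<in>I. u i c) \<in> tangent_space A q"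
  using assms(2)
proof (induction I rule: infinite_finite_induct)
  case (insert i I)
  then show ?case
    using tangent_add[OF assms(1), of "u i" q "\<lambda>c. \<Sum>i\<in>I. u i c"] by (simp add: tadd_def)
qed (auto simp: tangent_zero[OF assms(1)])

text \<open>The linearity clause of \<open>one_form_at\<close> at a single point. Forms are total
  functions on families of components, so linearity is demanded on genuine tangent vectors
  only.\<close>

definition linear_form ::
  "('a, 'k::{real_normed_field,euclidean_space}, 'm::finite) chart set \<Rightarrow> 'a \<Rightarrow>
   (('a, 'k, 'm) tangent \<Rightarrow> 'k) \<Rightarrow> bool" where
  "linear_form A q l \<longleftrightarrow> (\<forall>u\<in>tangent_space A q. \<forall>v\<in>tangent_space A q. \<forall>k.
     l (tadd u v) = l u + l v \<and> l (tscale k u) = k * l u)"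

lemma linear_form_add: "linear_form A q l \<Longrightarrow> u \<in> tangent_space A q \<Longrightarrow> v \<in> tangent_space A q \<Longrightarrow>
    l (tadd u v) = l u + l v"
  by (simp add: linear_form_def)

lemma linear_form_scale: "linear_form A q l \<Longrightarrow> u \<in> tangent_space A q \<Longrightarrow> l (tscale k u) = k * l u"
  by (auto simp: linear_form_def)

lemma linear_form_zero:
  assumes "manifold A" "linear_form A q l"
  shows "l (\<lambda>_. 0) = 0"
  using linear_form_scale[OF assms(2) tangent_zero[OF assms(1)], of 0] by (simp add: tscale_def)

text \<open>A tangent vector is the combination of the coordinate vectors with its components in c
  as coefficients. Since \<open>linear_form\<close> provides only binary sums, finite sums are
  reached by induction.\<close>

lemma linear_form_expand:
  assumes A: "manifold A" and lf: "linear_form A q l" and c: "c \<in> charts_at A q" and u: "u \<in> tangent_space A q"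
  shows "l u = (\<Sum>i\<in>UNIV. u c $ i * l (coord_vec A c (axis i 1) q))"
proof -
  define e where "e = (\<lambda>i. tscale (u c $ i) (coord_vec A c (axis i 1) q))"
  have e: "e i \<in> tangent_space A q" for i
    unfolding e_def by (intro tangent_scale[OF A] coord_vec_in[OF A c])
  have "l (\<lambda>c. \<Sum>i\<in>I. e i c) = (\<Sum>i\<in>I. l (e i))" if "finite I" for I
    using that
  proof (induction I)
    case empty
    then show ?case using linear_form_zero[OF A lf] by simp
  next
    case (insert i I)
    then show ?case
      using linear_form_add[OF lf e sum_tangent[OF A, of I e], of i] e by (simp add: tadd_def)
  qed
  from this[OF finite] have "l (\<lambda>c. \<Sum>i\<in>UNIV. e i c) = (\<Sum>i\<in>UNIV. l (e i))" .
  moreover have "(\<lambda>c. \<Sum>i\<in>UNIV. e i c) = u"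
    by (rule tangent_ext[OF A sum_tangent[OF A e] u c])
      (simp add: e_def tscale_def coord_vec_self[OF A c] flip: vec_eq_sum_basis)
  moreover have "l (e i) = u c $ i * l (coord_vec A c (axis i 1) q)" for i
    unfolding e_def by (rule linear_form_scale[OF lf coord_vec_in[OF A c]])
  ultimately show ?thesis
    by simp
qed

lemma coord_vec_change:
  assumes A: "manifold A" and c: "c \<in> charts_at A q" and c': "c' \<in> charts_at A q"
  shows "coord_vec A c' (FD (coord_change c c') (snd c q) \<xi>) q = coord_vec A c \<xi> q"
proof (rule tangent_ext[OF A coord_vec_in[OF A c'] coord_vec_in[OF A c] c'])
  show "coord_vec A c' (FD (coord_change c c') (snd c q) \<xi>) q c' = coord_vec A c \<xi> q c'"
    using tangent_eq[OF A coord_vec_in[OF A c] c c'] by (simp add: coord_vec_self[OF A] c c')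
qed

lemma one_form_at_linear: "one_form_at A p \<alpha> \<Longrightarrow> \<forall>\<^sub>F q in nhds p. linear_form A q (\<alpha> q)"
  by (simp add: one_form_at_def linear_form_def)

lemma one_form_at_chart:
  assumes A: "manifold A" and \<alpha>: "one_form_at A p \<alpha>" and c: "c \<in> charts_at A p"
  shows "smooth_at A (*) p (\<lambda>q. \<alpha> q (coord_vec A c \<xi> q))"
proof -
  obtain c0 where c0: "c0 \<in> charts_at A p" "\<And>\<xi>. smooth_at A (*) p (\<lambda>q. \<alpha> q (coord_vec A c0 \<xi> q))"
    using \<alpha> by (auto simp: one_form_at_def)
  let ?g = "\<lambda>q. FD (coord_change c c0) (snd c q) \<xi>"
  have "smooth_at A (*s) p (snd c)"
    using smooth_map_at_chart[OF A A smooth_map_at_id[OF A], of c p] c by (simp add: comp_def)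
  then have "smooth_at A (*s) p ?g"
    by (rule smooth_at_flat_compose[OF A]) (rule smooth_near_FD_vec[OF coord_change_smooth[OF A c c0(1)]])
  then have "smooth_at A (*) p (\<lambda>q. \<Sum>i\<in>UNIV. ?g q $ i * \<alpha> q (coord_vec A c0 (axis i 1) q))"
    using c0(2) smooth_at_vec_iff[OF A, of p ?g] by (intro smooth_at_sum[OF A] smooth_at_mult[OF A]) auto
  moreover have "\<forall>\<^sub>F q in nhds p. (\<Sum>i\<in>UNIV. ?g q $ i * \<alpha> q (coord_vec A c0 (axis i 1) q)) = \<alpha> q (coord_vec A c \<xi> q)"
    using one_form_at_linear[OF \<alpha>] charts_at_eventually[OF A c] charts_at_eventually[OF A c0(1)]
  proof eventually_elim
    case (elim q)
    then show ?case
      using linear_form_expand[OF A elim(1,3) coord_vec_in[OF A elim(2)], of \<xi>]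
        tangent_eq[OF A coord_vec_in[OF A elim(2)] elim(2,3)]
      by (simp add: coord_vec_self[OF A])
  qed
  ultimately show ?thesis
    by (rule smooth_at_cong[OF A])
qed

text \<open>The neighbourhood on which a coefficient is smooth may depend on the vector \<xi>, of
  which there are infinitely many. The finitely many basis vectors share a neighbourhood, and
  linearity extends the smoothness from them to every \<xi>.\<close>

lemma one_form_at_eventually:
  assumes A: "manifold A" and \<alpha>: "one_form_at A p \<alpha>"
  shows "\<forall>\<^sub>F q in nhds p. one_form_at A q \<alpha>"
proof -
  let ?c = "some_chart A p"
  note c = some_chart_in[OF A, of p]
  have 1: "\<forall>\<^sub>F q in nhds p. \<forall>\<^sub>F r in nhds q. linear_form A r (\<alpha> r)"
    using one_form_at_linear[OF \<alpha>] by (simp add: eventually_eventually)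
  have 2: "\<forall>\<^sub>F q in nhds p. \<forall>i\<in>UNIV. smooth_at A (*) q (\<lambda>q. \<alpha> q (coord_vec A ?c (axis i 1) q))"
    using smooth_at_eventually[OF A one_form_at_chart[OF A \<alpha> c]]
    by (intro eventually_ball_finite) auto
  from 1 2 charts_at_eventually[OF A c] show ?thesis
  proof eventually_elim
    case (elim q)
    have "smooth_at A (*) q (\<lambda>q. \<alpha> q (coord_vec A ?c \<xi> q))" for \<xi>
    proof (rule smooth_at_cong[OF A])
      show "smooth_at A (*) q (\<lambda>q. \<Sum>i\<in>UNIV. \<xi> $ i * \<alpha> q (coord_vec A ?c (axis i 1) q))"
        using elim(2) by (intro smooth_at_sum[OF A] smooth_at_mult[OF A] smooth_at_const[OF A] vector_space_mult) auto
      show "\<forall>\<^sub>F r in nhds q. (\<Sum>i\<in>UNIV. \<xi> $ i * \<alpha> r (coord_vec A ?c (axis i 1) r)) = \<alpha> r (coord_vec A ?c \<xi> r)"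
        using elim(1) charts_at_eventually[OF A elim(3)]
      proof eventually_elim
        case (elim r)
        then show ?case
          using linear_form_expand[OF A elim(1,2) coord_vec_in[OF A elim(2)], of \<xi>]
          by (simp add: coord_vec_self[OF A])
      qed
    qed
    then show ?case
      using elim(1,3) unfolding one_form_at_def linear_form_def by blast
  qed
qed

lemma one_form_apply_smooth:
  assumes A: "manifold A" and B: "manifold B" and f: "smooth_map_at A B p f"
    and \<alpha>: "one_form_at B (f p) \<alpha>" and v: "vf_along A B p f v"
  shows "smooth_at A (*) p (\<lambda>x. \<alpha> (f x) (v x))"
proof (rule smooth_at_cong[OF A])
  let ?c = "some_chart B (f p)"
  note c = some_chart_in[OF B, of "f p"]
  show "smooth_at A (*) p (\<lambda>x. \<Sum>i\<in>UNIV. v x ?c $ i * \<alpha> (f x) (coord_vec B ?c (axis i 1) (f x)))"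
    using vf_along_chart[OF A B f v c] smooth_at_compose[OF A B f one_form_at_chart[OF B \<alpha> c]]
      smooth_at_vec_iff[OF A, of p "\<lambda>x. v x ?c"]
    by (intro smooth_at_sum[OF A] smooth_at_mult[OF A]) auto
  show "\<forall>\<^sub>F x in nhds p. (\<Sum>i\<in>UNIV. v x ?c $ i * \<alpha> (f x) (coord_vec B ?c (axis i 1) (f x))) = \<alpha> (f x) (v x)"
    using eventually_compose_filterlim[OF one_form_at_linear[OF \<alpha>] smooth_map_at_filterlim[OF A B f]]
      smooth_map_at_charts_eventually[OF A B f c] vf_along_tangent[OF v]
    by eventually_elim (rule linear_form_expand[OF B, symmetric])
qed

text \<open>The functions that \<open>ext_deriv\<close> differentiates, but in an arbitrary chart
  instead of the picked one.\<close>

abbreviation form_coords ::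
  "('a, 'k::{real_normed_field,euclidean_space}, 'm::finite) chart set \<Rightarrow> ('a, 'k, 'm) form \<Rightarrow>
   ('a, 'k, 'm) chart \<Rightarrow> 'k ^ 'm \<Rightarrow> 'k ^ 'm \<Rightarrow> 'k" where
  "form_coords A \<alpha> c \<xi> y \<equiv> \<alpha> (chart_inv c y) (coord_vec A c \<xi> (chart_inv c y))"

lemma form_coords_linear:
  assumes A: "manifold A" and \<alpha>: "one_form_at A p \<alpha>" and c: "c \<in> charts_at A p"
  shows "\<forall>\<^sub>F y in nhds (snd c p). \<forall>\<xi>. form_coords A \<alpha> c \<xi> y =
    (\<Sum>i\<in>UNIV. \<xi> $ i * form_coords A \<alpha> c (axis i 1) y)"
proof -
  have "\<forall>\<^sub>F q in nhds p. linear_form A q (\<alpha> q) \<and> c \<in> charts_at A q"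
    using one_form_at_linear[OF \<alpha>] charts_at_eventually[OF A c] by eventually_elim simp
  from eventually_compose_filterlim[OF this filterlim_chart_inv[OF A c]] show ?thesis
  proof eventually_elim
    case (elim y)
    have l: "linear_form A (chart_inv c y) (\<alpha> (chart_inv c y))" "c \<in> charts_at A (chart_inv c y)"
      using elim by auto
    show ?case
    proof
      fix \<xi>
      show "form_coords A \<alpha> c \<xi> y =
          (\<Sum>i\<in>UNIV. \<xi> $ i * form_coords A \<alpha> c (axis i 1) y)"
        using linear_form_expand[OF A l coord_vec_in[OF A l(2), of \<xi>]] by (simp only: coord_vec_self[OF A l(2)])
    qed
  qed
qed

lemma form_coords_smooth:
  assumes A: "manifold A" and \<alpha>: "one_form_at A p \<alpha>" and c: "c \<in> charts_at A p"
  shows "smooth_near (*s) (*) (snd c p) (form_coords A \<alpha> c \<xi>)"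
  using one_form_at_chart[OF A \<alpha> c] by (simp add: smooth_at_iff[OF A c] comp_def)

text \<open>\<open>ext_deriv\<close> uses the chart picked at the point, which need not vary
  continuously. Here \<open>flat_naturality\<close>, applied to the change from that chart to c,
  allows one chart for a whole neighbourhood.\<close>

lemma ext_deriv_chart:
  assumes A: "manifold A" and \<alpha>: "one_form_at A p \<alpha>" and c: "c \<in> charts_at A p"
    and u: "u \<in> tangent_space A p" and v: "v \<in> tangent_space A p"
  shows "ext_deriv A \<alpha> p u v =
     FD (\<lambda>y. form_coords A \<alpha> c (v c) y) (snd c p) (u c)
   - FD (\<lambda>y. form_coords A \<alpha> c (u c) y) (snd c p) (v c)"
proof -
  let ?c = "some_chart A p"
  note c0 = some_chart_in[OF A, of p]
  define \<phi> where "\<phi> = coord_change ?c c"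
  define a where "a = (\<lambda>y \<xi>. form_coords A \<alpha> c \<xi> y)"
  obtain S where S: "open S" "snd ?c p \<in> S" "smooth_on (*s) (*s) S \<phi>"
    using coord_change_smooth[OF A c0 c] unfolding smooth_near_def \<phi>_def by blast
  have \<phi>p: "\<phi> (snd ?c p) = snd c p"
    by (simp add: \<phi>_def chart_inv_snd[OF A c0])
  have \<phi>w: "FD \<phi> (snd ?c p) (w ?c) = w c" if "w \<in> tangent_space A p" for w
    unfolding \<phi>_def using tangent_eq[OF A that c0 c] by simp
  \<comment> \<open>Pulled back along the coordinate change, the coefficients in c become the
    coefficients in the picked chart, because a coordinate vector may be re-expressed in either
    chart.\<close>
  have F: "FD (\<lambda>y. a (\<phi> y) (FD \<phi> y \<xi>)) (snd ?c p) =
      FD (\<lambda>y. form_coords A \<alpha> ?c \<xi> y) (snd ?c p)" for \<xi>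
  proof (rule FD_cong)
    have "\<forall>\<^sub>F y in nhds (snd ?c p). c \<in> charts_at A (chart_inv ?c y)"
      by (rule eventually_compose_filterlim[OF charts_at_eventually[OF A c] filterlim_chart_inv[OF A c0]])
    then show "\<forall>\<^sub>F y in nhds (snd ?c p). a (\<phi> y) (FD \<phi> y \<xi>) = form_coords A \<alpha> ?c \<xi> y"
      using chart_image_eventually[OF A c0]
    proof eventually_elim
      case (elim y)
      note c0y = chart_inv_in[OF A c0 elim(2)]
      have "chart_inv c (\<phi> y) = chart_inv ?c y"
        using chart_inv_snd[OF A elim(1)] by (simp add: \<phi>_def)
      then show ?case
        using coord_vec_change[OF A c0y elim(1), of \<xi>] snd_chart_inv[OF A c0 elim(2)]
        by (simp add: a_def \<phi>_def)
    qed
  qed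
  have "FD (\<lambda>y. a (\<phi> y) (FD \<phi> y (v ?c))) (snd ?c p) (u ?c) - FD (\<lambda>y. a (\<phi> y) (FD \<phi> y (u ?c))) (snd ?c p) (v ?c)
    = FD (\<lambda>y. a y (FD \<phi> (snd ?c p) (v ?c))) (\<phi> (snd ?c p)) (FD \<phi> (snd ?c p) (u ?c))
    - FD (\<lambda>y. a y (FD \<phi> (snd ?c p) (u ?c))) (\<phi> (snd ?c p)) (FD \<phi> (snd ?c p) (v ?c))"
  proof (rule flat_naturality(2)[OF S(1,2) smooth_on_Cr[OF S(3)]])
    show "\<forall>\<^sub>F y in nhds (\<phi> (snd ?c p)). \<forall>\<xi>. a y \<xi> = (\<Sum>i\<in>UNIV. \<xi> $ i * a y (axis i 1))"
      unfolding a_def \<phi>p by (rule form_coords_linear[OF A \<alpha> c])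
    show "(\<lambda>y. a y (axis i 1)) differentiable at (\<phi> (snd ?c p))" for i
      unfolding a_def \<phi>p
      by (rule differentiableI[OF smooth_near_has_derivative[OF form_coords_smooth[OF A \<alpha> c]]])
  qed
  then show ?thesis
    unfolding F \<phi>p \<phi>w[OF u] \<phi>w[OF v] by (simp add: ext_deriv_def Let_def a_def)
qed

text \<open>The bracket is the classical coefficient of d\<alpha>: the i-th partial derivative of
  the j-th coefficient minus the same with i and j exchanged. Bilinearity can be read off from this
  form.\<close>

lemma ext_deriv_coords:
  assumes A: "manifold A" and \<alpha>: "one_form_at A p \<alpha>" and c: "c \<in> charts_at A p"
    and u: "u \<in> tangent_space A p" and v: "v \<in> tangent_space A p"
  shows "ext_deriv A \<alpha> p u v = (\<Sum>i\<in>UNIV. \<Sum>j\<in>UNIV. u c $ i * v c $ j *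
    (FD (\<lambda>y. form_coords A \<alpha> c (axis j 1) y) (snd c p) (axis i 1) -
     FD (\<lambda>y. form_coords A \<alpha> c (axis i 1) y) (snd c p) (axis j 1)))"
proof -
  define a where "a = (\<lambda>i y. form_coords A \<alpha> c (axis i 1) y)"
  define P where "P = (\<lambda>i j. FD (a i) (snd c p) (axis j 1))"
  have a: "(a i has_derivative FD (a i) (snd c p)) (at (snd c p))" for i
    unfolding a_def by (rule smooth_near_has_derivative[OF form_coords_smooth[OF A \<alpha> c]])
  have lin: "FD (a i) (snd c p) \<xi> = (\<Sum>j\<in>UNIV. \<xi> $ j * P i j)" for i \<xi>
  proof -
    interpret L: Vector_Spaces.linear "(*s)" "(*)" "FD (a i) (snd c p)"
      unfolding a_def by (rule smooth_near_linear[OF form_coords_smooth[OF A \<alpha> c]])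
    have "FD (a i) (snd c p) (\<Sum>j\<in>UNIV. \<xi> $ j *s axis j 1) = (\<Sum>j\<in>UNIV. \<xi> $ j * P i j)"
      by (simp only: L.sum L.scale P_def)
    then show ?thesis
      by (simp flip: vec_eq_sum_basis)
  qed
  have F: "FD (form_coords A \<alpha> c \<xi>) (snd c p) \<eta> =
      (\<Sum>i\<in>UNIV. \<xi> $ i * (\<Sum>j\<in>UNIV. \<eta> $ j * P i j))" for \<xi> \<eta>
  proof -
    have "FD (form_coords A \<alpha> c \<xi>) (snd c p)
        = FD (\<lambda>y. \<Sum>i\<in>UNIV. \<xi> $ i * a i y) (snd c p)"
      unfolding a_def by (rule FD_cong, rule eventually_mono[OF form_coords_linear[OF A \<alpha> c]]) blast
    also have "\<dots> = (\<lambda>\<eta>. \<Sum>i\<in>UNIV. \<xi> $ i * FD (a i) (snd c p) \<eta>)"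
      by (intro FD_eq has_derivative_sum has_derivative_mult_right a)
    finally show ?thesis
      by (simp add: lin)
  qed
  have "ext_deriv A \<alpha> p u v = (\<Sum>i\<in>UNIV. v c $ i * (\<Sum>j\<in>UNIV. u c $ j * P i j)) -
      (\<Sum>i\<in>UNIV. u c $ i * (\<Sum>j\<in>UNIV. v c $ j * P i j))"
    unfolding ext_deriv_chart[OF A \<alpha> c u v] F ..
  also have "(\<Sum>i\<in>UNIV. v c $ i * (\<Sum>j\<in>UNIV. u c $ j * P i j)) = (\<Sum>i\<in>UNIV. \<Sum>j\<in>UNIV. u c $ i * v c $ j * P j i)"
    unfolding sum_distrib_left by (subst sum.swap) (simp add: algebra_simps)
  also have "(\<Sum>i\<in>UNIV. u c $ i * (\<Sum>j\<in>UNIV. v c $ j * P i j)) = (\<Sum>i\<in>UNIV. \<Sum>j\<in>UNIV. u c $ i * v c $ j * P i j)"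
    unfolding sum_distrib_left by (simp add: algebra_simps)
  finally show ?thesis
    by (simp add: sum_subtractf[symmetric] right_diff_distrib P_def a_def)
qed

lemma ext_deriv_linear_right:
  assumes A: "manifold A" and \<alpha>: "one_form_at A p \<alpha>" and u: "u \<in> tangent_space A p"
  shows "linear_form A p (ext_deriv A \<alpha> p u)"
proof -
  let ?c = "some_chart A p"
  define P where "P = (\<lambda>i j.
    FD (\<lambda>y. form_coords A \<alpha> ?c (axis j 1) y) (snd ?c p) (axis i 1) -
    FD (\<lambda>y. form_coords A \<alpha> ?c (axis i 1) y) (snd ?c p) (axis j 1))"
  have P: "ext_deriv A \<alpha> p u v = (\<Sum>i\<in>UNIV. \<Sum>j\<in>UNIV. u ?c $ i * v ?c $ j * P i j)"
    if "v \<in> tangent_space A p" for v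
    unfolding P_def by (rule ext_deriv_coords[OF A \<alpha> some_chart_in[OF A] u that])
  show ?thesis
    unfolding linear_form_def
  proof (intro ballI allI conjI)
    fix v w k assume vw: "v \<in> tangent_space A p" "w \<in> tangent_space A p"
    show "ext_deriv A \<alpha> p u (tadd v w) = ext_deriv A \<alpha> p u v + ext_deriv A \<alpha> p u w"
      unfolding P[OF tangent_add[OF A vw]] P[OF vw(1)] P[OF vw(2)]
      by (simp add: tadd_def algebra_simps sum.distrib)
    show "ext_deriv A \<alpha> p u (tscale k v) = k * ext_deriv A \<alpha> p u v"
      unfolding P[OF tangent_scale[OF A vw(1)]] P[OF vw(1)]
      by (simp add: tscale_def algebra_simps sum_distrib_left)
  qed
qed

lemma ext_deriv_antisym: "ext_deriv A \<alpha> p u v = - ext_deriv A \<alpha> p v u"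
  by (simp add: ext_deriv_def Let_def)

lemma ext_deriv_linear_left:
  assumes A: "manifold A" and \<alpha>: "one_form_at A p \<alpha>" and v: "v \<in> tangent_space A p"
  shows "linear_form A p (\<lambda>u. ext_deriv A \<alpha> p u v)"
  using ext_deriv_linear_right[OF A \<alpha> v] unfolding linear_form_def
  by (simp add: ext_deriv_antisym[of A \<alpha> p _ v])

lemma ext_deriv_smooth:
  assumes A: "manifold A" and \<alpha>: "one_form_at A p \<alpha>" and c: "c \<in> charts_at A p"
  shows "smooth_at A (*) p (\<lambda>q. ext_deriv A \<alpha> q (coord_vec A c \<xi> q) (coord_vec A c \<eta> q))"
proof (rule smooth_at_cong[OF A])
  define a where "a = (\<lambda>\<xi> y. form_coords A \<alpha> c \<xi> y)"
  have s: "smooth_at A (*s) p (snd c)"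
    using smooth_map_at_chart[OF A A smooth_map_at_id[OF A], of c p] c by (simp add: comp_def)
  have "smooth_at A (*) p (\<lambda>q. FD (a \<xi>) (snd c q) \<eta>)" for \<xi> \<eta>
    unfolding a_def
    by (rule smooth_at_flat_compose[OF A s]) (rule smooth_near_FD_mult[OF form_coords_smooth[OF A \<alpha> c]])
  then show "smooth_at A (*) p (\<lambda>q. FD (a \<eta>) (snd c q) \<xi> - FD (a \<xi>) (snd c q) \<eta>)"
    by (intro smooth_at_diff[OF A])
  show "\<forall>\<^sub>F q in nhds p. FD (a \<eta>) (snd c q) \<xi> - FD (a \<xi>) (snd c q) \<eta> =
      ext_deriv A \<alpha> q (coord_vec A c \<xi> q) (coord_vec A c \<eta> q)"
    using one_form_at_eventually[OF A \<alpha>] charts_at_eventually[OF A c]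
  proof eventually_elim
    case (elim q)
    show ?case
      unfolding ext_deriv_chart[OF A elim coord_vec_in[OF A elim(2)] coord_vec_in[OF A elim(2)]]
      by (simp add: coord_vec_self[OF A elim(2)] a_def)
  qed
qed

text \<open>This is d(g \<alpha>) = g d\<alpha> + dg wedge \<alpha>, from the product rule for the
  coefficients in a chart. It governs the change of the contact form.\<close>

lemma ext_deriv_scale:
  assumes A: "manifold A" and \<alpha>: "one_form_at A p \<alpha>" and \<beta>: "one_form_at A p \<beta>" and g: "smooth_at A (*) p g"
    and eq: "\<forall>\<^sub>F q in nhds p. \<forall>u\<in>tangent_space A q. \<beta> q u = g q * \<alpha> q u"
    and u: "u \<in> tangent_space A p" and v: "v \<in> tangent_space A p"
  shows "ext_deriv A \<beta> p u v =
    g p * ext_deriv A \<alpha> p u v + differential A g p u * \<alpha> p v - differential A g p v * \<alpha> p u"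
proof -
  let ?c = "some_chart A p"
  note c = some_chart_in[OF A, of p]
  have ev: "\<forall>\<^sub>F q in nhds p. \<forall>\<xi>. \<beta> q (coord_vec A ?c \<xi> q) = g q * \<alpha> q (coord_vec A ?c \<xi> q)"
    using eq charts_at_eventually[OF A c] by eventually_elim (use coord_vec_in[OF A] in blast)
  have D: "FD (\<lambda>y. form_coords A \<beta> ?c (w ?c) y) (snd ?c p) (w' ?c)
      = g p * FD (\<lambda>y. form_coords A \<alpha> ?c (w ?c) y) (snd ?c p) (w' ?c)
        + differential A g p w' * \<alpha> p w" if w: "w \<in> tangent_space A p" for w w'
  proof -
    have "FD (\<lambda>y. form_coords A \<beta> ?c (w ?c) y) (snd ?c p)
        = FD (\<lambda>y. (g \<circ> chart_inv ?c) y * form_coords A \<alpha> ?c (w ?c) y) (snd ?c p)"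
      by (rule FD_cong, rule eventually_mono[OF eventually_compose_filterlim[OF ev filterlim_chart_inv[OF A c]]]) simp
    then show ?thesis
      using FD_eq[OF has_derivative_mult[OF smooth_at_has_derivative[OF A g c]
          smooth_near_has_derivative[OF form_coords_smooth[OF A \<alpha> c]]], of "w ?c"]
      by (simp add: chart_inv_snd[OF A c] coord_vec_eq[OF A w c] differential_def Let_def)
  qed
  show ?thesis
    unfolding ext_deriv_chart[OF A \<alpha> c u v] ext_deriv_chart[OF A \<beta> c u v] D[OF u] D[OF v]
    by (simp add: algebra_simps)
qed

section \<open>Deformations and Cartan's formula\<close>

text \<open>The scalar multiplication on pairs (t, y) that \<open>deformation\<close> writes
  out.\<close>

abbreviation pscale :: "'k::real_normed_field \<Rightarrow> 'k \<times> ('k ^ 'n) \<Rightarrow> 'k \<times> ('k ^ 'n)" where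
  "pscale \<equiv> \<lambda>k (t, y). (k * t, k *s y)"

lemma smooth_near_fst: "smooth_near pscale (*) z (fst :: 'k::{real_normed_field,euclidean_space} \<times> ('k ^ 'n) \<Rightarrow> 'k)"
  by (rule smooth_near_bounded_linear) (auto simp: vector_space_scalars bounded_linear_fst)

lemma smooth_near_snd: "smooth_near pscale (*s) z (snd :: 'k::{real_normed_field,euclidean_space} \<times> ('k ^ 'n) \<Rightarrow> 'k ^ 'n)"
  by (rule smooth_near_bounded_linear) (auto simp: vector_space_scalars bounded_linear_snd)

lemma smooth_near_Pair:
  "smooth_near (*s) pscale y (\<lambda>y :: 'k::{real_normed_field,euclidean_space} ^ 'n. (t, y))"
proof -
  have "smooth_near (*s) pscale y (\<lambda>y :: 'k ^ 'n. (0, y))"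
    by (rule smooth_near_bounded_linear)
      (auto simp: vector_space_scalars intro!: bounded_linear_Pair bounded_linear_zero bounded_linear_ident)
  then have "smooth_near (*s) pscale y (\<lambda>y :: 'k ^ 'n. (t, 0) + (0, y))"
    by (intro smooth_near_add smooth_near_const vector_space_scalars)
  then show ?thesis
    by simp
qed

lemma has_derivative_slice_right:
  assumes "(h has_derivative h') (at (t, y))"
  shows "((\<lambda>y. h (t, y)) has_derivative (\<lambda>\<eta>. h' (0, \<eta>))) (at y)"
  by (rule has_derivative_compose[of "\<lambda>y. (t, y)" "\<lambda>\<eta>. (0, \<eta>)" y UNIV h])
    (use assms in \<open>auto intro!: derivative_eq_intros\<close>)

lemma has_derivative_slice_left:
  assumes "(h has_derivative h') (at (t, y))"
  shows "((\<lambda>t. h (t, y)) has_derivative (\<lambda>\<tau>. h' (\<tau>, 0))) (at t)"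
  by (rule has_derivative_compose[of "\<lambda>t. (t, y)" "\<lambda>\<tau>. (\<tau>, 0)" t UNIV h])
    (use assms in \<open>auto intro!: derivative_eq_intros\<close>)

text \<open>\<open>lie_deriv\<close> picks one deformation for the germ at p but is evaluated at all
  nearby points; the picked F must therefore be a deformation of the germ at those points as
  well.\<close>

lemma deformation_eventually:
  assumes A: "manifold A" and B: "manifold B" and F: "deformation A B p f v F"
  shows "\<forall>\<^sub>F x in nhds p. deformation A B x f v F"
proof -
  obtain c c' S where c: "c \<in> charts_at A p" and c': "c' \<in> charts_at B (f p)" and S: "open S" "(0, snd c p) \<in> S"
    "\<forall>(t, y)\<in>S. y \<in> snd c ` fst c \<and> F t (chart_inv c y) \<in> fst c'"
    "smooth_on pscale (*s) S (\<lambda>(t, y). snd c' (F t (chart_inv c y)))"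
    using F unfolding deformation_def by blast
  have F0: "\<forall>\<^sub>F x in nhds p. F 0 x = f x"
    and V: "\<forall>\<^sub>F x in nhds p. \<forall>c'\<in>charts_at B (f x). v x c' = FD (\<lambda>t. snd c' (F t x)) 0 1"
    using F by (auto simp: deformation_def)
  have "open ((\<lambda>y. (0, y)) -` S)"
    by (intro open_vimage S continuous_intros)
  then have "\<forall>\<^sub>F y in nhds (snd c p). (0, y) \<in> S"
    using S(2) by (auto simp: eventually_nhds)
  then have "\<forall>\<^sub>F x in nhds p. (0, snd c x) \<in> S"
    by (rule eventually_compose_filterlim[OF _ filterlim_chart[OF A c]])
  moreover have "\<forall>\<^sub>F x in nhds p. \<forall>\<^sub>F y in nhds x. F 0 y = f y"
    using F0 by (simp add: eventually_eventually)
  moreover have "\<forall>\<^sub>F x in nhds p. \<forall>\<^sub>F y in nhds x. \<forall>c'\<in>charts_at B (f y). v y c' = FD (\<lambda>t. snd c' (F t y)) 0 1"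
    using V by (simp add: eventually_eventually)
  ultimately show ?thesis
    using charts_at_eventually[OF A c] F0
  proof eventually_elim
    case (elim x)
    have "F 0 (chart_inv c (snd c x)) \<in> fst c'"
      using bspec[OF S(3) elim(1)] by simp
    then have "c' \<in> charts_at B (f x)"
      using c' elim(5) chart_inv_snd[OF A elim(4)] by (simp add: charts_at_def)
    then show ?case
      unfolding deformation_def using elim(1-4) S by blast
  qed
qed

text \<open>\<open>flat_naturality\<close> is applied to the coordinate expression \<open>G\<close>
  of the deformation at t = 0, in the directions (0, \<xi>) and (1, 0). Of the two derivatives on
  its left side, one is the t-derivative of the pulled back form and the other is the differential
  of \<alpha>(v); its right side is d\<alpha> at v and the image of \<xi>.\<close>

lemma cartan_deformation:
  fixes A :: "('x::{t2_space,second_countable_topology}, 'k::{real_normed_field,euclidean_space}, 'n::finite) chart set"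
  assumes A: "manifold A" and B: "manifold B" and f: "smooth_map_at A B p f" and v: "vf_along A B p f v"
    and \<alpha>: "one_form_at B (f p) \<alpha>" and F: "deformation A B p f v F" and \<xi>: "\<xi> \<in> tangent_space A p"
  shows "FD (\<lambda>t. \<alpha> (F t p) (tangent_map A B (F t) p \<xi>)) 0 1 =
    ext_deriv B \<alpha> (f p) (v p) (tangent_map A B f p \<xi>) + differential A (\<lambda>x. \<alpha> (f x) (v x)) p \<xi>"
proof -
  obtain c c' S where c: "c \<in> charts_at A p" and c': "c' \<in> charts_at B (f p)" and S: "open S" "(0, snd c p) \<in> S"
    "\<forall>(t, y)\<in>S. y \<in> snd c ` fst c \<and> F t (chart_inv c y) \<in> fst c'"
    "smooth_on pscale (*s) S (\<lambda>(t, y). snd c' (F t (chart_inv c y)))"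
    using F unfolding deformation_def by blast
  have F0: "\<forall>\<^sub>F x in nhds p. F 0 x = f x"
    and V: "\<forall>\<^sub>F x in nhds p. \<forall>c'\<in>charts_at B (f x). v x c' = FD (\<lambda>t. snd c' (F t x)) 0 1"
    using F by (auto simp: deformation_def)
  have F0p: "F 0 p = f p"
    using eventually_nhds_x_imp_x[OF F0] .
  define G where "G = (\<lambda>(t, y). snd c' (F t (chart_inv c y)))"
  define a where "a = (\<lambda>y \<xi>. form_coords B \<alpha> c' \<xi> y)"
  define z where "z = (0 :: 'k, snd c p)"
  have G: "smooth_near pscale (*s) (t, y) G" if "(t, y) \<in> S" for t y
    using S that unfolding smooth_near_def G_def by blast
  have Gd: "(G has_derivative FD G (t, y)) (at (t, y))" if "(t, y) \<in> S" for t y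
    by (rule smooth_near_has_derivative[OF G[OF that]])
  have Gz: "G z = snd c' (f p)"
    by (simp add: G_def z_def chart_inv_snd[OF A c] F0p)
  have zS: "z \<in> S"
    using S(2) by (simp add: z_def)
  have lin: "\<forall>\<^sub>F y in nhds (G z). \<forall>\<xi>. a y \<xi> = (\<Sum>i\<in>UNIV. \<xi> $ i * a y (axis i 1))"
    unfolding a_def Gz by (rule form_coords_linear[OF B \<alpha> c'])
  have diff: "(\<lambda>y. a y (axis i 1)) differentiable at (G z)" for i
    unfolding a_def Gz
    by (rule differentiableI[OF smooth_near_has_derivative[OF form_coords_smooth[OF B \<alpha> c']]])
  note nat = flat_naturality[OF S(1) zS smooth_on_Cr[OF S(4), folded G_def] lin diff]

  have evt: "\<forall>\<^sub>F t in nhds 0. (t, snd c p) \<in> S"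
  proof -
    have "open ((\<lambda>t. (t, snd c p)) -` S)"
      by (intro open_vimage S continuous_intros)
    then show ?thesis
      using S(2) by (auto simp: eventually_nhds)
  qed
  have evy: "\<forall>\<^sub>F y in nhds (snd c p). (t, y) \<in> S" if "(t, snd c p) \<in> S" for t
  proof -
    have "open ((\<lambda>y. (t, y)) -` S)"
      by (intro open_vimage S continuous_intros)
    then show ?thesis
      using that by (auto simp: eventually_nhds)
  qed
  \<comment> \<open>For each single t near 0 the map \<open>F t\<close> is smooth near p, and its
    tangent map is the derivative of the slice of \<open>G\<close> at that t.\<close>
  have Ft: "\<alpha> (F t p) (tangent_map A B (F t) p \<xi>) = a (G (t, snd c p)) (FD G (t, snd c p) (0, \<xi> c))"
    and Ftc: "tangent_map A B (F t) p \<xi> c' = FD G (t, snd c p) (0, \<xi> c)"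
    if tS: "(t, snd c p) \<in> S" for t
  proof -
    have cF: "c' \<in> charts_at B (F t p)"
      using S(3) tS c' chart_inv_snd[OF A c] by (auto simp: charts_at_def)
    have "\<forall>\<^sub>F x in nhds p. (t, snd c x) \<in> S"
      by (rule eventually_compose_filterlim[OF evy[OF tS] filterlim_chart[OF A c]])
    then have fst: "\<forall>\<^sub>F x in nhds p. F t x \<in> fst c'"
      using charts_at_eventually[OF A c]
    proof eventually_elim
      case (elim x)
      then show ?case
        using S(3) chart_inv_snd[OF A elim(2)] by fastforce
    qed
    have comp: "snd c' \<circ> F t \<circ> chart_inv c = (\<lambda>y. G (t, y))"
      by (auto simp: G_def)
    have sm: "smooth_near (*s) (*s) (snd c p) (\<lambda>y. G (t, y))"
      by (rule smooth_near_compose[OF smooth_near_Pair G[OF tS]])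
    have smF: "smooth_map_at A B p (F t)"
      by (rule smooth_map_atI[OF cF fst]) (unfold smooth_at_iff[OF A c] comp, rule sm)
    have "FD (\<lambda>y. G (t, y)) (snd c p) = (\<lambda>\<eta>. FD G (t, snd c p) (0, \<eta>))"
      by (rule FD_eq[OF has_derivative_slice_right[OF Gd[OF tS]]])
    then show tc: "tangent_map A B (F t) p \<xi> c' = FD G (t, snd c p) (0, \<xi> c)"
      using tangent_map_chart[OF A B smF c cF \<xi>] comp by simp
    have inv: "chart_inv c' (G (t, snd c p)) = F t p"
      by (simp add: G_def chart_inv_snd[OF A c] chart_inv_snd[OF B cF])
    show "\<alpha> (F t p) (tangent_map A B (F t) p \<xi>) = a (G (t, snd c p)) (FD G (t, snd c p) (0, \<xi> c))"
      using coord_vec_eq[OF B tangent_map_in[OF A B smF \<xi>] cF] by (simp add: a_def inv tc)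
  qed
  \<comment> \<open>The formula \<open>Ft\<close> holds for all t near 0, so its t-derivative is the
    derivative of the two-variable expression in the direction (1, 0).\<close>
  have t_side: "FD (\<lambda>t. \<alpha> (F t p) (tangent_map A B (F t) p \<xi>)) 0 1 =
      FD (\<lambda>x. a (G x) (FD G x (0, \<xi> c))) z (1, 0)"
  proof -
    let ?g = "\<lambda>x. a (G x) (FD G x (0, \<xi> c))"
    have "(?g has_derivative FD ?g z) (at (0, snd c p))"
      using nat(1)[of "(0, \<xi> c)"] by (simp add: frechet_derivative_works z_def)
    then have "FD (\<lambda>t. ?g (t, snd c p)) 0 = (\<lambda>\<tau>. FD ?g z (\<tau>, 0))"
      by (rule FD_eq[OF has_derivative_slice_left])
    moreover have "FD (\<lambda>t. \<alpha> (F t p) (tangent_map A B (F t) p \<xi>)) 0 = FD (\<lambda>t. ?g (t, snd c p)) 0"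
      by (rule FD_cong, rule eventually_mono[OF evt]) (rule Ft)
    ultimately show ?thesis
      by simp
  qed

  \<comment> \<open>At t = 0 the t-derivative of \<open>G\<close> is v in coordinates, and this
    holds at every y near the base point; only therefore can \<alpha>(v) be differentiated in y
    below.\<close>
  have vc: "\<forall>\<^sub>F y in nhds (snd c p). c' \<in> charts_at B (f (chart_inv c y)) \<and>
      v (chart_inv c y) \<in> tangent_space B (f (chart_inv c y)) \<and>
      F 0 (chart_inv c y) = f (chart_inv c y) \<and> v (chart_inv c y) c' = FD G (0, y) (1, 0)"
  proof -
    have "\<forall>\<^sub>F x in nhds p. c' \<in> charts_at B (f x) \<and> v x \<in> tangent_space B (f x) \<and> F 0 x = f x \<and>
        v x c' = FD (\<lambda>t. snd c' (F t x)) 0 1"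
      using smooth_map_at_charts_eventually[OF A B f c'] vf_along_tangent[OF v] F0 V by eventually_elim auto
    from eventually_compose_filterlim[OF this filterlim_chart_inv[OF A c]] evy[OF S(2)] show ?thesis
    proof eventually_elim
      case (elim y)
      have "FD (\<lambda>t. G (t, y)) 0 = (\<lambda>\<tau>. FD G (0, y) (\<tau>, 0))"
        by (rule FD_eq[OF has_derivative_slice_left[OF Gd[OF elim(2)]]])
      then show ?case
        using elim(1) by (simp add: G_def)
    qed
  qed
  have x_side: "FD (\<lambda>x. a (G x) (FD G x (1, 0))) z (0, \<xi> c) = differential A (\<lambda>x. \<alpha> (f x) (v x)) p \<xi>"
  proof -
    let ?h = "\<lambda>x. a (G x) (FD G x (1, 0))"
    have "(?h has_derivative FD ?h z) (at (0, snd c p))"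
      using nat(1)[of "(1, 0)"] by (simp add: frechet_derivative_works z_def)
    then have "FD (\<lambda>y. ?h (0, y)) (snd c p) = (\<lambda>\<eta>. FD ?h z (0, \<eta>))"
      by (rule FD_eq[OF has_derivative_slice_right])
    moreover have "FD (\<lambda>y. ?h (0, y)) (snd c p) = FD ((\<lambda>x. \<alpha> (f x) (v x)) \<circ> chart_inv c) (snd c p)"
    proof (rule FD_cong, rule eventually_mono[OF vc])
      fix y assume y: "c' \<in> charts_at B (f (chart_inv c y)) \<and>
        v (chart_inv c y) \<in> tangent_space B (f (chart_inv c y)) \<and>
        F 0 (chart_inv c y) = f (chart_inv c y) \<and> v (chart_inv c y) c' = FD G (0, y) (1, 0)"
      then have "G (0, y) = snd c' (f (chart_inv c y))"
        by (simp add: G_def)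
      then show "?h (0, y) = ((\<lambda>x. \<alpha> (f x) (v x)) \<circ> chart_inv c) y"
        using y coord_vec_eq[OF B, of "v (chart_inv c y)" "f (chart_inv c y)" c'] chart_inv_snd[OF B, of c' "f (chart_inv c y)"]
        by (simp add: a_def)
    qed
    ultimately show ?thesis
      using differential_chart[OF A one_form_apply_smooth[OF A B f \<alpha> v] c \<xi>] by simp
  qed

  have tm: "tangent_map A B f p \<xi> c' = FD G z (0, \<xi> c)"
  proof -
    have "FD (snd c' \<circ> f \<circ> chart_inv c) (snd c p) = FD (\<lambda>y. G (0, y)) (snd c p)"
      by (rule FD_cong, rule eventually_mono[OF vc]) (simp add: G_def)
    also have "\<dots> = (\<lambda>\<eta>. FD G z (0, \<eta>))"
      unfolding z_def by (rule FD_eq[OF has_derivative_slice_right[OF Gd[OF S(2)]]])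
    finally show ?thesis
      using tangent_map_chart[OF A B f c c' \<xi>] by simp
  qed
  have vp: "v p c' = FD G z (1, 0)"
    using eventually_nhds_x_imp_x[OF vc] chart_inv_snd[OF A c] by (simp add: z_def)
  have vT: "v p \<in> tangent_space B (f p)"
    using eventually_nhds_x_imp_x[OF vf_along_tangent[OF v]] .
  have "ext_deriv B \<alpha> (f p) (v p) (tangent_map A B f p \<xi>) =
      FD (\<lambda>y. a y (FD G z (0, \<xi> c))) (G z) (FD G z (1, 0)) - FD (\<lambda>y. a y (FD G z (1, 0))) (G z) (FD G z (0, \<xi> c))"
    unfolding ext_deriv_chart[OF B \<alpha> c' vT tangent_map_in[OF A B f \<xi>]] tm vp Gz a_def ..
  with nat(2)[of "(0, \<xi> c)" "(1, 0)"] have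
    "FD (\<lambda>x. a (G x) (FD G x (0, \<xi> c))) z (1, 0) - FD (\<lambda>x. a (G x) (FD G x (1, 0))) z (0, \<xi> c)
      = ext_deriv B \<alpha> (f p) (v p) (tangent_map A B f p \<xi>)"
    by (simp only:)
  then show ?thesis
    unfolding t_side x_side[symmetric] by (simp only: diff_eq_eq)
qed

text \<open>The points move along straight lines with velocity v in one chart around
  \<open>f p\<close>. Without existence the \<open>SOME\<close> in \<open>lie_deriv\<close> would
  carry no information.\<close>

lemma deformation_exists:
  fixes A :: "('x::{t2_space,second_countable_topology}, 'k::{real_normed_field,euclidean_space}, 'n::finite) chart set"
  assumes A: "manifold A" and B: "manifold B" and f: "smooth_map_at A B p f" and v: "vf_along A B p f v"
  shows "\<exists>F. deformation A B p f v F"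
proof -
  let ?c = "some_chart A p" and ?c' = "some_chart B (f p)"
  note c = some_chart_in[OF A, of p] and c' = some_chart_in[OF B, of "f p"]
  define F where "F = (\<lambda>t x. chart_inv ?c' (snd ?c' (f x) + t *s v x ?c'))"
  define g where "g = snd ?c' \<circ> f \<circ> chart_inv ?c"
  define w where "w = (\<lambda>x. v x ?c') \<circ> chart_inv ?c"
  define G where "G = (\<lambda>x :: 'k \<times> ('k ^ 'n). g (snd x) + fst x *s w (snd x))"
  have g: "smooth_near (*s) (*s) (snd ?c p) g" and w: "smooth_near (*s) (*s) (snd ?c p) w"
    using smooth_map_at_chart[OF A B f c'] vf_along_chart[OF A B f v c']
    by (simp_all add: smooth_at_iff[OF A c] g_def w_def)
  have G: "smooth_near pscale (*s) (0, snd ?c p) G"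
    unfolding G_def
    by (intro smooth_near_add smooth_near_scaleV smooth_near_fst
        smooth_near_compose[OF smooth_near_snd[where z = "(0, snd ?c p)"], of "(*s)" g]
        smooth_near_compose[OF smooth_near_snd[where z = "(0, snd ?c p)"], of "(*s)" w])
      (simp_all add: g w)
  have "G (0, snd ?c p) = snd ?c' (f p)"
    by (simp add: G_def g_def chart_inv_snd[OF A c])
  then have "\<forall>\<^sub>F x in nhds (0, snd ?c p). G x \<in> snd ?c' ` fst ?c'"
    using eventually_compose_filterlim[OF _ smooth_near_filterlim[OF G]] chart_image_eventually[OF B c'] by simp
  then obtain T where T: "open T" "(0, snd ?c p) \<in> T" "\<And>x. x \<in> T \<Longrightarrow> G x \<in> snd ?c' ` fst ?c'"
    by (auto simp: eventually_nhds)
  obtain U where U: "open U" "(0, snd ?c p) \<in> U" "smooth_on pscale (*s) U G"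
    using G by (auto simp: smooth_near_def)
  \<comment> \<open>On T the line stays inside the chart image, so \<open>chart_inv\<close> really
    inverts the chart there; U provides smoothness, and the last factor keeps y inside the chart of
    the source.\<close>
  define S where "S = T \<inter> U \<inter> (UNIV \<times> snd ?c ` fst ?c)"
  have S: "open S" "(0, snd ?c p) \<in> S"
    unfolding S_def using T U chart_open(2)[OF A c] chart_mem[OF A c] by (auto intro!: open_Int open_Times)
  have SF: "y \<in> snd ?c ` fst ?c" "F t (chart_inv ?c y) = chart_inv ?c' (G (t, y))"
    "F t (chart_inv ?c y) \<in> fst ?c'" "snd ?c' (F t (chart_inv ?c y)) = G (t, y)" if "(t, y) \<in> S" for t y
  proof -
    show y: "y \<in> snd ?c ` fst ?c"
      using that by (auto simp: S_def)
    show F: "F t (chart_inv ?c y) = chart_inv ?c' (G (t, y))"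
      by (simp add: F_def G_def g_def w_def)
    have "G (t, y) \<in> snd ?c' ` fst ?c'"
      using that T by (auto simp: S_def)
    then show "F t (chart_inv ?c y) \<in> fst ?c'" "snd ?c' (F t (chart_inv ?c y)) = G (t, y)"
      unfolding F using chart_mem[OF B chart_inv_in[OF B c']] snd_chart_inv[OF B c'] by auto
  qed
  have smS: "smooth_on pscale (*s) S (\<lambda>(t, y). snd ?c' (F t (chart_inv ?c y)))"
    by (rule smooth_on_cong[OF S(1) smooth_on_subset[OF U(3)]]) (use SF(4) in \<open>auto simp: S_def\<close>)
  have F0: "\<forall>\<^sub>F x in nhds p. F 0 x = f x"
    using smooth_map_at_charts_eventually[OF A B f c']
    by eventually_elim (simp add: F_def chart_inv_snd[OF B])
  have vel: "\<forall>\<^sub>F x in nhds p. \<forall>c''\<in>charts_at B (f x). v x c'' = FD (\<lambda>t. snd c'' (F t x)) 0 1"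
    using smooth_map_at_charts_eventually[OF A B f c'] vf_along_tangent[OF v]
  proof eventually_elim
    case (elim x)
    show ?case
    proof
      fix c'' assume c'': "c'' \<in> charts_at B (f x)"
      have "bounded_linear (\<lambda>t :: 'k. t *s v x ?c')"
        unfolding linear_conv_bounded_linear[symmetric]
        by (rule linearI) (auto simp: vec_eq_iff algebra_simps)
      then have "((\<lambda>t. snd ?c' (f x) + t *s v x ?c') has_derivative (\<lambda>t. t *s v x ?c')) (at 0)"
        by (auto intro!: derivative_eq_intros bounded_linear_imp_has_derivative)
      then have "FD (\<lambda>t. coord_change ?c' c'' (snd ?c' (f x) + t *s v x ?c')) 0 1
          = FD (coord_change ?c' c'') (snd ?c' (f x)) (1 *s v x ?c')"
        using smooth_near_has_derivative[OF coord_change_smooth[OF B elim(1) c'']]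
        by (intro FD_compose) (simp_all add: comp_def)
      then show "v x c'' = FD (\<lambda>t. snd c'' (F t x)) 0 1"
        using tangent_eq[OF B elim(2,1) c''] by (simp add: F_def)
    qed
  qed
  have "deformation A B p f v F"
    unfolding deformation_def
    by (intro conjI F0 vel bexI[OF _ c] bexI[OF _ c'] exI[of _ S] S smS) (use SF in auto)
  then show ?thesis
    by (rule exI[where x = F])
qed

text \<open>The right side does not mention the deformation, which justifies the choice made in
  \<open>lie_deriv\<close>. From here on deformations disappear, and L_v \<alpha> = 0 is a
  first-order equation in v.\<close>

proposition lie_deriv_cartan:
  assumes A: "manifold A" and B: "manifold B" and f: "smooth_map_at A B p f" and v: "vf_along A B p f v"
    and \<alpha>: "one_form_at B (f p) \<alpha>"
  shows "\<forall>\<^sub>F x in nhds p. \<forall>\<xi>\<in>tangent_space A x. lie_deriv A B p f v \<alpha> x \<xi> =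
    ext_deriv B \<alpha> (f x) (v x) (tangent_map A B f x \<xi>) + differential A (\<lambda>x. \<alpha> (f x) (v x)) x \<xi>"
proof -
  define F where "F = (SOME F. deformation A B p f v F)"
  have "deformation A B p f v F"
    unfolding F_def by (rule someI_ex[OF deformation_exists[OF A B f v]])
  from deformation_eventually[OF A B this] smooth_map_at_eventually[OF A B f] vf_along_eventually[OF A B f v]
    eventually_compose_filterlim[OF one_form_at_eventually[OF B \<alpha>] smooth_map_at_filterlim[OF A B f]]
  show ?thesis
  proof eventually_elim
    case (elim x)
    show ?case
      using cartan_deformation[OF A B elim(2-4,1)] by (simp add: lie_deriv_def Let_def F_def)
  qed
qed

section \<open>Reeb and contact Hamilton vector fields\<close>

lemma differential_one_form:
  assumes A: "manifold A" and h: "smooth_at A (*) p h"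
  shows "one_form_at A p (differential A h)"
  unfolding one_form_at_def
proof
  show "\<forall>\<^sub>F q in nhds p. \<forall>u\<in>tangent_space A q. \<forall>v\<in>tangent_space A q. \<forall>k.
      differential A h q (tadd u v) = differential A h q u + differential A h q v \<and>
      differential A h q (tscale k u) = k * differential A h q u"
    using smooth_at_eventually[OF A h]
    by eventually_elim (auto simp: differential_linear[OF A])
  show "\<exists>c\<in>charts_at A p. \<forall>\<xi>. smooth_at A (*) p (\<lambda>q. differential A h q (coord_vec A c \<xi> q))"
    using differential_coord_smooth[OF A h some_chart_in[OF A]] some_chart_in[OF A] by blast
qed

section \<open>Linear algebra of a contact form at a point\<close>

lemma tadd_minus_eq_zero:
  assumes "tadd u (tscale (-1) v) = (\<lambda>_. 0)"
  shows "u = v"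
proof
  fix c
  have "u c + (-1) *s v c = 0"
    using fun_cong[OF assms, of c] by (simp add: tadd_def tscale_def)
  then show "u c = v c"
    by (simp add: vec_eq_iff)
qed

text \<open>Everything about \<alpha> that holds at all points near the base point, collected at one
  point. Algebraic identities can then be proved pointwise and lifted through the single fact
  \<open>contact_points\<close>.\<close>

definition contact_point ::
  "('a::{t2_space,second_countable_topology}, 'k::{real_normed_field,euclidean_space}, 'm::finite) chart set \<Rightarrow>
   ('a, 'k, 'm) form \<Rightarrow> 'a \<Rightarrow> bool" where
  "contact_point A \<alpha> q \<longleftrightarrow> one_form_at A q \<alpha> \<and> linear_form A q (\<alpha> q) \<and>
     (\<exists>u\<in>tangent_space A q. \<alpha> q u \<noteq> 0) \<and>
     (\<forall>u\<in>tangent_space A q. \<alpha> q u = 0 \<longrightarrow>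
       (\<forall>v\<in>tangent_space A q. \<alpha> q v = 0 \<longrightarrow> ext_deriv A \<alpha> q u v = 0) \<longrightarrow> u = (\<lambda>_. 0))"

definition bform ::
  "('a, 'k::{real_normed_field,euclidean_space}, 'm::finite) chart set \<Rightarrow> ('a, 'k, 'm) form \<Rightarrow> 'a \<Rightarrow>
   ('a, 'k, 'm) tangent \<Rightarrow> ('a, 'k, 'm) tangent \<Rightarrow> 'k" where
  "bform A \<alpha> q u v = ext_deriv A \<alpha> q u v + \<alpha> q u * \<alpha> q v"

locale contact_form =
  fixes W :: "('w::{t2_space,second_countable_topology}, 'k::{real_normed_field,euclidean_space}, 'm::finite) chart set"
    and w0 :: 'w and \<alpha> :: "('w, 'k, 'm) form"
  assumes W: "manifold W" and contact: "contact_form_at W w0 \<alpha>"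
begin

abbreviation "T \<equiv> tangent_space W"
abbreviation "\<omega> \<equiv> ext_deriv W \<alpha>"
abbreviation "smooth \<equiv> smooth_at W (*) w0"
abbreviation "vfield \<equiv> vf_along W W w0 id"
abbreviation "b \<equiv> bform W \<alpha>"

lemma form: "one_form_at W w0 \<alpha>"
  using contact by (simp add: contact_form_at_def)

lemma contact_points: "\<forall>\<^sub>F q in nhds w0. contact_point W \<alpha> q"
proof -
  have "\<forall>\<^sub>F q in nhds w0. (\<exists>u\<in>T q. \<alpha> q u \<noteq> 0) \<and>
      (\<forall>u\<in>T q. \<alpha> q u = 0 \<and> (\<forall>v\<in>T q. \<alpha> q v = 0 \<longrightarrow> \<omega> q u v = 0) \<longrightarrow> u = (\<lambda>_. 0))"
    using contact by (simp add: contact_form_at_def)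
  then show ?thesis
    using one_form_at_eventually[OF W form] one_form_at_linear[OF form]
    by eventually_elim (simp add: contact_point_def)
qed

lemma \<alpha>_add: "contact_point W \<alpha> q \<Longrightarrow> u \<in> T q \<Longrightarrow> v \<in> T q \<Longrightarrow> \<alpha> q (tadd u v) = \<alpha> q u + \<alpha> q v"
  and \<alpha>_scale: "contact_point W \<alpha> q \<Longrightarrow> u \<in> T q \<Longrightarrow> \<alpha> q (tscale k u) = k * \<alpha> q u"
  unfolding contact_point_def using linear_form_add[of W q "\<alpha> q"] linear_form_scale[of W q "\<alpha> q"] by blast+

lemma \<omega>_add: "contact_point W \<alpha> q \<Longrightarrow> u \<in> T q \<Longrightarrow> v \<in> T q \<Longrightarrow> w \<in> T q \<Longrightarrow>
    \<omega> q (tadd u v) w = \<omega> q u w + \<omega> q v w"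
  and \<omega>_scale: "contact_point W \<alpha> q \<Longrightarrow> u \<in> T q \<Longrightarrow> w \<in> T q \<Longrightarrow> \<omega> q (tscale k u) w = k * \<omega> q u w"
  unfolding contact_point_def
  using linear_form_add[OF ext_deriv_linear_left[OF W, of q \<alpha> w]]
    linear_form_scale[OF ext_deriv_linear_left[OF W, of q \<alpha> w]] by blast+

lemma \<alpha>_zero: "contact_point W \<alpha> q \<Longrightarrow> \<alpha> q (\<lambda>_. 0) = 0"
  unfolding contact_point_def using linear_form_zero[OF W, of q "\<alpha> q"] by blast

lemma \<omega>_zero: "contact_point W \<alpha> q \<Longrightarrow> w \<in> T q \<Longrightarrow> \<omega> q (\<lambda>_. 0) w = 0"
  unfolding contact_point_def using linear_form_zero[OF W ext_deriv_linear_left[OF W]] by blast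

lemma \<omega>_self: "\<omega> q u u = 0"
  by (simp add: ext_deriv_def Let_def)

text \<open>The difference of u and v lies in the kernel of \<alpha> and is d\<alpha>-orthogonal to
  it, hence is zero. All uniqueness statements below, for the Reeb field, for Z_H and for X_H, go
  through this rule.\<close>

lemma contact_point_eqI:
  assumes q: "contact_point W \<alpha> q" and u: "u \<in> T q" and v: "v \<in> T q" and \<alpha>: "\<alpha> q u = \<alpha> q v"
    and \<omega>: "\<And>w. w \<in> T q \<Longrightarrow> \<alpha> q w = 0 \<Longrightarrow> \<omega> q u w = \<omega> q v w"
  shows "u = v"
proof (rule tadd_minus_eq_zero)
  have v': "tscale (-1) v \<in> T q"
    by (rule tangent_scale[OF W v])
  have "\<alpha> q (tadd u (tscale (-1) v)) = 0"
    using \<alpha>_add[OF q u v'] \<alpha>_scale[OF q v] \<alpha> by simp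
  moreover have "\<omega> q (tadd u (tscale (-1) v)) w = 0" if "w \<in> T q" "\<alpha> q w = 0" for w
    using \<omega>_add[OF q u v' that(1)] \<omega>_scale[OF q v that(1)] \<omega>[OF that] by simp
  ultimately show "tadd u (tscale (-1) v) = (\<lambda>_. 0)"
    using q tangent_add[OF W u v'] unfolding contact_point_def by blast
qed

lemma b_linear: "contact_point W \<alpha> q \<Longrightarrow> u \<in> T q \<Longrightarrow> linear_form W q (b q u)"
  using ext_deriv_linear_right[OF W, of q \<alpha> u]
  by (auto simp: contact_point_def linear_form_def bform_def algebra_simps)

lemma b_linear_left: "contact_point W \<alpha> q \<Longrightarrow> v \<in> T q \<Longrightarrow> linear_form W q (\<lambda>u. b q u v)"
  using ext_deriv_linear_left[OF W, of q \<alpha> v]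
  by (auto simp: contact_point_def linear_form_def bform_def algebra_simps)

text \<open>Since d\<alpha>(u, u) = 0, the value of b at (u, u) is the square of \<alpha>(u). So
  \<alpha>(u) = 0, then b(u, v) = d\<alpha>(u, v) for every v, and the contact condition
  applies.\<close>

lemma b_nondegenerate:
  assumes q: "contact_point W \<alpha> q" and u: "u \<in> T q" and b: "\<And>v. v \<in> T q \<Longrightarrow> b q u v = 0"
  shows "u = (\<lambda>_. 0)"
proof -
  have "\<alpha> q u = 0"
    using b[OF u] \<omega>_self by (simp add: bform_def)
  then have "\<omega> q u v = 0" if "v \<in> T q" for v
    using b[OF that] by (simp add: bform_def)
  then show ?thesis
    using q u \<open>\<alpha> q u = 0\<close> by (simp add: contact_point_def)
qed

lemma b_smooth:
  assumes c: "c \<in> charts_at W w0"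
  shows "smooth (\<lambda>q. b q (coord_vec W c \<xi> q) (coord_vec W c \<eta> q))"
  unfolding bform_def
  by (intro smooth_at_add[OF W] smooth_at_mult[OF W] ext_deriv_smooth[OF W form c] one_form_at_chart[OF W form c])

text \<open>In a coordinate frame the equation for the components of Y is linear, with the Gram
  matrix of b as coefficients. Nondegeneracy makes that matrix invertible at every nearby point, and
  \<open>smooth_at_solve\<close> yields smooth components.\<close>

lemma b_represents:
  assumes \<rho>: "one_form_at W w0 \<rho>"
  shows "\<exists>Y. vfield Y \<and> (\<forall>\<^sub>F q in nhds w0. \<forall>u\<in>T q. b q (Y q) u = \<rho> q u)"
proof -
  let ?c = "some_chart W w0"
  note c = some_chart_in[OF W, of w0]
  define e where "e = (\<lambda>i. coord_vec W ?c (axis i 1))"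
  \<comment> \<open>b is not symmetric, so the order matters: the row index j belongs to the second
    argument, and the product of the matrix with y lists the values b(Y, e_j) for the vector Y with
    components y.\<close>
  define M where "M = (\<lambda>q. (\<chi> j i. b q (e i q) (e j q)) :: 'k ^ 'm ^ 'm)"
  define r where "r = (\<lambda>q. (\<chi> j. \<rho> q (e j q)) :: 'k ^ 'm)"
  note ev = contact_points charts_at_eventually[OF W c] one_form_at_linear[OF \<rho>]
  have eT: "e i q \<in> T q" if "?c \<in> charts_at W q" for i q
    unfolding e_def by (rule coord_vec_in[OF W that])
  have M: "(M q *v y) $ j = b q (coord_vec W ?c y q) (e j q)"
    if q: "contact_point W \<alpha> q" and cq: "?c \<in> charts_at W q" for q y j
    using linear_form_expand[OF W b_linear_left[OF q eT[OF cq, of j]] cq coord_vec_in[OF W cq, of y]]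
    by (simp add: M_def matrix_vector_mult_def coord_vec_self[OF W cq] e_def mult.commute)
  have det: "\<forall>\<^sub>F q in nhds w0. det (M q) \<noteq> 0"
    using ev(1,2)
  proof eventually_elim
    case (elim q)
    have "y = 0" if "M q *v y = 0" for y
    proof -
      have "b q (coord_vec W ?c y q) v = 0" if v: "v \<in> T q" for v
        unfolding linear_form_expand[OF W b_linear[OF elim(1) coord_vec_in[OF W elim(2)]] elim(2) v]
          e_def[symmetric]
        using M[OF elim, of y] \<open>M q *v y = 0\<close> by (simp add: e_def)
      then have "coord_vec W ?c y q = (\<lambda>_. 0)"
        by (rule b_nondegenerate[OF elim(1) coord_vec_in[OF W elim(2)]])
      then show ?thesis
        using coord_vec_self[OF W elim(2), of y] by simp
    qed
    then have "invertible (M q)"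
      unfolding invertible_left_inverse matrix_left_invertible_ker by blast
    then show ?case
      by (simp add: invertible_det_nz)
  qed
  obtain y where y: "smooth_at W (*s) w0 y" "\<forall>\<^sub>F q in nhds w0. M q *v y q = r q"
    using smooth_at_solve[OF W, of w0 M r] det b_smooth[OF c] one_form_at_chart[OF W \<rho> c]
    by (auto simp: M_def r_def e_def smooth_at_vec_iff[OF W])
  have "vfield (\<lambda>q. coord_vec W ?c (y q) (id q))"
    by (rule vf_along_coord_vec[OF W W smooth_map_at_id[OF W] _ y(1)]) (simp add: c)
  moreover have "\<forall>\<^sub>F q in nhds w0. \<forall>u\<in>T q. b q (coord_vec W ?c (y q) (id q)) u = \<rho> q u"
    using ev y(2)
  proof eventually_elim
    case (elim q)
    show ?case
    proof
      fix u assume u: "u \<in> T q"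
      have "b q (coord_vec W ?c (y q) q) (e j q) = \<rho> q (e j q)" for j
        using M[OF elim(1,2), of "y q" j] elim(4) by (simp add: r_def)
      then show "b q (coord_vec W ?c (y q) (id q)) u = \<rho> q u"
        unfolding linear_form_expand[OF W elim(3,2) u] id_apply
          linear_form_expand[OF W b_linear[OF elim(1) coord_vec_in[OF W elim(2)]] elim(2) u]
        by (simp add: e_def)
    qed
  qed
  ultimately show ?thesis by blast
qed

text \<open>R is the field that represents \<alpha> itself through b. Inserting R gives
  \<alpha>(R)^2 = \<alpha>(R). If \<alpha>(R) were 0, then d\<alpha>(R, u) = \<alpha>(u) would
  vanish on the kernel of \<alpha>, forcing R = 0 and then \<alpha> = 0. So \<alpha>(R) = 1, and the
  remaining equation says d\<alpha>(R, u) = 0.\<close>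

lemma reeb_exists:
  "\<exists>R. vfield R \<and> (\<forall>\<^sub>F q in nhds w0. \<alpha> q (R q) = 1 \<and> (\<forall>u\<in>T q. \<omega> q (R q) u = 0))"
proof -
  obtain R where R: "vfield R" "\<forall>\<^sub>F q in nhds w0. \<forall>u\<in>T q. b q (R q) u = \<alpha> q u"
    using b_represents[OF form] by blast
  have "\<forall>\<^sub>F q in nhds w0. \<alpha> q (R q) = 1 \<and> (\<forall>u\<in>T q. \<omega> q (R q) u = 0)"
    using R(2) contact_points vf_along_tangent[OF R(1)]
  proof eventually_elim
    case (elim q)
    then have RT: "R q \<in> T q" by simp
    have "\<alpha> q (R q) \<noteq> 0"
    proof
      assume 0: "\<alpha> q (R q) = 0"
      then have eq: "\<omega> q (R q) u = \<alpha> q u" if "u \<in> T q" for u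
        using elim(1) that by (simp add: bform_def)
      then have "R q = (\<lambda>_. 0)"
        using elim(2) RT 0 by (simp add: contact_point_def)
      moreover obtain u where u: "u \<in> T q" "\<alpha> q u \<noteq> 0"
        using elim(2) by (auto simp: contact_point_def)
      moreover have "\<omega> q (\<lambda>_. 0) u = 0"
        by (rule \<omega>_zero[OF elim(2) u(1)])
      ultimately show False
        using eq[OF u(1)] by simp
    qed
    moreover have "\<alpha> q (R q) * \<alpha> q (R q) = \<alpha> q (R q)"
      using elim(1) RT \<omega>_self by (force simp: bform_def)
    ultimately have "\<alpha> q (R q) = 1"
      by simp
    then show ?case
      using elim(1) by (force simp: bform_def)
  qed
  with R(1) show ?thesis by blast
qed

definition R where
  "R = (SOME R. vfield R \<and> (\<forall>\<^sub>F q in nhds w0. \<alpha> q (R q) = 1 \<and> (\<forall>u\<in>T q. \<omega> q (R q) u = 0)))"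

lemma R: "vfield R" "\<forall>\<^sub>F q in nhds w0. \<alpha> q (R q) = 1 \<and> (\<forall>u\<in>T q. \<omega> q (R q) u = 0)"
  using someI_ex[OF reeb_exists] unfolding R_def by blast+

lemma R_tangent: "\<forall>\<^sub>F q in nhds w0. R q \<in> T q"
  using vf_along_tangent[OF R(1)] by simp

text \<open>On the kernel of \<alpha> the prescribed 1-form is -dh; the multiple dh(R) \<alpha> is
  added to make it vanish on R, as any d\<alpha>(Z, u) must. For the representing field this gives
  b(Z, R) = 0, that is \<alpha>(Z) = 0, so b(Z, u) reduces to d\<alpha>(Z, u).\<close>

lemma Z_exists:
  assumes h: "smooth h"
  shows "\<exists>Z. vfield Z \<and> (\<forall>\<^sub>F q in nhds w0. \<alpha> q (Z q) = 0 \<and>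
    (\<forall>u\<in>T q. \<omega> q (Z q) u = differential W h q (R q) * \<alpha> q u - differential W h q u))"
proof -
  let ?\<rho> = "\<lambda>q u. differential W h q (R q) * \<alpha> q u - differential W h q u"
  note d = differential_one_form[OF W h]
  have dR: "smooth (\<lambda>q. differential W h q (R q))"
    using one_form_apply_smooth[OF W W smooth_map_at_id[OF W] _ R(1), of "differential W h"] d by simp
  have "one_form_at W w0 ?\<rho>"
    unfolding one_form_at_def
  proof
    show "\<forall>\<^sub>F q in nhds w0. \<forall>u\<in>T q. \<forall>v\<in>T q. \<forall>k.
        ?\<rho> q (tadd u v) = ?\<rho> q u + ?\<rho> q v \<and> ?\<rho> q (tscale k u) = k * ?\<rho> q u"
      using one_form_at_linear[OF d] one_form_at_linear[OF form]
      by eventually_elim (simp add: linear_form_def algebra_simps)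
    show "\<exists>c\<in>charts_at W w0. \<forall>\<xi>. smooth (\<lambda>q. ?\<rho> q (coord_vec W c \<xi> q))"
      using some_chart_in[OF W]
      by (intro bexI[of _ "some_chart W w0"] allI smooth_at_diff[OF W] smooth_at_mult[OF W] dR
          one_form_at_chart[OF W form] one_form_at_chart[OF W d])
  qed
  then obtain Z where Z: "vfield Z" "\<forall>\<^sub>F q in nhds w0. \<forall>u\<in>T q. b q (Z q) u = ?\<rho> q u"
    using b_represents by blast
  have "\<forall>\<^sub>F q in nhds w0. \<alpha> q (Z q) = 0 \<and> (\<forall>u\<in>T q. \<omega> q (Z q) u = ?\<rho> q u)"
    using Z(2) R(2) R_tangent vf_along_tangent[OF Z(1)]
  proof eventually_elim
    case (elim q)
    have "\<omega> q (Z q) (R q) = 0"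
      using elim(2,4) ext_deriv_antisym[of W \<alpha> q "Z q" "R q"] by simp
    then have "\<alpha> q (Z q) = 0"
      using elim(1,2,3) by (force simp: bform_def)
    then show ?case
      using elim(1) by (force simp: bform_def)
  qed
  with Z(1) show ?thesis by blast
qed

text \<open>The component of \<open>X\<^sub>h\<close> in the contact hyperplanes: \<open>X\<^sub>h = h R + Z h\<close>.\<close>
definition Z where
  "Z h = (SOME Z. vfield Z \<and> (\<forall>\<^sub>F q in nhds w0. \<alpha> q (Z q) = 0 \<and>
    (\<forall>u\<in>T q. \<omega> q (Z q) u = differential W h q (R q) * \<alpha> q u - differential W h q u)))"

lemma Z:
  assumes "smooth h"
  shows "vfield (Z h)"
    and "\<forall>\<^sub>F q in nhds w0. \<alpha> q (Z h q) = 0 \<and>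
      (\<forall>u\<in>T q. \<omega> q (Z h q) u = differential W h q (R q) * \<alpha> q u - differential W h q u)"
  using someI_ex[OF Z_exists[OF assms]] unfolding Z_def by blast+

lemma Z_tangent: "smooth h \<Longrightarrow> \<forall>\<^sub>F q in nhds w0. Z h q \<in> T q"
  using vf_along_tangent[OF Z(1)] by simp

text \<open>To recognise \<open>Z h\<close> it suffices to test d\<alpha> on the contact
  hyperplanes. All rules for \<open>Z\<close> are obtained by checking these conditions for the
  candidate.\<close>

lemma Z_unique:
  assumes h: "smooth h"
    and Y: "\<forall>\<^sub>F q in nhds w0. Y q \<in> T q \<and> \<alpha> q (Y q) = 0 \<and>
      (\<forall>u\<in>T q. \<alpha> q u = 0 \<longrightarrow> \<omega> q (Y q) u = - differential W h q u)"
  shows "\<forall>\<^sub>F q in nhds w0. Y q = Z h q"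
  using Y Z(2)[OF h] Z_tangent[OF h] contact_points
  by eventually_elim (auto intro: contact_point_eqI)

text \<open>\<open>THE\<close> is applied to germs, for which uniqueness holds: two candidates agree
  near the base point by \<open>contact_point_eqI\<close>.\<close>

lemma reeb_eq: "reeb W w0 \<alpha> = germ w0 R"
  unfolding reeb_def
proof (rule the_equality)
  show "\<exists>Y. germ w0 R = germ w0 Y \<and> vfield Y \<and>
      (\<forall>\<^sub>F q in nhds w0. \<alpha> q (Y q) = 1 \<and> (\<forall>u\<in>T q. \<omega> q (Y q) u = 0))"
    using R by blast
  fix G assume "\<exists>Y. G = germ w0 Y \<and> vfield Y \<and>
      (\<forall>\<^sub>F q in nhds w0. \<alpha> q (Y q) = 1 \<and> (\<forall>u\<in>T q. \<omega> q (Y q) u = 0))"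
  then obtain Y where Y: "G = germ w0 Y" "vfield Y"
      "\<forall>\<^sub>F q in nhds w0. \<alpha> q (Y q) = 1 \<and> (\<forall>u\<in>T q. \<omega> q (Y q) u = 0)"
    by blast
  have "\<forall>\<^sub>F q in nhds w0. Y q = R q"
    using Y(3) vf_along_tangent[OF Y(2)] R(2) R_tangent contact_points
    by eventually_elim (auto intro: contact_point_eqI)
  then show "G = germ w0 R"
    unfolding Y(1) germ_def by (auto elim: eventually_elim2)
qed

lemma lie_deriv_id:
  assumes Y: "vfield Y" and h: "\<forall>\<^sub>F q in nhds w0. \<alpha> q (Y q) = h q"
  shows "\<forall>\<^sub>F q in nhds w0. \<forall>u\<in>T q. lie_deriv W W w0 id Y \<alpha> q u = \<omega> q (Y q) u + differential W h q u"
proof -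
  have "\<forall>\<^sub>F q in nhds w0. \<forall>\<^sub>F r in nhds q. \<alpha> r (Y r) = h r"
    using h by (simp add: eventually_eventually)
  moreover have "one_form_at W (id w0) \<alpha>"
    using form by simp
  note lie_deriv_cartan[OF W W smooth_map_at_id[OF W] Y this]
  ultimately show ?thesis
  proof eventually_elim
    case (elim q)
    show ?case
    proof
      fix u assume u: "u \<in> T q"
      have "lie_deriv W W w0 id Y \<alpha> q u =
          \<omega> (id q) (Y q) (tangent_map W W id q u) + differential W (\<lambda>r. \<alpha> (id r) (Y r)) q u"
        using elim(2) u by blast
      then show "lie_deriv W W w0 id Y \<alpha> q u = \<omega> q (Y q) u + differential W h q u"
        using tangent_map_id[OF W u] differential_cong[OF W elim(1)] by (simp only: id_apply)
    qed
  qed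
qed

text \<open>For X = H R + Z_H, Cartan's formula gives L_X \<alpha> = dH(R) \<alpha>, so dH(R) is the
  factor \<mu>. Conversely, for any candidate Y the unknown factor drops out on the kernel of
  \<alpha>, leaving d\<alpha>(Y, u) = -dH(u) there; together with \<alpha>(Y) = H this determines
  Y.\<close>

lemma ham_field_eq:
  assumes h: "smooth (rep H)"
  shows "ham_field W w0 \<alpha> H = germ w0 (\<lambda>q. tadd (tscale (rep H q) (R q)) (Z (rep H) q))" (is "_ = germ w0 ?X")
  unfolding ham_field_def
proof (rule the_equality)
  have X: "vfield ?X"
    by (intro vf_along_add[OF W W smooth_map_at_id[OF W]] vf_along_scale[OF W W smooth_map_at_id[OF W]] h R Z)
  note ev = contact_points R(2) R_tangent Z(2)[OF h] Z_tangent[OF h]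
  have X\<alpha>: "\<forall>\<^sub>F q in nhds w0. \<alpha> q (?X q) = rep H q"
    using ev
    by eventually_elim (simp add: \<alpha>_add \<alpha>_scale tangent_scale[OF W])
  have X\<omega>: "\<forall>\<^sub>F q in nhds w0. \<forall>u\<in>T q. \<omega> q (?X q) u = differential W (rep H) q (R q) * \<alpha> q u - differential W (rep H) q u"
    using ev
    by eventually_elim (simp add: \<omega>_add \<omega>_scale tangent_scale[OF W])
  have "smooth (\<lambda>q. differential W (rep H) q (R q))"
    using one_form_apply_smooth[OF W W smooth_map_at_id[OF W] _ R(1), of "differential W (rep H)"]
      differential_one_form[OF W h] by simp
  moreover have "\<forall>\<^sub>F q in nhds w0. \<forall>u\<in>T q. lie_deriv W W w0 id ?X \<alpha> q u = differential W (rep H) q (R q) * \<alpha> q u"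
    using lie_deriv_id[OF X X\<alpha>] X\<omega> by eventually_elim simp
  ultimately show "\<exists>Y. germ w0 ?X = germ w0 Y \<and> vfield Y \<and>
      (\<forall>\<^sub>F q in nhds w0. \<alpha> q (Y q) = rep H q) \<and>
      (\<exists>\<mu>. smooth \<mu> \<and> (\<forall>\<^sub>F q in nhds w0. \<forall>u\<in>T q. lie_deriv W W w0 id Y \<alpha> q u = \<mu> q * \<alpha> q u))"
    using X X\<alpha> by (intro exI[of _ ?X]) blast
  fix G assume "\<exists>Y. G = germ w0 Y \<and> vfield Y \<and>
      (\<forall>\<^sub>F q in nhds w0. \<alpha> q (Y q) = rep H q) \<and>
      (\<exists>\<mu>. smooth \<mu> \<and> (\<forall>\<^sub>F q in nhds w0. \<forall>u\<in>T q. lie_deriv W W w0 id Y \<alpha> q u = \<mu> q * \<alpha> q u))"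
  then obtain Y \<mu> where Y: "G = germ w0 Y" "vfield Y" "\<forall>\<^sub>F q in nhds w0. \<alpha> q (Y q) = rep H q"
      "\<forall>\<^sub>F q in nhds w0. \<forall>u\<in>T q. lie_deriv W W w0 id Y \<alpha> q u = \<mu> q * \<alpha> q u"
    by blast
  have "\<forall>\<^sub>F q in nhds w0. Y q = ?X q"
    using lie_deriv_id[OF Y(2,3)] Y(3,4) vf_along_tangent[OF Y(2)] X\<alpha> X\<omega> vf_along_tangent[OF X] contact_points
  proof eventually_elim
    case (elim q)
    show ?case
    proof (rule contact_point_eqI[OF elim(8)])
      show "Y q \<in> T q" "?X q \<in> T q" "\<alpha> q (Y q) = \<alpha> q (?X q)"
        using elim by simp_all
      fix u assume u: "u \<in> T q" "\<alpha> q u = 0"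
      have "\<omega> q (Y q) u + differential W (rep H) q u = 0"
        using elim(1,3) u by force
      then show "\<omega> q (Y q) u = \<omega> q (?X q) u"
        using elim(6) u by (simp add: eq_neg_iff_add_eq_0)
    qed
  qed
  then show "G = germ w0 ?X"
    unfolding Y(1) germ_def by (auto elim: eventually_elim2)
qed

section \<open>Derivation rules for the fields \<open>Z h\<close>\<close>

lemma Z_add:
  assumes g: "smooth g" and h: "smooth h"
  shows "\<forall>\<^sub>F q in nhds w0. tadd (Z g q) (Z h q) = Z (\<lambda>q. g q + h q) q"
proof (rule Z_unique[OF smooth_at_add[OF W g h]])
  show "\<forall>\<^sub>F q in nhds w0. tadd (Z g q) (Z h q) \<in> T q \<and> \<alpha> q (tadd (Z g q) (Z h q)) = 0 \<and>
      (\<forall>u\<in>T q. \<alpha> q u = 0 \<longrightarrow> \<omega> q (tadd (Z g q) (Z h q)) u = - differential W (\<lambda>q. g q + h q) q u)"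
    using contact_points Z(2)[OF g] Z(2)[OF h] Z_tangent[OF g] Z_tangent[OF h]
      smooth_at_eventually[OF W g] smooth_at_eventually[OF W h]
    by eventually_elim (simp add: tangent_add[OF W] \<alpha>_add \<omega>_add differential_add[OF W])
qed

text \<open>The Leibniz rule is inherited from that of the differential. It will become the
  associativity of the multiplication.\<close>

lemma Z_mult:
  assumes g: "smooth g" and h: "smooth h"
  shows "\<forall>\<^sub>F q in nhds w0. tadd (tscale (g q) (Z h q)) (tscale (h q) (Z g q)) = Z (\<lambda>q. g q * h q) q"
proof (rule Z_unique[OF smooth_at_mult[OF W g h]])
  show "\<forall>\<^sub>F q in nhds w0. tadd (tscale (g q) (Z h q)) (tscale (h q) (Z g q)) \<in> T q \<and>
      \<alpha> q (tadd (tscale (g q) (Z h q)) (tscale (h q) (Z g q))) = 0 \<and>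
      (\<forall>u\<in>T q. \<alpha> q u = 0 \<longrightarrow>
        \<omega> q (tadd (tscale (g q) (Z h q)) (tscale (h q) (Z g q))) u = - differential W (\<lambda>q. g q * h q) q u)"
    using contact_points Z(2)[OF g] Z(2)[OF h] Z_tangent[OF g] Z_tangent[OF h]
      smooth_at_eventually[OF W g] smooth_at_eventually[OF W h]
    by eventually_elim
      (simp add: tangent_add[OF W] tangent_scale[OF W] \<alpha>_add \<alpha>_scale \<omega>_add \<omega>_scale differential_mult[OF W])
qed

lemma Z_const: "\<forall>\<^sub>F q in nhds w0. (\<lambda>_. 0) = Z (\<lambda>_. k) q"
proof (rule Z_unique[OF smooth_at_const[OF W vector_space_mult]])
  show "\<forall>\<^sub>F q in nhds w0. (\<lambda>_. 0) \<in> T q \<and> \<alpha> q (\<lambda>_. 0) = 0 \<and>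
      (\<forall>u\<in>T q. \<alpha> q u = 0 \<longrightarrow> \<omega> q (\<lambda>_. 0) u = - differential W (\<lambda>_. k) q u)"
    using contact_points
    by eventually_elim (simp add: \<alpha>_zero \<omega>_zero tangent_zero[OF W] differential_const[OF W])
qed

text \<open>\<open>Z\<close> is defined on functions; this lets it pass to germs, because functions
  that agree near the base point have equal differentials at all nearby points.\<close>

lemma Z_cong:
  assumes g: "smooth g" and ev: "\<forall>\<^sub>F q in nhds w0. g q = h q"
  shows "\<forall>\<^sub>F q in nhds w0. Z g q = Z h q"
proof (rule Z_unique[OF smooth_at_cong[OF W g ev]])
  have "\<forall>\<^sub>F q in nhds w0. \<forall>\<^sub>F r in nhds q. g r = h r"
    using ev by (simp add: eventually_eventually)
  then show "\<forall>\<^sub>F q in nhds w0. Z g q \<in> T q \<and> \<alpha> q (Z g q) = 0 \<and>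
      (\<forall>u\<in>T q. \<alpha> q u = 0 \<longrightarrow> \<omega> q (Z g q) u = - differential W h q u)"
    using Z(2)[OF g] Z_tangent[OF g]
    by eventually_elim (simp add: differential_cong[OF W])
qed

end

section \<open>Germs\<close>

lemma germ_eq_iff: "germ p g = germ p h \<longleftrightarrow> (\<forall>\<^sub>F x in nhds p. g x = h x)"
proof
  assume eq: "germ p g = germ p h"
  have "g \<in> germ p g"
    by (simp add: germ_def)
  then have "g \<in> germ p h"
    unfolding eq .
  then show "\<forall>\<^sub>F x in nhds p. g x = h x"
    by (simp add: germ_def)
next
  assume "\<forall>\<^sub>F x in nhds p. g x = h x"
  then show "germ p g = germ p h"
    by (auto simp: germ_def elim: eventually_elim2)
qed

lemma rep_germ: "\<forall>\<^sub>F x in nhds p. rep (germ p h) x = h x"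
proof -
  have "h \<in> germ p h"
    by (simp add: germ_def)
  then have "rep (germ p h) \<in> germ p h"
    unfolding rep_def by (rule someI[where P = "\<lambda>g. g \<in> germ p h"])
  then show ?thesis
    by (simp add: germ_def)
qed

lemma fun_germs_carrier: "G \<in> carrier (fun_germs A p) \<longleftrightarrow> (\<exists>g. G = germ p g \<and> smooth_at A (*) p g)"
  by (auto simp: fun_germs_def)

lemma fun_germs_mult: "germ p g \<otimes>\<^bsub>fun_germs A p\<^esub> germ p h = germ p (\<lambda>x. g x * h x)"
proof -
  have "\<forall>\<^sub>F x in nhds p. rep (germ p g) x * rep (germ p h) x = g x * h x"
    using rep_germ[of p g] rep_germ[of p h] by eventually_elim simp
  then show ?thesis
    by (simp add: fun_germs_def germ_eq_iff)
qed

lemma fun_germs_add: "germ p g \<oplus>\<^bsub>fun_germs A p\<^esub> germ p h = germ p (\<lambda>x. g x + h x)"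
proof -
  have "\<forall>\<^sub>F x in nhds p. rep (germ p g) x + rep (germ p h) x = g x + h x"
    using rep_germ[of p g] rep_germ[of p h] by eventually_elim simp
  then show ?thesis
    by (simp add: fun_germs_def germ_eq_iff)
qed

lemma fun_germs_one: "\<one>\<^bsub>fun_germs A p\<^esub> = germ p (\<lambda>_. 1)"
  and fun_germs_zero: "\<zero>\<^bsub>fun_germs A p\<^esub> = germ p (\<lambda>_. 0)"
  by (simp_all add: fun_germs_def)

lemma fun_germs_cring:
  assumes A: "manifold A"
  shows "cring (fun_germs A p)"
proof (rule cringI)
  note ops = fun_germs_carrier fun_germs_mult fun_germs_add fun_germs_one fun_germs_zero
  note const = smooth_at_const[OF A vector_space_mult]
  show "abelian_group (fun_germs A p)"
  proof (rule abelian_groupI)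
    fix x assume "x \<in> carrier (fun_germs A p)"
    then obtain g where g: "x = germ p g" "smooth_at A (*) p g"
      by (auto simp: ops)
    then show "\<exists>y\<in>carrier (fun_germs A p). y \<oplus>\<^bsub>fun_germs A p\<^esub> x = \<zero>\<^bsub>fun_germs A p\<^esub>"
      by (intro bexI[of _ "germ p (\<lambda>x. - g x)"]) (auto simp: ops intro: smooth_at_uminus[OF A])
  qed (auto simp: ops add_ac intro: smooth_at_add[OF A] const)
  show "comm_monoid (fun_germs A p)"
    by (rule comm_monoidI) (auto simp: ops mult_ac intro: smooth_at_mult[OF A] const)
  show "(x \<oplus>\<^bsub>fun_germs A p\<^esub> y) \<otimes>\<^bsub>fun_germs A p\<^esub> z =
      x \<otimes>\<^bsub>fun_germs A p\<^esub> z \<oplus>\<^bsub>fun_germs A p\<^esub> y \<otimes>\<^bsub>fun_germs A p\<^esub> z"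
    if "x \<in> carrier (fun_germs A p)" "y \<in> carrier (fun_germs A p)" "z \<in> carrier (fun_germs A p)" for x y z
    using that by (auto simp: ops distrib_right)
qed

section \<open>Exact sequences from linear maps\<close>

text \<open>Every element of the target is a value of h, so each axiom is the image of the same
  axiom in M. This spares a separate proof that R_f is closed under its operations.\<close>

lemma module_image:
  fixes E M M'
  assumes M: "Module.module E M"
    and surj: "h ` carrier M = carrier M'"
    and zero: "h \<zero>\<^bsub>M\<^esub> = \<zero>\<^bsub>M'\<^esub>"
    and add: "\<And>x y. x \<in> carrier M \<Longrightarrow> y \<in> carrier M \<Longrightarrow> h (x \<oplus>\<^bsub>M\<^esub> y) = h x \<oplus>\<^bsub>M'\<^esub> h y"
    and smult: "\<And>r x. r \<in> carrier E \<Longrightarrow> x \<in> carrier M \<Longrightarrow> h (r \<odot>\<^bsub>M\<^esub> x) = r \<odot>\<^bsub>M'\<^esub> h x"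
  shows "Module.module E M'"
proof -
  interpret Module.module E M by (rule M)
  have ex: "\<exists>x\<in>carrier M. y = h x" if "y \<in> carrier M'" for y
    using that surj by auto
  have im: "h x \<in> carrier M'" if "x \<in> carrier M" for x
    using that surj by auto
  have mz: "\<zero>\<^bsub>M'\<^esub> \<in> carrier M'"
    using im[OF M.zero_closed] zero by simp
  show ?thesis
  proof (rule Module.moduleI)
    show "cring E" by (rule is_cring)
    show "abelian_group M'"
    proof (rule abelian_groupI)
      fix x y assume "x \<in> carrier M'" "y \<in> carrier M'"
      then obtain u v where uv: "x = h u" "y = h v" "u \<in> carrier M" "v \<in> carrier M"
        using ex by blast
      show "x \<oplus>\<^bsub>M'\<^esub> y \<in> carrier M'"
        using uv im[OF M.add.m_closed[OF uv(3,4)]] add[OF uv(3,4)] by simp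
      show "x \<oplus>\<^bsub>M'\<^esub> y = y \<oplus>\<^bsub>M'\<^esub> x"
        using uv add[OF uv(3,4)] add[OF uv(4,3)] M.add.m_comm[OF uv(3,4)] by simp
      fix z assume "z \<in> carrier M'"
      then obtain w where w: "z = h w" "w \<in> carrier M"
        using ex by blast
      have "h ((u \<oplus>\<^bsub>M\<^esub> v) \<oplus>\<^bsub>M\<^esub> w) = h (u \<oplus>\<^bsub>M\<^esub> (v \<oplus>\<^bsub>M\<^esub> w))"
        using uv w M.add.m_assoc by simp
      then show "(x \<oplus>\<^bsub>M'\<^esub> y) \<oplus>\<^bsub>M'\<^esub> z = x \<oplus>\<^bsub>M'\<^esub> (y \<oplus>\<^bsub>M'\<^esub> z)"
        using uv w by (simp add: add)
    next
      fix x assume "x \<in> carrier M'"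
      then obtain u where u: "x = h u" "u \<in> carrier M"
        using ex by blast
      show "\<zero>\<^bsub>M'\<^esub> \<oplus>\<^bsub>M'\<^esub> x = x"
        using u add[OF M.zero_closed u(2)] zero by simp
      show "\<exists>y\<in>carrier M'. y \<oplus>\<^bsub>M'\<^esub> x = \<zero>\<^bsub>M'\<^esub>"
        using u add[OF M.a_inv_closed[OF u(2)] u(2)] M.l_neg[OF u(2)] zero im[OF M.a_inv_closed[OF u(2)]]
        by (intro bexI[of _ "h (\<ominus>\<^bsub>M\<^esub> u)"]) auto
    qed (rule mz)
    fix r x assume r: "r \<in> carrier E" and "x \<in> carrier M'"
    then obtain u where u: "x = h u" "u \<in> carrier M"
      using ex by blast
    show "r \<odot>\<^bsub>M'\<^esub> x \<in> carrier M'"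
      using u smult[OF r u(2)] im[OF smult_closed[OF r u(2)]] by simp
    fix s assume s: "s \<in> carrier E"
    show "(r \<oplus>\<^bsub>E\<^esub> s) \<odot>\<^bsub>M'\<^esub> x = r \<odot>\<^bsub>M'\<^esub> x \<oplus>\<^bsub>M'\<^esub> s \<odot>\<^bsub>M'\<^esub> x"
      using u r s smult_l_distr[OF r s u(2)] by (simp flip: smult add)
    show "(r \<otimes>\<^bsub>E\<^esub> s) \<odot>\<^bsub>M'\<^esub> x = r \<odot>\<^bsub>M'\<^esub> (s \<odot>\<^bsub>M'\<^esub> x)"
      using u r s smult_assoc1[OF r s u(2)] by (simp flip: smult)
  next
    fix x assume "x \<in> carrier M'"
    then obtain u where u: "x = h u" "u \<in> carrier M"
      using ex by blast
    show "\<one>\<^bsub>E\<^esub> \<odot>\<^bsub>M'\<^esub> x = x"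
      using u smult[OF R.one_closed u(2)] by simp
  next
    fix r x y assume r: "r \<in> carrier E" and "x \<in> carrier M'" "y \<in> carrier M'"
    then obtain u v where uv: "x = h u" "y = h v" "u \<in> carrier M" "v \<in> carrier M"
      using ex by blast
    show "r \<odot>\<^bsub>M'\<^esub> (x \<oplus>\<^bsub>M'\<^esub> y) = r \<odot>\<^bsub>M'\<^esub> x \<oplus>\<^bsub>M'\<^esub> r \<odot>\<^bsub>M'\<^esub> y"
      using uv r smult_r_distr[OF r uv(3,4)] by (simp flip: smult add)
  qed
qed

text \<open>Reduces exactness to surjectivity and compatibility with the operations: the kernel is a
  submodule, and the target is a module by \<open>module_image\<close>.\<close>

lemma short_exact_kernel:
  fixes E M M'
  assumes M: "Module.module E M"
    and surj: "h ` carrier M = carrier M'"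
    and zero: "h \<zero>\<^bsub>M\<^esub> = \<zero>\<^bsub>M'\<^esub>"
    and add: "\<And>x y. x \<in> carrier M \<Longrightarrow> y \<in> carrier M \<Longrightarrow> h (x \<oplus>\<^bsub>M\<^esub> y) = h x \<oplus>\<^bsub>M'\<^esub> h y"
    and smult: "\<And>r x. r \<in> carrier E \<Longrightarrow> x \<in> carrier M \<Longrightarrow> h (r \<odot>\<^bsub>M\<^esub> x) = r \<odot>\<^bsub>M'\<^esub> h x"
  shows "short_exact E (M\<lparr>carrier := kernel (add_monoid M) (add_monoid M') h\<rparr>) (\<lambda>v. v) M h M'"
proof -
  interpret Module.module E M by (rule M)
  interpret M': Module.module E M' by (rule module_image[OF assms])
  let ?K = "kernel (add_monoid M) (add_monoid M') h"
  have K: "x \<in> ?K \<longleftrightarrow> x \<in> carrier M \<and> h x = \<zero>\<^bsub>M'\<^esub>" for x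
    by (simp add: kernel_def)
  have "submodule ?K E M"
  proof (rule submoduleI)
    show "?K \<subseteq> carrier M"
      by (auto simp: K)
    show "\<zero>\<^bsub>M\<^esub> \<in> ?K"
      by (simp add: K zero)
    show "\<ominus>\<^bsub>M\<^esub> a \<in> ?K" if "a \<in> ?K" for a
    proof -
      have a: "a \<in> carrier M" "h a = \<zero>\<^bsub>M'\<^esub>"
        using that by (auto simp: K)
      have "h (\<ominus>\<^bsub>M\<^esub> a) \<in> carrier M'"
        using surj a by auto
      then have "h (\<ominus>\<^bsub>M\<^esub> a) = \<zero>\<^bsub>M'\<^esub>"
        using add[OF M.a_inv_closed[OF a(1)] a(1)] M.l_neg[OF a(1)] zero a(2) by simp
      then show ?thesis
        using a by (simp add: K)
    qed
  qed (auto simp: K add smult)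
  then have "Module.module E (M\<lparr>carrier := ?K\<rparr>)"
    by (rule submodule.submodule_is_module) (rule M)
  moreover have "(\<lambda>v. v) \<in> module_homs E (M\<lparr>carrier := ?K\<rparr>) M"
    by (auto simp: module_homs_def hom_def K)
  moreover have "h \<in> module_homs E M M'"
    using surj by (auto simp: module_homs_def hom_def add smult)
  ultimately show ?thesis
    using surj M M'.module_axioms by (auto simp: short_exact_def inj_on_def)
qed

section \<open>Infinitesimal integral deformations\<close>

text \<open>Coordinate functions are dual to the coordinate vectors; they will serve as the
  functions H_i that witness membership in R_f.\<close>

lemma differential_coord:
  assumes A: "manifold A" and c: "c \<in> charts_at A p" and u: "u \<in> tangent_space A p"
  shows "smooth_at A (*) p (\<lambda>q. snd c q $ i)" and "differential A (\<lambda>q. snd c q $ i) p u = u c $ i"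
proof -
  have "smooth_at A (*s) p (snd c)"
    using smooth_map_at_chart[OF A A smooth_map_at_id[OF A], of c p] c by (simp add: comp_def)
  then show s: "smooth_at A (*) p (\<lambda>q. snd c q $ i)"
    by (simp add: smooth_at_vec_iff[OF A])
  have "FD ((\<lambda>q. snd c q $ i) \<circ> chart_inv c) (snd c p) = FD (\<lambda>y. y $ i) (snd c p)"
    by (rule FD_cong, rule eventually_mono[OF chart_image_eventually[OF A c]])
      (simp add: snd_chart_inv[OF A c])
  also have "\<dots> = (\<lambda>y. y $ i)"
    by (rule FD_eq[OF bounded_linear_imp_has_derivative[OF bounded_linear_vec_nth]])
  finally show "differential A (\<lambda>q. snd c q $ i) p u = u c $ i"
    unfolding differential_chart[OF A s c u] by simp
qed

lemma ext_deriv_along_smooth: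
  assumes A: "manifold A" and B: "manifold B" and f: "smooth_map_at A B p f"
    and \<alpha>: "one_form_at B (f p) \<alpha>" and v: "vf_along A B p f v" and w: "vf_along A B p f w"
  shows "smooth_at A (*) p (\<lambda>x. ext_deriv B \<alpha> (f x) (v x) (w x))"
proof (rule smooth_at_cong[OF A])
  let ?c = "some_chart B (f p)"
  note c = some_chart_in[OF B, of "f p"]
  let ?e = "\<lambda>i. coord_vec B ?c (axis i 1)"
  show "smooth_at A (*) p (\<lambda>x. \<Sum>i\<in>UNIV. v x ?c $ i * (\<Sum>j\<in>UNIV. w x ?c $ j * ext_deriv B \<alpha> (f x) (?e i (f x)) (?e j (f x))))"
    using vf_along_chart[OF A B f v c] vf_along_chart[OF A B f w c]
      smooth_at_compose[OF A B f ext_deriv_smooth[OF B \<alpha> c]]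
    by (intro smooth_at_sum[OF A] smooth_at_mult[OF A]) (simp_all add: smooth_at_vec_iff[OF A])
  show "\<forall>\<^sub>F x in nhds p. (\<Sum>i\<in>UNIV. v x ?c $ i * (\<Sum>j\<in>UNIV. w x ?c $ j * ext_deriv B \<alpha> (f x) (?e i (f x)) (?e j (f x))))
      = ext_deriv B \<alpha> (f x) (v x) (w x)"
    using eventually_compose_filterlim[OF one_form_at_eventually[OF B \<alpha>] smooth_map_at_filterlim[OF A B f]]
      smooth_map_at_charts_eventually[OF A B f c] vf_along_tangent[OF v] vf_along_tangent[OF w]
  proof eventually_elim
    case (elim x)
    note eT = coord_vec_in[OF B elim(2)]
    show ?case
      unfolding linear_form_expand[OF B ext_deriv_linear_left[OF B elim(1,4)] elim(2,3)]
        linear_form_expand[OF B ext_deriv_linear_right[OF B elim(1) eT] elim(2,4)] ..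
  qed
qed

text \<open>Integrality is expressed through \<alpha> rather than D, so that the locale can be
  instantiated with each contact form defining the same structure.\<close>

locale integral_germ = contact_form W w0 \<alpha>
  for W :: "('w::{t2_space,second_countable_topology}, 'k::{real_normed_field,euclidean_space}, 'm::finite) chart set"
    and w0 :: 'w and \<alpha> :: "('w, 'k, 'm) form" +
  fixes N :: "('x::{t2_space,second_countable_topology}, 'k, 'n::finite) chart set" and x0 :: 'x and f :: "'x \<Rightarrow> 'w"
  assumes N: "manifold N" and f: "smooth_map_at N W x0 f" and fx0: "f x0 = w0"
    and integral: "\<forall>\<^sub>F x in nhds x0. \<forall>\<xi>\<in>tangent_space N x. \<alpha> (f x) (tangent_map N W f x \<xi>) = 0"
begin

abbreviation "vf \<equiv> vf_along N W x0 f"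
abbreviation "TN \<equiv> tangent_space N"
abbreviation "f' x \<equiv> tangent_map N W f x"
abbreviation "d \<equiv> differential N"

lemma form': "one_form_at W (f x0) \<alpha>"
  by (simp add: fx0 form)

lemma pull: "\<forall>\<^sub>F q in nhds w0. P q \<Longrightarrow> \<forall>\<^sub>F x in nhds x0. P (f x)"
  using eventually_compose_filterlim[OF _ smooth_map_at_filterlim[OF N W f]] by (simp add: fx0)

lemma pull_smooth: "smooth h \<Longrightarrow> smooth_at N (*) x0 (\<lambda>x. h (f x))"
  using smooth_at_compose[OF N W f] by (simp add: fx0)

lemma pull_vf: "vfield Y \<Longrightarrow> vf (\<lambda>x. Y (f x))"
  using vf_along_compose[OF N W f] by (simp add: fx0)

lemma f'_tangent: "\<forall>\<^sub>F x in nhds x0. \<forall>\<xi>\<in>TN x. f' x \<xi> \<in> T (f x)"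
  using smooth_map_at_eventually[OF N W f] by eventually_elim (simp add: tangent_map_in[OF N W])

lemma \<alpha>_smooth: "vf v \<Longrightarrow> smooth_at N (*) x0 (\<lambda>x. \<alpha> (f x) (v x))"
  by (rule one_form_apply_smooth[OF N W f form'])

lemma d_compose:
  assumes "smooth h"
  shows "\<forall>\<^sub>F x in nhds x0. \<forall>\<xi>\<in>TN x. d (\<lambda>x. h (f x)) x \<xi> = differential W h (f x) (f' x \<xi>)"
  using smooth_map_at_eventually[OF N W f] pull[OF smooth_at_eventually[OF W assms]]
  by eventually_elim (simp add: differential_compose[OF N W])

text \<open>The equation L_v \<alpha> = 0 in Cartan's form, for representatives instead of
  germs.\<close>

definition VIset where
  "VIset v \<longleftrightarrow> vf v \<and>
    (\<forall>\<^sub>F x in nhds x0. \<forall>\<xi>\<in>TN x. \<omega> (f x) (v x) (f' x \<xi>) + d (\<lambda>x. \<alpha> (f x) (v x)) x \<xi> = 0)"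

lemma VI_carrier_eq: "VI_carrier N W x0 f \<alpha> = germ x0 ` {v. VIset v}"
proof -
  have "(\<forall>\<^sub>F x in nhds x0. \<forall>\<xi>\<in>TN x. lie_deriv N W x0 f v \<alpha> x \<xi> = 0) \<longleftrightarrow>
      (\<forall>\<^sub>F x in nhds x0. \<forall>\<xi>\<in>TN x. \<omega> (f x) (v x) (f' x \<xi>) + d (\<lambda>x. \<alpha> (f x) (v x)) x \<xi> = 0)"
    if "vf v" for v
    using lie_deriv_cartan[OF N W f that form']
    by (intro eventually_cong) (auto elim: eventually_mono)
  then show ?thesis
    unfolding VI_carrier_def VIset_def by (intro arg_cong[of _ _ "\<lambda>S. germ x0 ` S"]) blast
qed

lemma VIsetD:
  assumes "VIset v"
  shows "vf v" "\<forall>\<^sub>F x in nhds x0. v x \<in> T (f x)"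
    "\<forall>\<^sub>F x in nhds x0. \<forall>\<xi>\<in>TN x. \<omega> (f x) (v x) (f' x \<xi>) = - d (\<lambda>x. \<alpha> (f x) (v x)) x \<xi>"
  using assms vf_along_tangent[of N W x0 f v] by (auto simp: VIset_def eq_neg_iff_add_eq_0)

text \<open>Allows \<alpha>(v) to be replaced by any function h equal to it near the base point; the
  differentials then agree at all nearby points.\<close>

lemma VIsetI:
  assumes v: "vf v" and h: "\<forall>\<^sub>F x in nhds x0. \<alpha> (f x) (v x) = h x"
    and eq: "\<forall>\<^sub>F x in nhds x0. \<forall>\<xi>\<in>TN x. \<omega> (f x) (v x) (f' x \<xi>) = - d h x \<xi>"
  shows "VIset v"
proof -
  have "\<forall>\<^sub>F x in nhds x0. \<forall>\<^sub>F y in nhds x. \<alpha> (f y) (v y) = h y"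
    using h by (simp add: eventually_eventually)
  then have "\<forall>\<^sub>F x in nhds x0. \<forall>\<xi>\<in>TN x. \<omega> (f x) (v x) (f' x \<xi>) + d (\<lambda>x. \<alpha> (f x) (v x)) x \<xi> = 0"
    using eq by eventually_elim (simp add: differential_cong[OF N])
  then show ?thesis
    using v by (simp add: VIset_def)
qed

lemma VIset_add:
  assumes v: "VIset v" and w: "VIset w"
  shows "VIset (\<lambda>x. tadd (v x) (w x))"
proof (rule VIsetI)
  note V = VIsetD[OF v] and U = VIsetD[OF w]
  show "vf (\<lambda>x. tadd (v x) (w x))"
    by (rule vf_along_add[OF N W f V(1) U(1)])
  show "\<forall>\<^sub>F x in nhds x0. \<alpha> (f x) (tadd (v x) (w x)) = \<alpha> (f x) (v x) + \<alpha> (f x) (w x)"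
    using pull[OF contact_points] V(2) U(2) by eventually_elim (simp add: \<alpha>_add)
  show "\<forall>\<^sub>F x in nhds x0. \<forall>\<xi>\<in>TN x. \<omega> (f x) (tadd (v x) (w x)) (f' x \<xi>) =
      - d (\<lambda>x. \<alpha> (f x) (v x) + \<alpha> (f x) (w x)) x \<xi>"
    using pull[OF contact_points] V(2,3) U(2,3) f'_tangent
      smooth_at_eventually[OF N \<alpha>_smooth[OF V(1)]] smooth_at_eventually[OF N \<alpha>_smooth[OF U(1)]]
    by eventually_elim (simp add: \<omega>_add differential_add[OF N])
qed

text \<open>The multiplication \<open>h * v\<close>.\<close>
definition act where
  "act h v = (\<lambda>x. tadd (tscale (h (f x)) (v x)) (tscale (\<alpha> (f x) (v x)) (Z h (f x))))"

lemma act_vf: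
  assumes h: "smooth h" and v: "vf v"
  shows "vf (act h v)"
  unfolding act_def
  by (intro vf_along_add[OF N W f] vf_along_scale[OF N W f] pull_smooth pull_vf \<alpha>_smooth Z h v)

lemma act_\<alpha>:
  assumes h: "smooth h" and v: "vf v"
  shows "\<forall>\<^sub>F x in nhds x0. \<alpha> (f x) (act h v x) = h (f x) * \<alpha> (f x) (v x)"
  using pull[OF contact_points] pull[OF Z(2)[OF h]] pull[OF Z_tangent[OF h]] vf_along_tangent[OF v]
  by eventually_elim (simp add: act_def \<alpha>_add \<alpha>_scale tangent_scale[OF W])

text \<open>The summands of \<open>act h v\<close> supply the two halves of the product rule for h
  \<alpha>(v): the first gives -h d(\<alpha>(v)) because v satisfies the equation, the second gives
  -\<alpha>(v) dh, with h pulled back along f.\<close>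

lemma VIset_act:
  assumes h: "smooth h" and v: "VIset v"
  shows "VIset (act h v)"
proof (rule VIsetI)
  note V = VIsetD[OF v]
  show "vf (act h v)"
    by (rule act_vf[OF h V(1)])
  show "\<forall>\<^sub>F x in nhds x0. \<alpha> (f x) (act h v x) = h (f x) * \<alpha> (f x) (v x)"
    by (rule act_\<alpha>[OF h V(1)])
  show "\<forall>\<^sub>F x in nhds x0. \<forall>\<xi>\<in>TN x. \<omega> (f x) (act h v x) (f' x \<xi>) =
      - d (\<lambda>x. h (f x) * \<alpha> (f x) (v x)) x \<xi>"
    using pull[OF contact_points] pull[OF Z(2)[OF h]] pull[OF Z_tangent[OF h]] V(2,3) f'_tangent integral
      smooth_at_eventually[OF N \<alpha>_smooth[OF V(1)]] smooth_at_eventually[OF N pull_smooth[OF h]] d_compose[OF h]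
  proof eventually_elim
    case (elim x)
    show ?case
    proof
      fix \<xi> assume \<xi>: "\<xi> \<in> TN x"
      \<comment> \<open>The image of \<xi> lies in the kernel of \<alpha>, so the summand dh(R)
        \<alpha> in the equation for \<open>Z h\<close> disappears.\<close>
      then have "\<omega> (f x) (Z h (f x)) (f' x \<xi>) = - d (\<lambda>x. h (f x)) x \<xi>"
        using elim(2,6,7,10) by simp
      then show "\<omega> (f x) (act h v x) (f' x \<xi>) = - d (\<lambda>x. h (f x) * \<alpha> (f x) (v x)) x \<xi>"
        using elim(1,3-6,8,9) \<xi>
        by (simp add: act_def \<omega>_add \<omega>_scale tangent_scale[OF W] differential_mult[OF N] mult.commute)
    qed
  qed
qed

text \<open>The summand H R of X_H cancels against the subtracted one and leaves \<open>Z\<close>;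
  \<open>Z_cong\<close> absorbs the passage to the representative picked by
  \<open>rep\<close>.\<close>

lemma star_germ:
  assumes h: "smooth h"
  shows "star W x0 f \<alpha> (germ w0 h) (germ x0 v) = germ x0 (act h v)"
proof -
  let ?h = "rep (germ w0 h)"
  have h': "smooth ?h"
    by (rule smooth_at_cong[OF W h eventually_mono[OF rep_germ[of w0 h]]]) simp
  have "\<forall>\<^sub>F x in nhds x0. (\<lambda>c. rep (pullback x0 f (germ w0 h)) x *s rep (germ x0 v) x c +
     rep (contraction x0 f \<alpha> (germ x0 v)) x *s
       (rep (ham_field W (f x0) \<alpha> (germ w0 h)) (f x) c - ?h (f x) *s rep (reeb W (f x0) \<alpha>) (f x) c)) = act h v x"
    unfolding pullback_def contraction_def fx0 ham_field_eq[OF h'] reeb_eq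
    using rep_germ[of x0 "\<lambda>x. ?h (f x)"] rep_germ[of x0 v] rep_germ[of x0 "\<lambda>x. \<alpha> (f x) (rep (germ x0 v) x)"]
      pull[OF rep_germ[of w0 "\<lambda>q. tadd (tscale (?h q) (R q)) (Z ?h q)"]]
      pull[OF rep_germ[of w0 R]] pull[OF rep_germ[of w0 h]] pull[OF Z_cong[OF h' rep_germ[of w0 h]]]
    by eventually_elim (simp add: act_def tadd_def tscale_def)
  then show ?thesis
    by (simp add: star_def germ_eq_iff)
qed

section \<open>The module axioms for infinitesimal integral deformations\<close>

abbreviation "E \<equiv> fun_germs W w0"
abbreviation "Rf \<equiv> R_mod N W x0 f"
abbreviation "e \<equiv> contraction x0 f \<alpha>"
abbreviation "M \<equiv> VI N W x0 f \<alpha>"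

lemma M_carrier: "V \<in> carrier M \<longleftrightarrow> (\<exists>v. V = germ x0 v \<and> VIset v)"
  by (auto simp: VI_def VI_carrier_eq)

lemma M_add: "germ x0 u \<oplus>\<^bsub>M\<^esub> germ x0 v = germ x0 (\<lambda>x. tadd (u x) (v x))"
proof -
  have "\<forall>\<^sub>F x in nhds x0. tadd (rep (germ x0 u) x) (rep (germ x0 v) x) = tadd (u x) (v x)"
    using rep_germ[of x0 u] rep_germ[of x0 v] by eventually_elim simp
  then show ?thesis
    by (simp add: VI_def germ_eq_iff)
qed

lemma M_zero: "\<zero>\<^bsub>M\<^esub> = germ x0 (\<lambda>_ _. 0)"
  by (simp add: VI_def)

lemma M_smult: "smooth h \<Longrightarrow> germ w0 h \<odot>\<^bsub>M\<^esub> germ x0 v = germ x0 (act h v)"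
  by (simp add: VI_def star_germ)

lemma act_add:
  assumes g: "smooth g" and h: "smooth h"
  shows "\<forall>\<^sub>F x in nhds x0. act (\<lambda>q. g q + h q) v x = tadd (act g v x) (act h v x)"
  using pull[OF Z_add[OF g h]]
proof eventually_elim
  case (elim x)
  show ?case
    unfolding act_def elim[symmetric]
    by (simp add: tadd_def tscale_def fun_eq_iff vec_eq_iff algebra_simps)
qed

text \<open>\<open>Z\<close> vanishes on constants, so these act by ordinary scaling. The unit law
  (k = 1) and additive inverses (k = -1) follow.\<close>

lemma act_const:
  "\<forall>\<^sub>F x in nhds x0. act (\<lambda>_. k) v x = tscale k (v x)"
  using pull[OF Z_const[of k]]
  by eventually_elim (simp add: act_def tadd_def tscale_def fun_eq_iff)

lemma act_tadd:
  assumes u: "vf u" and v: "vf v"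
  shows "\<forall>\<^sub>F x in nhds x0. act h (\<lambda>x. tadd (u x) (v x)) x = tadd (act h u x) (act h v x)"
  using pull[OF contact_points] vf_along_tangent[OF u] vf_along_tangent[OF v]
  by eventually_elim
    (simp add: act_def \<alpha>_add, simp add: tadd_def tscale_def fun_eq_iff vec_eq_iff algebra_simps)

text \<open>Since \<open>Z h\<close> lies in the kernel of \<alpha>, the contraction of
  \<open>act h v\<close> is h \<alpha>(v). Acting once more therefore yields g h v + \<alpha>(v) (g
  Z_h + h Z_g), and the bracket is Z of the product by \<open>Z_mult\<close>.\<close>

lemma act_act:
  assumes g: "smooth g" and h: "smooth h" and v: "vf v"
  shows "\<forall>\<^sub>F x in nhds x0. act (\<lambda>q. g q * h q) v x = act g (act h v) x"
  using pull[OF Z_mult[OF g h]] act_\<alpha>[OF h v]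
proof eventually_elim
  case (elim x)
  have "act g (act h v) x = tadd (tscale (g (f x)) (act h v x)) (tscale (h (f x) * \<alpha> (f x) (v x)) (Z g (f x)))"
    using elim(2) by (simp add: act_def[of g])
  then show ?case
    unfolding act_def[of "\<lambda>q. g q * h q"] elim(1)[symmetric] act_def[of h]
    by (simp add: tadd_def tscale_def fun_eq_iff vec_eq_iff algebra_simps)
qed

lemma VIset_zero: "VIset (\<lambda>_ _. 0)"
proof (rule VIsetI)
  show "vf (\<lambda>_ _. 0)"
    by (rule vf_along_zero[OF N W])
  show "\<forall>\<^sub>F x in nhds x0. \<alpha> (f x) (\<lambda>_. 0) = 0"
    using pull[OF contact_points] by eventually_elim (simp add: \<alpha>_zero)
  show "\<forall>\<^sub>F x in nhds x0. \<forall>\<xi>\<in>TN x. \<omega> (f x) (\<lambda>_. 0) (f' x \<xi>) = - d (\<lambda>_. 0) x \<xi>"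
    using pull[OF contact_points] f'_tangent by eventually_elim (simp add: \<omega>_zero differential_const[OF N])
qed

lemma VI_module: "Module.module E M"
proof (rule Module.moduleI)
  show "cring E"
    by (rule fun_germs_cring[OF W])
  have one: "smooth (\<lambda>_. k)" for k :: 'k
    by (rule smooth_at_const[OF W vector_space_mult])
  show "abelian_group M"
  proof (rule abelian_groupI)
    fix a assume "a \<in> carrier M"
    then obtain v where v: "a = germ x0 v" "VIset v"
      by (auto simp: M_carrier)
    \<comment> \<open>The additive inverse is obtained as the action of the constant -1, which keeps
      it inside the carrier by \<open>VIset_act\<close>.\<close>
    have "\<forall>\<^sub>F x in nhds x0. tadd (act (\<lambda>_. -1) v x) (v x) = (\<lambda>_. 0)"
      using act_const[of "-1" v] by eventually_elim (simp add: tadd_def tscale_def fun_eq_iff vec_eq_iff)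
    then have "germ x0 (act (\<lambda>_. -1) v) \<oplus>\<^bsub>M\<^esub> a = \<zero>\<^bsub>M\<^esub>"
      by (simp add: v M_add M_zero germ_eq_iff)
    moreover have "germ x0 (act (\<lambda>_. -1) v) \<in> carrier M"
      using VIset_act[OF one v(2), of "-1"] unfolding M_carrier by blast
    ultimately show "\<exists>y\<in>carrier M. y \<oplus>\<^bsub>M\<^esub> a = \<zero>\<^bsub>M\<^esub>"
      by blast
  qed (auto simp: M_carrier M_add M_zero tadd_def add_ac intro: VIset_add[unfolded tadd_def] VIset_zero)
  fix a b x assume "a \<in> carrier E" "x \<in> carrier M"
  then obtain g v where g: "a = germ w0 g" "smooth g" and v: "x = germ x0 v" "VIset v"
    by (auto simp: M_carrier fun_germs_carrier)
  show "a \<odot>\<^bsub>M\<^esub> x \<in> carrier M"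
    using VIset_act[OF g(2) v(2)] by (auto simp: M_carrier M_smult g v)
  assume "b \<in> carrier E"
  then obtain h where h: "b = germ w0 h" "smooth h"
    by (auto simp: fun_germs_carrier)
  show "(a \<oplus>\<^bsub>E\<^esub> b) \<odot>\<^bsub>M\<^esub> x = a \<odot>\<^bsub>M\<^esub> x \<oplus>\<^bsub>M\<^esub> b \<odot>\<^bsub>M\<^esub> x"
    using act_add[OF g(2) h(2)]
    by (simp add: g h v fun_germs_add M_smult M_add smooth_at_add[OF W] germ_eq_iff)
  show "(a \<otimes>\<^bsub>E\<^esub> b) \<odot>\<^bsub>M\<^esub> x = a \<odot>\<^bsub>M\<^esub> (b \<odot>\<^bsub>M\<^esub> x)"
    using act_act[OF g(2) h(2) VIsetD(1)[OF v(2)]]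
    by (simp add: g h v fun_germs_mult M_smult smooth_at_mult[OF W] germ_eq_iff)
next
  fix a x y assume "a \<in> carrier E" "x \<in> carrier M" "y \<in> carrier M"
  then obtain g u v where g: "a = germ w0 g" "smooth g"
    and u: "x = germ x0 u" "VIset u" and v: "y = germ x0 v" "VIset v"
    by (auto simp: M_carrier fun_germs_carrier)
  show "a \<odot>\<^bsub>M\<^esub> (x \<oplus>\<^bsub>M\<^esub> y) = a \<odot>\<^bsub>M\<^esub> x \<oplus>\<^bsub>M\<^esub> a \<odot>\<^bsub>M\<^esub> y"
    using act_tadd[OF VIsetD(1)[OF u(2)] VIsetD(1)[OF v(2)]]
    by (simp add: g u v M_smult M_add germ_eq_iff)
next
  fix x assume "x \<in> carrier M"
  then obtain v where v: "x = germ x0 v" "VIset v"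
    by (auto simp: M_carrier)
  have "\<forall>\<^sub>F x in nhds x0. act (\<lambda>_. 1) v x = v x"
    using act_const[of 1 v] by eventually_elim (simp add: tscale_def)
  then show "\<one>\<^bsub>E\<^esub> \<odot>\<^bsub>M\<^esub> x = x"
    by (simp add: v fun_germs_one M_smult smooth_at_const[OF W vector_space_mult] germ_eq_iff)
qed

section \<open>The image of the contraction\<close>

definition Rset where
  "Rset h \<longleftrightarrow> smooth_at N (*) x0 h \<and>
     (\<exists>(r::nat) a H. (\<forall>i<r. smooth_at N (*) x0 (a i) \<and> smooth_at W (*) (f x0) (H i)) \<and>
       (\<forall>\<^sub>F x in nhds x0. \<forall>\<xi>\<in>TN x. d h x \<xi> = (\<Sum>i<r. a i x * d (H i \<circ> f) x \<xi>)))"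

lemma R_mod_carrier: "carrier Rf = germ x0 ` {h. Rset h}"
  by (simp add: R_mod_def Rset_def)

lemma contraction_germ: "e (germ x0 v) = germ x0 (\<lambda>x. \<alpha> (f x) (v x))"
proof -
  have "\<forall>\<^sub>F x in nhds x0. \<alpha> (f x) (rep (germ x0 v) x) = \<alpha> (f x) (v x)"
    using rep_germ[of x0 v] by eventually_elim simp
  then show ?thesis
    by (simp add: contraction_def germ_eq_iff)
qed

text \<open>The equation for v says that d(\<alpha>(v)) is minus d\<alpha>(v, .) on images of
  tangent vectors. The components of such an image are the differentials of the pulled back
  coordinates, so the coordinates of a chart of W serve as H_i, with the coefficients -d\<alpha>(v,
  e_i).\<close>

lemma VIset_imp_Rset:
  assumes v: "VIset v"
  shows "Rset (\<lambda>x. \<alpha> (f x) (v x))"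
proof -
  note V = VIsetD[OF v]
  let ?c = "some_chart W w0"
  note c = some_chart_in[OF W, of w0]
  \<comment> \<open>Sums in the definition of R_f run over natural numbers, whereas coordinates are
    indexed by the type \<open>'m\<close>.\<close>
  obtain \<sigma> where \<sigma>: "bij_betw \<sigma> {0..<CARD('m)} (UNIV :: 'm set)"
    using ex_bij_betw_nat_finite[of "UNIV :: 'm set"] by auto
  define a where "a = (\<lambda>i x. - \<omega> (f x) (v x) (coord_vec W ?c (axis (\<sigma> i) 1) (f x)))"
  define H where "H = (\<lambda>i q. snd ?c q $ \<sigma> i)"
  have H: "smooth (H i)" for i
    unfolding H_def by (rule differential_coord(1)[OF W c tangent_zero[OF W]])
  have "smooth_at N (*) x0 (a i)" for i
    unfolding a_def
    by (intro smooth_at_uminus[OF N] ext_deriv_along_smooth[OF N W f form' V(1)]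
        vf_along_coord_vec[OF N W f] smooth_at_const[OF N vector_space_vec]) (simp add: fx0 c)
  moreover have "\<forall>\<^sub>F x in nhds x0. \<forall>\<xi>\<in>TN x. d (\<lambda>x. \<alpha> (f x) (v x)) x \<xi> =
      (\<Sum>i<CARD('m). a i x * d (H i \<circ> f) x \<xi>)"
    using pull[OF contact_points] V(2,3) f'_tangent pull[OF charts_at_eventually[OF W c]] smooth_map_at_eventually[OF N W f]
  proof eventually_elim
    case (elim x)
    show ?case
    proof
      fix \<xi> assume \<xi>: "\<xi> \<in> TN x"
      then have T: "f' x \<xi> \<in> T (f x)"
        using elim(4) by blast
      have dH: "d (H i \<circ> f) x \<xi> = f' x \<xi> ?c $ \<sigma> i" for i
        using differential_compose[OF N W elim(6) differential_coord(1)[OF W elim(5) T] \<xi>]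
          differential_coord(2)[OF W elim(5) T]
        by (simp add: H_def comp_def)
      have "d (\<lambda>x. \<alpha> (f x) (v x)) x \<xi> = - \<omega> (f x) (v x) (f' x \<xi>)"
        using elim(3) \<xi> by simp
      also have "\<omega> (f x) (v x) (f' x \<xi>) = (\<Sum>j\<in>UNIV. f' x \<xi> ?c $ j * \<omega> (f x) (v x) (coord_vec W ?c (axis j 1) (f x)))"
        using elim(1) by (intro linear_form_expand[OF W ext_deriv_linear_right[OF W _ elim(2)] elim(5) T])
          (simp add: contact_point_def)
      also have "\<dots> = (\<Sum>i\<in>{0..<CARD('m)}. f' x \<xi> ?c $ \<sigma> i * \<omega> (f x) (v x) (coord_vec W ?c (axis (\<sigma> i) 1) (f x)))"
        by (rule sum.reindex_bij_betw[OF \<sigma>, symmetric])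
      finally show "d (\<lambda>x. \<alpha> (f x) (v x)) x \<xi> = (\<Sum>i<CARD('m). a i x * d (H i \<circ> f) x \<xi>)"
        by (simp add: dH a_def sum_negf atLeast0LessThan mult.commute)
    qed
  qed
  ultimately show ?thesis
    using \<alpha>_smooth[OF V(1)] H unfolding Rset_def fx0
    by (intro conjI exI[of _ "CARD('m)"] exI[of _ a] exI[of _ H]) auto
qed

lemma Rset_imp_VIset:
  assumes h: "Rset h"
  shows "\<exists>v. VIset v \<and> (\<forall>\<^sub>F x in nhds x0. \<alpha> (f x) (v x) = h x)"
proof -
  obtain r a H where a: "\<And>i. i < (r::nat) \<Longrightarrow> smooth_at N (*) x0 (a i)"
    and H: "\<And>i. i < r \<Longrightarrow> smooth (H i)"
    and dh: "\<forall>\<^sub>F x in nhds x0. \<forall>\<xi>\<in>TN x. d h x \<xi> = (\<Sum>i<r. a i x * d (H i \<circ> f) x \<xi>)"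
    and sh: "smooth_at N (*) x0 h"
    using h unfolding Rset_def fx0 by blast
  \<comment> \<open>Builds the sum of the fields a_i Z_(H_i) along f one term at a time, keeping it
    in the kernel of \<alpha>; since f is integral, each term contributes minus a_i times the
    differential of the pulled back H_i.\<close>
  have "\<exists>u. vf u \<and> (\<forall>\<^sub>F x in nhds x0. \<alpha> (f x) (u x) = 0) \<and>
      (\<forall>\<^sub>F x in nhds x0. \<forall>\<xi>\<in>TN x. \<omega> (f x) (u x) (f' x \<xi>) = - (\<Sum>i<k. a i x * d (H i \<circ> f) x \<xi>))"
    if "k \<le> r" for k
    using that
  proof (induction k)
    case 0
    have "\<forall>\<^sub>F x in nhds x0. \<alpha> (f x) (\<lambda>_. 0) = 0"
      using pull[OF contact_points] by eventually_elim (simp add: \<alpha>_zero)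
    moreover have "\<forall>\<^sub>F x in nhds x0. \<forall>\<xi>\<in>TN x. \<omega> (f x) (\<lambda>_. 0) (f' x \<xi>) = 0"
      using pull[OF contact_points] f'_tangent by eventually_elim (simp add: \<omega>_zero)
    ultimately show ?case
      using vf_along_zero[OF N W] by (intro exI[of _ "\<lambda>_ _. 0"]) simp
  next
    case (Suc k)
    from Suc.IH[OF Suc_leD[OF Suc.prems]] obtain u where u: "vf u" "\<forall>\<^sub>F x in nhds x0. \<alpha> (f x) (u x) = 0"
      "\<forall>\<^sub>F x in nhds x0. \<forall>\<xi>\<in>TN x. \<omega> (f x) (u x) (f' x \<xi>) = - (\<Sum>i<k. a i x * d (H i \<circ> f) x \<xi>)"
      by blast
    have ak: "smooth_at N (*) x0 (a k)" and Hk: "smooth (H k)"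
      using Suc.prems by (simp_all add: a H)
    let ?u = "\<lambda>x. tadd (u x) (tscale (a k x) (Z (H k) (f x)))"
    note ev = pull[OF contact_points] vf_along_tangent[OF u(1)] pull[OF Z(2)[OF Hk]] pull[OF Z_tangent[OF Hk]]
    have "vf ?u"
      by (intro vf_along_add[OF N W f] vf_along_scale[OF N W f] u(1) ak pull_vf Z(1) Hk)
    moreover have "\<forall>\<^sub>F x in nhds x0. \<alpha> (f x) (?u x) = 0"
      using ev u(2) by eventually_elim (simp add: \<alpha>_add \<alpha>_scale tangent_scale[OF W])
    moreover have "\<forall>\<^sub>F x in nhds x0. \<forall>\<xi>\<in>TN x. \<omega> (f x) (?u x) (f' x \<xi>) = - (\<Sum>i<Suc k. a i x * d (H i \<circ> f) x \<xi>)"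
      using ev u(3) f'_tangent integral d_compose[OF Hk]
      by eventually_elim (simp add: \<omega>_add \<omega>_scale tangent_scale[OF W] comp_def)
    ultimately show ?case
      by (intro exI[of _ ?u]) blast
  qed
  from this[OF order.refl] obtain u where u: "vf u" "\<forall>\<^sub>F x in nhds x0. \<alpha> (f x) (u x) = 0"
    "\<forall>\<^sub>F x in nhds x0. \<forall>\<xi>\<in>TN x. \<omega> (f x) (u x) (f' x \<xi>) = - (\<Sum>i<r. a i x * d (H i \<circ> f) x \<xi>)"
    by blast
  \<comment> \<open>Adding h R raises \<alpha> from 0 to h and leaves d\<alpha> unchanged, since
    d\<alpha>(R, u) = 0.\<close>
  let ?v = "\<lambda>x. tadd (u x) (tscale (h x) (R (f x)))"
  note ev = pull[OF contact_points] vf_along_tangent[OF u(1)] pull[OF R(2)] pull[OF R_tangent]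
  have v: "vf ?v"
    by (intro vf_along_add[OF N W f] vf_along_scale[OF N W f] u(1) sh pull_vf R(1))
  have v\<alpha>: "\<forall>\<^sub>F x in nhds x0. \<alpha> (f x) (?v x) = h x"
    using ev u(2) by eventually_elim (simp add: \<alpha>_add \<alpha>_scale tangent_scale[OF W])
  have "\<forall>\<^sub>F x in nhds x0. \<forall>\<xi>\<in>TN x. \<omega> (f x) (?v x) (f' x \<xi>) = - d h x \<xi>"
    using ev u(3) f'_tangent dh by eventually_elim (simp add: \<omega>_add \<omega>_scale tangent_scale[OF W])
  then show ?thesis
    using VIsetI[OF v v\<alpha>] v\<alpha> by blast
qed

text \<open>Surjectivity combines the two inclusions just proved. Compatibility of e with the module
  action is \<open>act_\<alpha>\<close>: the correction term lies in the kernel of \<alpha>, so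
  \<alpha> sees only ordinary multiplication.\<close>

lemma VI_short_exact:
  "short_exact E
     (M\<lparr>carrier := kernel (add_monoid M) (add_monoid Rf) e\<rparr>)
     (\<lambda>v. v) M e Rf"
proof (rule short_exact_kernel[OF VI_module])
  have ops: "\<zero>\<^bsub>Rf\<^esub> = germ x0 (\<lambda>_. 0)"
    "germ x0 g \<oplus>\<^bsub>Rf\<^esub> germ x0 h = germ x0 (\<lambda>x. g x + h x)" for g h
    using fun_germs_add[where p = x0 and A = N and g = g and h = h] fun_germs_zero[where p = x0 and A = N] by (simp_all add: R_mod_def)
  show "e ` carrier M = carrier Rf"
  proof (intro equalityI subsetI)
    fix y assume "y \<in> e ` carrier M"
    then obtain v where "VIset v" "y = germ x0 (\<lambda>x. \<alpha> (f x) (v x))"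
      by (auto simp: M_carrier contraction_germ)
    then show "y \<in> carrier Rf"
      using VIset_imp_Rset by (auto simp: R_mod_carrier)
  next
    fix y assume "y \<in> carrier Rf"
    then obtain h where "y = germ x0 h" "Rset h"
      by (auto simp: R_mod_carrier)
    moreover then obtain v where "VIset v" "\<forall>\<^sub>F x in nhds x0. \<alpha> (f x) (v x) = h x"
      using Rset_imp_VIset by blast
    ultimately have "y = e (germ x0 v)" "germ x0 v \<in> carrier M"
      by (auto simp: contraction_germ germ_eq_iff M_carrier elim: eventually_mono)
    then show "y \<in> e ` carrier M"
      by blast
  qed
  have "\<forall>\<^sub>F x in nhds x0. \<alpha> (f x) (\<lambda>_. 0) = 0"
    using pull[OF contact_points] by eventually_elim (simp add: \<alpha>_zero)
  then show "e \<zero>\<^bsub>M\<^esub> = \<zero>\<^bsub>Rf\<^esub>"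
    by (simp add: M_zero contraction_germ ops germ_eq_iff)
  show "e (x \<oplus>\<^bsub>M\<^esub> y) = e x \<oplus>\<^bsub>Rf\<^esub> e y"
    if xy: "x \<in> carrier M" "y \<in> carrier M" for x y
  proof -
    obtain u v where uv: "x = germ x0 u" "y = germ x0 v" "VIset u" "VIset v"
      using xy by (auto simp: M_carrier)
    have "\<forall>\<^sub>F x in nhds x0. \<alpha> (f x) (tadd (u x) (v x)) = \<alpha> (f x) (u x) + \<alpha> (f x) (v x)"
      using pull[OF contact_points] VIsetD(2)[OF uv(3)] VIsetD(2)[OF uv(4)] by eventually_elim (simp add: \<alpha>_add)
    then show ?thesis
      by (simp add: uv M_add contraction_germ ops germ_eq_iff)
  qed
  show "e (r \<odot>\<^bsub>M\<^esub> x) = r \<odot>\<^bsub>Rf\<^esub> e x"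
    if r: "r \<in> carrier E" and x: "x \<in> carrier M" for r x
  proof -
    obtain h v where hv: "r = germ w0 h" "smooth h" "x = germ x0 v" "VIset v"
      using r x by (auto simp: M_carrier fun_germs_carrier)
    have "\<forall>\<^sub>F x in nhds x0. \<alpha> (f x) (act h v x) = rep (germ w0 h) (f x) * \<alpha> (f x) (v x)"
      using act_\<alpha>[OF hv(2) VIsetD(1)[OF hv(4)]] pull[OF rep_germ[of w0 h]] by eventually_elim simp
    then show ?thesis
      using fun_germs_mult[where p = x0 and A = N and g = "\<lambda>x. rep (germ w0 h) (f x)" and h = "\<lambda>x. \<alpha> (f x) (v x)"]
      by (simp add: hv M_smult contraction_germ R_mod_def pullback_def germ_eq_iff)
  qed
qed

end

section \<open>Change of the contact form\<close>

locale two_contact_forms = A: integral_germ W w0 \<alpha> N x0 f + B: integral_germ W w0 \<beta> N x0 f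
  for W :: "('w::{t2_space,second_countable_topology}, 'k::{real_normed_field,euclidean_space}, 'm::finite) chart set"
    and w0 \<alpha> \<beta> and N :: "('x::{t2_space,second_countable_topology}, 'k, 'n::finite) chart set" and x0 f +
  assumes same_kernel: "\<forall>\<^sub>F q in nhds w0. \<forall>u\<in>tangent_space W q. \<alpha> q u = 0 \<longleftrightarrow> \<beta> q u = 0"
begin

text \<open>The factor g with \<beta> = g \<alpha>, read off on the Reeb field of \<alpha>, where
  \<alpha> takes the value 1.\<close>

definition ratio where "ratio q = \<beta> q (A.R q)"

lemma ratio_smooth: "smooth_at W (*) w0 ratio"
  unfolding ratio_def[abs_def]
  using one_form_apply_smooth[OF A.W A.W smooth_map_at_id[OF A.W] _ A.R(1), of \<beta>] B.form by simp

text \<open>The vector u - \<alpha>(u) R lies in the kernel of \<alpha>, hence in that of \<beta>,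
  which gives the formula. The factor is nonzero because R lies outside the common kernel.\<close>

lemma ratio: "\<forall>\<^sub>F q in nhds w0. ratio q \<noteq> 0 \<and> (\<forall>u\<in>tangent_space W q. \<beta> q u = ratio q * \<alpha> q u)"
  using same_kernel A.R(2) A.R_tangent A.contact_points B.contact_points
proof eventually_elim
  case (elim q)
  have "\<beta> q u = ratio q * \<alpha> q u" if u: "u \<in> tangent_space W q" for u
  proof -
    let ?w = "tscale (- \<alpha> q u) (A.R q)"
    have w: "?w \<in> tangent_space W q"
      using elim(3) by (rule tangent_scale[OF A.W])
    have "\<alpha> q (tadd u ?w) = 0"
      using elim(2,3) u w by (simp add: A.\<alpha>_add[OF elim(4)] A.\<alpha>_scale[OF elim(4)])
    then have "\<beta> q (tadd u ?w) = 0"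
      using elim(1) tangent_add[OF A.W u w] by blast
    then show ?thesis
      using elim(3) u w by (simp add: B.\<alpha>_add[OF elim(5)] B.\<alpha>_scale[OF elim(5)] ratio_def mult.commute)
  qed
  moreover have "ratio q \<noteq> 0"
    using elim(1,2,3) unfolding ratio_def by (metis zero_neq_one)
  ultimately show ?case
    by blast
qed

lemma ext_deriv_ratio:
  "\<forall>\<^sub>F q in nhds w0. \<forall>u\<in>tangent_space W q. \<forall>v\<in>tangent_space W q. B.\<omega> q u v =
    ratio q * A.\<omega> q u v + differential W ratio q u * \<alpha> q v - differential W ratio q v * \<alpha> q u"
proof -
  have "\<forall>\<^sub>F q in nhds w0. \<forall>\<^sub>F r in nhds q. \<forall>u\<in>tangent_space W r. \<beta> r u = ratio r * \<alpha> r u"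
    unfolding eventually_eventually using ratio by (rule eventually_mono) blast
  then show ?thesis
    using A.contact_points B.contact_points smooth_at_eventually[OF A.W ratio_smooth]
    by eventually_elim (auto simp: contact_point_def intro: ext_deriv_scale[OF A.W])
qed

text \<open>With g the ratio, d\<beta> carries two extra terms in dg. The one with \<alpha>(v)
  cancels against the product rule for d(g \<alpha>(v)), and the one with \<alpha> of the image of
  \<xi> vanishes by integrality. The two equations then differ by the nonzero factor g.\<close>

lemma VIset_ratio: "B.VIset v \<longleftrightarrow> A.VIset v"
proof -
  have "(\<forall>\<^sub>F x in nhds x0. \<forall>\<xi>\<in>tangent_space N x. B.\<omega> (f x) (v x) (A.f' x \<xi>) + A.d (\<lambda>x. \<beta> (f x) (v x)) x \<xi> = 0) \<longleftrightarrow>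
      (\<forall>\<^sub>F x in nhds x0. \<forall>\<xi>\<in>tangent_space N x. A.\<omega> (f x) (v x) (A.f' x \<xi>) + A.d (\<lambda>x. \<alpha> (f x) (v x)) x \<xi> = 0)"
    if v: "vf_along N W x0 f v"
  proof (rule eventually_cong)
    have "\<forall>\<^sub>F x in nhds x0. \<beta> (f x) (v x) = ratio (f x) * \<alpha> (f x) (v x)"
      using A.pull[OF ratio] vf_along_tangent[OF v] by eventually_elim blast
    then have "\<forall>\<^sub>F x in nhds x0. \<forall>\<^sub>F y in nhds x. \<beta> (f y) (v y) = ratio (f y) * \<alpha> (f y) (v y)"
      by (simp add: eventually_eventually)
    then show "\<forall>\<^sub>F x in nhds x0. \<forall>\<xi>\<in>tangent_space N x.
        B.\<omega> (f x) (v x) (A.f' x \<xi>) + A.d (\<lambda>x. \<beta> (f x) (v x)) x \<xi> =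
        ratio (f x) * (A.\<omega> (f x) (v x) (A.f' x \<xi>) + A.d (\<lambda>x. \<alpha> (f x) (v x)) x \<xi>) \<and> ratio (f x) \<noteq> 0"
      using A.pull[OF ext_deriv_ratio] vf_along_tangent[OF v] A.f'_tangent A.integral A.d_compose[OF ratio_smooth]
        smooth_at_eventually[OF A.N A.\<alpha>_smooth[OF v]] smooth_at_eventually[OF A.N A.pull_smooth[OF ratio_smooth]]
        A.pull[OF ratio]
      by eventually_elim
        (simp add: differential_cong[OF A.N] differential_mult[OF A.N] algebra_simps)
  qed auto
  then show ?thesis
    unfolding A.VIset_def B.VIset_def by blast
qed

text \<open>On the common kernel the terms with dg vanish, so d\<beta> is g d\<alpha> there. Hence g
  times the field for \<beta> satisfies the conditions that characterise the field for
  \<alpha>.\<close>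

lemma Z_ratio:
  assumes h: "smooth_at W (*) w0 h"
  shows "\<forall>\<^sub>F q in nhds w0. A.Z h q = tscale (ratio q) (B.Z h q)"
proof -
  have "\<forall>\<^sub>F q in nhds w0. tscale (ratio q) (B.Z h q) \<in> tangent_space W q \<and>
      \<alpha> q (tscale (ratio q) (B.Z h q)) = 0 \<and>
      (\<forall>u\<in>tangent_space W q. \<alpha> q u = 0 \<longrightarrow> A.\<omega> q (tscale (ratio q) (B.Z h q)) u = - differential W h q u)"
    using A.contact_points B.Z(2)[OF h] B.Z_tangent[OF h] ratio ext_deriv_ratio
  proof eventually_elim
    case (elim q)
    then have 0: "\<alpha> q (B.Z h q) = 0"
      by auto
    have "ratio q * A.\<omega> q (B.Z h q) u = - differential W h q u" if u: "u \<in> tangent_space W q" "\<alpha> q u = 0" for u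
    proof -
      have "B.\<omega> q (B.Z h q) u = - differential W h q u"
        using elim(2,4) u by simp
      then show ?thesis
        using elim(3,5) u 0 by simp
    qed
    then show ?case
      using elim(3) 0 by (simp add: A.\<alpha>_scale[OF elim(1)] A.\<omega>_scale[OF elim(1)] tangent_scale[OF A.W])
  qed
  from A.Z_unique[OF h this] show ?thesis
    by (rule eventually_mono) simp
qed

lemma act_ratio:
  assumes h: "smooth_at W (*) w0 h" and v: "vf_along N W x0 f v"
  shows "\<forall>\<^sub>F x in nhds x0. B.act h v x = A.act h v x"
  using A.pull[OF Z_ratio[OF h]] A.pull[OF ratio] vf_along_tangent[OF v]
  by eventually_elim (simp add: A.act_def B.act_def tscale_def vector_smult_assoc mult.commute)

lemma VI_independent:
  "carrier (VI N W x0 f \<beta>) = carrier (VI N W x0 f \<alpha>)"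
  "H \<in> carrier (fun_germs W w0) \<Longrightarrow> V \<in> carrier (VI N W x0 f \<alpha>) \<Longrightarrow>
    H \<odot>\<^bsub>VI N W x0 f \<beta>\<^esub> V = H \<odot>\<^bsub>VI N W x0 f \<alpha>\<^esub> V"
proof -
  show "carrier (VI N W x0 f \<beta>) = carrier (VI N W x0 f \<alpha>)"
    by (auto simp: A.M_carrier B.M_carrier VIset_ratio)
  assume "H \<in> carrier (fun_germs W w0)" "V \<in> carrier (VI N W x0 f \<alpha>)"
  then obtain h v where hv: "H = germ w0 h" "smooth_at W (*) w0 h" "V = germ x0 v" "A.VIset v"
    by (auto simp: A.M_carrier fun_germs_carrier)
  then show "H \<odot>\<^bsub>VI N W x0 f \<beta>\<^esub> V = H \<odot>\<^bsub>VI N W x0 f \<alpha>\<^esub> V"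
    using act_ratio[OF hv(2) A.VIsetD(1)[OF hv(4)]] by (simp add: A.M_smult B.M_smult germ_eq_iff)
qed

end

theorem proposition6p3:
  fixes N :: "('x::{t2_space,second_countable_topology}, 'k::{real_normed_field,euclidean_space}, 'n::finite) chart set"
    and W :: "('w::{t2_space,second_countable_topology}, 'k, 'm::finite) chart set"
    and D :: "'w \<Rightarrow> ('w, 'k, 'm) tangent set"
    and f :: "'x \<Rightarrow> 'w" and x0 :: 'x and w0 :: 'w
    and \<alpha> :: "('w, 'k, 'm) form"
  assumes "manifold W" and "CARD('m) = 2 * CARD('n) + 1" and "contact_structure W D"
    and "manifold N"
    and "smooth_map_at N W x0 f" and "f x0 = w0" and "integral_at N W D x0 f"
    and "contact_form_at W w0 \<alpha>" and "defines_near W D w0 \<alpha>"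
  shows "Module.module (fun_germs W w0) (VI N W x0 f \<alpha>) \<and>
    (\<forall>\<beta>. contact_form_at W w0 \<beta> \<and> defines_near W D w0 \<beta> \<longrightarrow>
       carrier (VI N W x0 f \<beta>) = carrier (VI N W x0 f \<alpha>) \<and>
       (\<forall>H\<in>carrier (fun_germs W w0). \<forall>v\<in>carrier (VI N W x0 f \<alpha>).
          H \<odot>\<^bsub>VI N W x0 f \<beta>\<^esub> v = H \<odot>\<^bsub>VI N W x0 f \<alpha>\<^esub> v)) \<and>
    short_exact (fun_germs W w0)
      (VI N W x0 f \<alpha>\<lparr>carrier := kernel (add_monoid (VI N W x0 f \<alpha>)) (add_monoid (R_mod N W x0 f))
         (contraction x0 f \<alpha>)\<rparr>)
      (\<lambda>v. v)
      (VI N W x0 f \<alpha>)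
      (contraction x0 f \<alpha>)
      (R_mod N W x0 f)"
proof -
  \<comment> \<open>Tangency to D turns into vanishing of the pulled back form for any form that
    defines D near the base point; the general version serves both contact forms.\<close>
  have igerm: "integral_germ W w0 \<gamma> N x0 f"
    if \<gamma>: "contact_form_at W w0 \<gamma>" "defines_near W D w0 \<gamma>" for \<gamma>
  proof
    have "\<forall>\<^sub>F x in nhds x0. D (f x) = {u \<in> tangent_space W (f x). \<gamma> (f x) u = 0}"
      using eventually_compose_filterlim[OF _ smooth_map_at_filterlim[OF assms(4,1,5)]] \<gamma>(2) assms(6)
      by (simp add: defines_near_def)
    then show "\<forall>\<^sub>F x in nhds x0. \<forall>\<xi>\<in>tangent_space N x. \<gamma> (f x) (tangent_map N W f x \<xi>) = 0"
      using assms(7) unfolding integral_at_def by eventually_elim blast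
  qed (use assms \<gamma> in auto)
  interpret A: integral_germ W w0 \<alpha> N x0 f
    by (rule igerm[OF assms(8,9)])
  have "carrier (VI N W x0 f \<beta>) = carrier (VI N W x0 f \<alpha>) \<and>
      (\<forall>H\<in>carrier (fun_germs W w0). \<forall>v\<in>carrier (VI N W x0 f \<alpha>).
        H \<odot>\<^bsub>VI N W x0 f \<beta>\<^esub> v = H \<odot>\<^bsub>VI N W x0 f \<alpha>\<^esub> v)"
    if \<beta>: "contact_form_at W w0 \<beta>" "defines_near W D w0 \<beta>" for \<beta>
  proof -
    interpret B: integral_germ W w0 \<beta> N x0 f
      by (rule igerm[OF \<beta>])
    interpret two_contact_forms W w0 \<alpha> \<beta> N x0 f
    proof
      show "\<forall>\<^sub>F q in nhds w0. \<forall>u\<in>tangent_space W q. \<alpha> q u = 0 \<longleftrightarrow> \<beta> q u = 0"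
        using assms(9) \<beta>(2) unfolding defines_near_def by eventually_elim blast
    qed
    show ?thesis
      using VI_independent by blast
  qed
  then show ?thesis
    using A.VI_module A.VI_short_exact by blast
qed

end
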